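(* Let $0<s<1<p<\infty$, let $\mathbb{G}$ be a stratified Lie group of homogeneous dimension $Q>sp$, and let $\Omega\subset\mathbb{G}$ be a bounded domain. Consider the eigenvalue problem $$(-\Delta_{p,\mathbb{G}})^su=\nu|u|^{p-2}u\ \text{ in }\Omega,\qquad u=0\ \text{ in }\mathbb{G}\setminus\Omega,$$ and let $\lambda_1=\lambda_1(\Omega)$ be its first eigenvalue. Then: (i) The first eigenfunction is strictly positive: if $\phi$ is an eigenfunction associated to $\lambda_1$, then, after possibly replacing $\phi$ by $-\phi$, $\phi>0$ a.e. in $\Omega$. (ii) The first eigenvalue $\lambda_1$ is simple (any two eigenfunctions associated to $\lambda_1$ are proportional), and the corresponding eigenfunction $\phi_1$ is (up to multiples) the only eigenfunction of constant sign; that is, if $u$ is an eigenfunction associated to an eigenvalue $\nu>\lambda_1(\Omega)$, then $u$ must be sign-changing. (iii) The first eigenvalue $\lambda_1$ is isolated: there is $\varepsilon>0$ such that there is no eigenvalue $\nu\neq\lambda_1$ with $|\nu-\lambda_1|<\varepsilon$.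
   Context: Stratified Lie group: a Lie group $\mathbb{G}=(\mathbb{R}^N,\circ)$ with identity $0$ such that (i) there is a decomposition $\mathbb{R}^N=\mathbb{R}^{N_1}\times\cdots\times\mathbb{R}^{N_k}$ for which, for every $\lambda>0$, the dilation $D_\lambda(x)=(\lambda x^{(1)},\lambda^2x^{(2)},\dots,\lambda^kx^{(k)})$, $x^{(i)}\in\mathbb{R}^{N_i}$, is an automorphism of $\mathbb{G}$; (ii) if $X_1,\dots,X_{N_1}$ are the left-invariant vector fields with $X_j(0)=\partial/\partial x_j|_0$, then the Lie algebra generated by $X_1,\dots,X_{N_1}$ has rank $N$ at every point. The homogeneous dimension is $Q=\sum_{i=1}^k iN_i$. The Haar measure $dx$ is Lebesgue measure on $\mathbb{R}^N$. We write $xy$ for $x\circ y$ and fix a homogeneous quasi-norm $|\cdot|$ on $\mathbb{G}$: a continuous function $|\cdot|:\mathbb{G}\to[0,\infty)$ with $|x|=0$ iff $x=0$, $|x^{-1}|=|x|$, and $|D_\lambda x|=\lambda|x|$ for $\lambda>0$. A domain is a nonempty connected open set. Functions are real-valued. $[u]_{s,p,\mathbb{G}}:=\left(\iint_{\mathbb{G}\times\mathbb{G}}\frac{|u(x)-u(y)|^p}{|y^{-1}x|^{Q+ps}}\,dx\,dy\right)^{1/p}$. $X_0^{s,p}(\Omega)$ is the closure of $C_c^\infty(\Omega)$ with respect to the norm $\|u\|_{L^p(\Omega)}+[u]_{s,p,\mathbb{G}}$, functions being extended by $0$ to $\mathbb{G}\setminus\Omega$. The fractional $p$-sub-Laplacian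 is understood weakly: $$\langle(-\Delta_{p,\mathbb{G}})^su,\varphi\rangle=\iint_{\mathbb{G}\times\mathbb{G}}\frac{|u(x)-u(y)|^{p-2}(u(x)-u(y))(\varphi(x)-\varphi(y))}{|y^{-1}x|^{Q+ps}}\,dx\,dy.$$ A function $u\in X_0^{s,p}(\Omega)$ is a weak solution of the eigenvalue problem if $\langle(-\Delta_{p,\mathbb{G}})^su,\phi\rangle=\nu\int_\Omega|u|^{p-2}u\phi\,dx$ for all $\phi\in C_c^\infty(\Omega)$. If there is a nontrivial weak solution $u$, then $\nu\in\mathbb{R}$ is an eigenvalue and $u$ an eigenfunction associated to $\nu$. The first eigenvalue is $\lambda_1(\Omega)=\inf\{[u]_{s,p,\mathbb{G}}^p:\ u\in X_0^{s,p}(\Omega),\ \|u\|_{L^p(\Omega)}=1\}$, and a first eigenfunction is an eigenfunction associated to $\lambda_1(\Omega)$. *)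

theory Defs
  imports "HOL-Analysis.Analysis"
begin

section \<open>Smooth functions and vector fields\<close>

fun n_times_differentiable ::
    "nat \<Rightarrow> ('a::real_normed_vector \<Rightarrow> 'b::real_normed_vector) \<Rightarrow> bool" where
  "n_times_differentiable 0 f \<longleftrightarrow> continuous_on UNIV f"
| "n_times_differentiable (Suc n) f \<longleftrightarrow>
     (\<forall>x. f differentiable (at x)) \<and>
     (\<forall>v. n_times_differentiable n (\<lambda>x. frechet_derivative f (at x) v))"

definition smooth :: "('a::real_normed_vector \<Rightarrow> 'b::real_normed_vector) \<Rightarrow> bool" where
  "smooth f \<longleftrightarrow> (\<forall>n. n_times_differentiable n f)"

definition test_functions :: "'a::real_normed_vector set \<Rightarrow> ('a \<Rightarrow> real) set" where
  "test_functions \<Omega> =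
     {\<phi>. smooth \<phi> \<and> compact (closure {x. \<phi> x \<noteq> 0}) \<and> closure {x. \<phi> x \<noteq> 0} \<subseteq> \<Omega>}"

definition lie_bracket ::
    "('a::real_normed_vector \<Rightarrow> 'a) \<Rightarrow> ('a \<Rightarrow> 'a) \<Rightarrow> 'a \<Rightarrow> 'a" where
  "lie_bracket X Y =
     (\<lambda>x. frechet_derivative Y (at x) (X x) - frechet_derivative X (at x) (Y x))"

inductive_set lie_algebra_generated ::
    "('a::real_normed_vector \<Rightarrow> 'a) set \<Rightarrow> ('a \<Rightarrow> 'a) set"
  for S :: "('a \<Rightarrow> 'a) set" where
  gen: "X \<in> S \<Longrightarrow> X \<in> lie_algebra_generated S"
| zero: "(\<lambda>_. 0) \<in> lie_algebra_generated S"
| add: "X \<in> lie_algebra_generated S \<Longrightarrow> Y \<in> lie_algebra_generated S \<Longrightarrow>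
     (\<lambda>x. X x + Y x) \<in> lie_algebra_generated S"
| scale: "X \<in> lie_algebra_generated S \<Longrightarrow>
     (\<lambda>x. c *\<^sub>R X x) \<in> lie_algebra_generated S"
| bracket: "X \<in> lie_algebra_generated S \<Longrightarrow> Y \<in> lie_algebra_generated S \<Longrightarrow>
     lie_bracket X Y \<in> lie_algebra_generated S"


section \<open>Stratified Lie groups\<close>

text \<open>
  The decomposition of the space into layers is encoded by \<open>weight\<close>: the \<open>i\<close>-th layer is
  spanned by the coordinates \<open>j\<close> with \<open>weight G j = i\<close>, where \<open>i\<close> ranges over \<open>{1..step G}\<close>.
  The field \<open>qnorm\<close> is the fixed homogeneous quasi-norm.
\<close>

record 'n graded_group =
  gmult :: "real ^ 'n \<Rightarrow> real ^ 'n \<Rightarrow> real ^ 'n"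
  ginv :: "real ^ 'n \<Rightarrow> real ^ 'n"
  weight :: "'n \<Rightarrow> nat"
  step :: nat
  qnorm :: "real ^ 'n \<Rightarrow> real"

definition dilation :: "('n::finite) graded_group \<Rightarrow> real \<Rightarrow> real ^ 'n \<Rightarrow> real ^ 'n" where
  "dilation G r x = (\<chi> j. r ^ weight G j * x $ j)"

definition layer_dim :: "('n::finite) graded_group \<Rightarrow> nat \<Rightarrow> nat" where
  "layer_dim G i = card {j. weight G j = i}"

definition homogeneous_dim :: "('n::finite) graded_group \<Rightarrow> nat" where
  "homogeneous_dim G = (\<Sum>i = 1..step G. i * layer_dim G i)"

definition left_invariant :: "('n::finite) graded_group \<Rightarrow> (real ^ 'n \<Rightarrow> real ^ 'n) \<Rightarrow> bool" where
  "left_invariant G X \<longleftrightarrow>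
     (\<forall>x y. X (gmult G x y) = frechet_derivative (gmult G x) (at y) (X y))"

definition horizontal_fields :: "('n::finite) graded_group \<Rightarrow> (real ^ 'n \<Rightarrow> real ^ 'n) set" where
  "horizontal_fields G =
     {X. left_invariant G X \<and> (\<exists>j. weight G j = 1 \<and> X 0 = axis j 1)}"

definition stratified_lie_group :: "('n::finite) graded_group \<Rightarrow> bool" where
  "stratified_lie_group G \<longleftrightarrow>
     group (gmult G) 0 (ginv G) \<and>
     smooth (\<lambda>(x, y). gmult G x y) \<and> smooth (ginv G) \<and>
     range (weight G) \<subseteq> {1..step G} \<and>
     (\<forall>r>0. bij (dilation G r) \<and>
        (\<forall>x y. dilation G r (gmult G x y) = gmult G (dilation G r x) (dilation G r y))) \<and>
     (\<forall>x. dim {X x | X. X \<in> lie_algebra_generated (horizontal_fields G)} = CARD('n))"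

definition homogeneous_quasi_norm :: "('n::finite) graded_group \<Rightarrow> bool" where
  "homogeneous_quasi_norm G \<longleftrightarrow>
     continuous_on UNIV (qnorm G) \<and>
     (\<forall>x. 0 \<le> qnorm G x) \<and>
     (\<forall>x. qnorm G x = 0 \<longleftrightarrow> x = 0) \<and>
     (\<forall>x. qnorm G (ginv G x) = qnorm G x) \<and>
     (\<forall>r>0. \<forall>x. qnorm G (dilation G r x) = r * qnorm G x)"


section \<open>Fractional Sobolev spaces and the eigenvalue problem\<close>

definition frac_weight ::
    "('n::finite) graded_group \<Rightarrow> real \<Rightarrow> real \<Rightarrow> real ^ 'n \<Rightarrow> real ^ 'n \<Rightarrow> real" where
  "frac_weight G s p x y =
     qnorm G (gmult G (ginv G y) x) powr (real (homogeneous_dim G) + p * s)"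

definition gagliardo_integrand ::
    "('n::finite) graded_group \<Rightarrow> real \<Rightarrow> real \<Rightarrow> (real ^ 'n \<Rightarrow> real) \<Rightarrow> (real ^ 'n) \<times> (real ^ 'n) \<Rightarrow> real" where
  "gagliardo_integrand G s p u =
     (\<lambda>(x, y). \<bar>u x - u y\<bar> powr p / frac_weight G s p x y)"

definition Lp_norm :: "real \<Rightarrow> (real ^ 'n::finite) set \<Rightarrow> (real ^ 'n \<Rightarrow> real) \<Rightarrow> real" where
  "Lp_norm p \<Omega> u = (LINT x:\<Omega>|lebesgue. \<bar>u x\<bar> powr p) powr (1 / p)"

definition gagliardo_seminorm ::
    "('n::finite) graded_group \<Rightarrow> real \<Rightarrow> real \<Rightarrow> (real ^ 'n \<Rightarrow> real) \<Rightarrow> real" where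
  "gagliardo_seminorm G s p u =
     (LINT z|(lebesgue \<Otimes>\<^sub>M lebesgue). gagliardo_integrand G s p u z) powr (1 / p)"

text \<open>
  The Bochner integrals above are 0 for non-integrable integrands, so finiteness of the norm
  is expressed by integrability.  Functions are representatives of their a.e. classes.
\<close>

definition finite_norm ::
    "('n::finite) graded_group \<Rightarrow> real \<Rightarrow> real \<Rightarrow> (real ^ 'n) set \<Rightarrow> (real ^ 'n \<Rightarrow> real) \<Rightarrow> bool" where
  "finite_norm G s p \<Omega> u \<longleftrightarrow>
     u \<in> borel_measurable lebesgue \<and>
     set_integrable lebesgue \<Omega> (\<lambda>x. \<bar>u x\<bar> powr p) \<and>
     integrable (lebesgue \<Otimes>\<^sub>M lebesgue) (gagliardo_integrand G s p u)"

definition X0 ::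
    "('n::finite) graded_group \<Rightarrow> real \<Rightarrow> real \<Rightarrow> (real ^ 'n) set \<Rightarrow> (real ^ 'n \<Rightarrow> real) set" where
  "X0 G s p \<Omega> =
     {u. finite_norm G s p \<Omega> u \<and>
         (AE x in lebesgue. x \<notin> \<Omega> \<longrightarrow> u x = 0) \<and>
         (\<forall>\<epsilon>>0. \<exists>\<phi>\<in>test_functions \<Omega>.
            finite_norm G s p \<Omega> (\<lambda>x. u x - \<phi> x) \<and>
            Lp_norm p \<Omega> (\<lambda>x. u x - \<phi> x) + gagliardo_seminorm G s p (\<lambda>x. u x - \<phi> x) < \<epsilon>)}"

text \<open>For \<open>p < 2\<close> the expression below is 0 at \<open>t = 0\<close>, since \<open>0 powr a = 0\<close>.\<close>

definition signed_power :: "real \<Rightarrow> real \<Rightarrow> real" where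
  "signed_power p t = \<bar>t\<bar> powr (p - 2) * t"

definition frac_p_sub_laplacian ::
    "('n::finite) graded_group \<Rightarrow> real \<Rightarrow> real \<Rightarrow> (real ^ 'n \<Rightarrow> real) \<Rightarrow> (real ^ 'n \<Rightarrow> real) \<Rightarrow> real" where
  "frac_p_sub_laplacian G s p u \<phi> =
     (LINT (x, y)|(lebesgue \<Otimes>\<^sub>M lebesgue).
        signed_power p (u x - u y) * (\<phi> x - \<phi> y) / frac_weight G s p x y)"

definition weak_solution ::
    "('n::finite) graded_group \<Rightarrow> real \<Rightarrow> real \<Rightarrow> (real ^ 'n) set \<Rightarrow> real \<Rightarrow> (real ^ 'n \<Rightarrow> real) \<Rightarrow> bool" where
  "weak_solution G s p \<Omega> \<nu> u \<longleftrightarrow>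
     u \<in> X0 G s p \<Omega> \<and>
     (\<forall>\<phi>\<in>test_functions \<Omega>.
        frac_p_sub_laplacian G s p u \<phi> =
        \<nu> * (LINT x:\<Omega>|lebesgue. signed_power p (u x) * \<phi> x))"

definition eigenfunction ::
    "('n::finite) graded_group \<Rightarrow> real \<Rightarrow> real \<Rightarrow> (real ^ 'n) set \<Rightarrow> real \<Rightarrow> (real ^ 'n \<Rightarrow> real) \<Rightarrow> bool" where
  "eigenfunction G s p \<Omega> \<nu> u \<longleftrightarrow>
     weak_solution G s p \<Omega> \<nu> u \<and> \<not> (AE x in lebesgue. u x = 0)"

definition eigenvalue ::
    "('n::finite) graded_group \<Rightarrow> real \<Rightarrow> real \<Rightarrow> (real ^ 'n) set \<Rightarrow> real \<Rightarrow> bool" where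
  "eigenvalue G s p \<Omega> \<nu> \<longleftrightarrow> (\<exists>u. eigenfunction G s p \<Omega> \<nu> u)"

definition first_eigenvalue ::
    "('n::finite) graded_group \<Rightarrow> real \<Rightarrow> real \<Rightarrow> (real ^ 'n) set \<Rightarrow> real" where
  "first_eigenvalue G s p \<Omega> =
     Inf {gagliardo_seminorm G s p u powr p | u. u \<in> X0 G s p \<Omega> \<and> Lp_norm p \<Omega> u = 1}"

definition first_eigenfunction ::
    "('n::finite) graded_group \<Rightarrow> real \<Rightarrow> real \<Rightarrow> (real ^ 'n) set \<Rightarrow> (real ^ 'n \<Rightarrow> real) \<Rightarrow> bool" where
  "first_eigenfunction G s p \<Omega> u \<longleftrightarrow> eigenfunction G s p \<Omega> (first_eigenvalue G s p \<Omega>) u"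

definition constant_sign :: "(real ^ 'n::finite) set \<Rightarrow> (real ^ 'n \<Rightarrow> real) \<Rightarrow> bool" where
  "constant_sign \<Omega> u \<longleftrightarrow>
     (AE x in lebesgue. x \<in> \<Omega> \<longrightarrow> 0 \<le> u x) \<or> (AE x in lebesgue. x \<in> \<Omega> \<longrightarrow> u x \<le> 0)"

definition sign_changing :: "(real ^ 'n::finite) set \<Rightarrow> (real ^ 'n \<Rightarrow> real) \<Rightarrow> bool" where
  "sign_changing \<Omega> u \<longleftrightarrow>
     0 < emeasure lebesgue {x \<in> \<Omega>. 0 < u x} \<and> 0 < emeasure lebesgue {x \<in> \<Omega>. u x < 0}"

end

(*
  Write I(u) for the p-th power of the seminorm and A(u) for that of the L^p norm. All steps are
  comparisons of integrals; no compactness, embedding theorem or existence of a minimiser enters.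

  The space is stable under Lipschitz functions F with F(0) = 0 (approximate F on the range of a
  test function by polynomials). Hence max and min are available, and pointwise submodularity of
  |.|^p gives I(max u w) + I(min u w) <= I(u) + I(w) with strict inequality unless u <= w or
  w <= u. First eigenfunctions are minimisers, so any two of them are ordered; comparing with 0
  gives constant sign, and comparing with all multiples gives simplicity.

  Positivity: testing the equation of u >= 0 with (g - n u)^+ and letting n tend to infinity
  (reverse Fatou, dominating function |u(x)-u(y)|^(p-1) |g(x)-g(y)|) shows that g vanishes on
  {u = 0}. Suitable g near any point of the domain are obtained by translating and dilating one
  nonzero test function. A positive eigenfunction has eigenvalue at most the first one by the
  discrete Picone inequality.

  Isolation: testing with the smaller of the two parts of a sign-changing eigenfunction bounds the
  interaction between the two parts by (nu - lambda_1) A(u^-), while a Faber-Krahn inequality keeps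
  both parts from concentrating, which bounds the same interaction from below by a fixed multiple
  of A(u^-).
*)
theory Submission
  imports Defs
begin

section \<open>Smooth functions\<close>

text \<open>The obstacle that shapes the development is finiteness of the energy. It is not part of
  being a test function; it is available only for elements of the space and for the test functions
  that approximate them. Hence a Lipschitz function of a test function is approximated by
  polynomials in that same test function, which dominates all of them, and the functions used for
  positivity are moved copies of an approximant of the eigenfunction itself. Moving them costs a
  factor: translations are controlled through a distortion constant for Lebesgue measure that does
  not depend on the translation. This suffices for finiteness of transported energies and for lower
  bounds on the volume of translated balls. Both norms are handled as L^p norms, of u for
  \<open>M\<Omega>\<close> and of the differences of u for \<open>MK\<close>, so that each
  convergence argument is carried out once for an abstract measure. The Picone test function is
  reached by the same Lipschitz calculus, as a product of bounded Lipschitz functions of elements of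
  the space.\<close>

lemma closed_subset_compact: "closed S \<Longrightarrow> S \<subseteq> T \<Longrightarrow> compact T \<Longrightarrow> compact S" for S :: "'a::t2_space set"
  by (metis compact_Int_closed Int_absorb1)

lemma n_times_differentiable_Suc_imp:
  "n_times_differentiable (Suc n) f \<Longrightarrow> n_times_differentiable n f"
proof (induction n arbitrary: f)
  case 0
  then show ?case
    by (auto intro!: continuous_at_imp_continuous_on differentiable_imp_continuous_within)
next
  case (Suc n)
  then show ?case by (metis n_times_differentiable.simps(2))
qed

lemma n_times_differentiable_const: "n_times_differentiable n (\<lambda>_. c)"
proof (induction n arbitrary: c)
  case (Suc n)
  have "frechet_derivative (\<lambda>_. c) (at x) = (\<lambda>_. 0)" for x :: 'a
    by simp
  then show ?case using Suc by simp
qed simp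

lemma n_times_differentiable_bounded_linear:
  assumes "bounded_linear T" "n_times_differentiable n f"
  shows "n_times_differentiable n (\<lambda>x. T (f x))"
  using assms(2)
proof (induction n arbitrary: f)
  case 0
  then show ?case
    using assms(1) by (auto intro: bounded_linear.continuous_on)
next
  case (Suc n)
  have d: "((\<lambda>x. T (f x)) has_derivative (\<lambda>v. T (frechet_derivative f (at x) v))) (at x)" for x
    using Suc.prems by (auto intro!: bounded_linear.has_derivative[OF assms(1)] simp flip: frechet_derivative_works)
  have "frechet_derivative (\<lambda>x. T (f x)) (at x) = (\<lambda>v. T (frechet_derivative f (at x) v))" for x
    using frechet_derivative_at[OF d] by simp
  moreover have "(\<lambda>x. T (f x)) differentiable at x" for x
    using d differentiable_def by blast
  ultimately show ?case using Suc by simp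
qed

lemma n_times_differentiable_add:
  assumes "n_times_differentiable n f" "n_times_differentiable n g"
  shows "n_times_differentiable n (\<lambda>x. f x + g x)"
  using assms
proof (induction n arbitrary: f g)
  case 0
  then show ?case by (auto intro: continuous_intros)
next
  case (Suc n)
  have d: "((\<lambda>x. f x + g x) has_derivative
     (\<lambda>v. frechet_derivative f (at x) v + frechet_derivative g (at x) v)) (at x)" for x
    using Suc.prems by (intro has_derivative_add) (auto simp flip: frechet_derivative_works)
  have "frechet_derivative (\<lambda>x. f x + g x) (at x) =
     (\<lambda>v. frechet_derivative f (at x) v + frechet_derivative g (at x) v)" for x
    using frechet_derivative_at[OF d] by simp
  moreover have "(\<lambda>x. f x + g x) differentiable at x" for x
    using d differentiable_def by blast
  ultimately show ?case using Suc by simp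
qed

lemma n_times_differentiable_sum:
  assumes "\<And>i. i \<in> I \<Longrightarrow> n_times_differentiable n (f i)"
  shows "n_times_differentiable n (\<lambda>x. \<Sum>i\<in>I. f i x)"
  using assms
  by (induction I rule: infinite_finite_induct)
    (auto intro: n_times_differentiable_const n_times_differentiable_add)

lemma n_times_differentiable_scaleR:
  fixes f :: "'a::real_normed_vector \<Rightarrow> real"
  assumes "n_times_differentiable n f" "n_times_differentiable n g"
  shows "n_times_differentiable n (\<lambda>x. f x *\<^sub>R g x)"
  using assms
proof (induction n arbitrary: f g)
  case 0
  then show ?case by (auto intro: continuous_intros)
next
  case (Suc n)
  have d: "((\<lambda>x. f x *\<^sub>R g x) has_derivative
     (\<lambda>v. f x *\<^sub>R frechet_derivative g (at x) v + frechet_derivative f (at x) v *\<^sub>R g x)) (at x)" for x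
    using Suc.prems by (intro has_derivative_scaleR) (auto simp flip: frechet_derivative_works)
  have "frechet_derivative (\<lambda>x. f x *\<^sub>R g x) (at x) =
     (\<lambda>v. f x *\<^sub>R frechet_derivative g (at x) v + frechet_derivative f (at x) v *\<^sub>R g x)" for x
    using frechet_derivative_at[OF d] by simp
  moreover have "(\<lambda>x. f x *\<^sub>R g x) differentiable at x" for x
    using d differentiable_def by blast
  moreover have "n_times_differentiable n f" "n_times_differentiable n g"
    using Suc.prems n_times_differentiable_Suc_imp by blast+
  ultimately show ?case using Suc by (auto intro!: n_times_differentiable_add)
qed

text \<open>The recursion differentiates in a fixed direction, whereas the chain rule produces the
  direction \<open>frechet_derivative g (at x) v\<close>, which moves with x. Expanding it in the
  basis turns the derivative into a finite sum of products of functions to which the induction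
  hypothesis applies.\<close>

lemma n_times_differentiable_compose:
  fixes f :: "'b::euclidean_space \<Rightarrow> 'c::real_normed_vector"
  assumes "n_times_differentiable n f" "n_times_differentiable n g"
  shows "n_times_differentiable n (\<lambda>x. f (g x))"
  using assms
proof (induction n arbitrary: f g)
  case 0
  then show ?case by (auto intro: continuous_on_compose2)
next
  case (Suc n)
  have f: "(f has_derivative frechet_derivative f (at x)) (at x)" for x
    using Suc.prems by (auto simp flip: frechet_derivative_works)
  have g: "(g has_derivative frechet_derivative g (at x)) (at x)" for x
    using Suc.prems by (auto simp flip: frechet_derivative_works)
  have d: "((\<lambda>x. f (g x)) has_derivative
     (\<lambda>v. frechet_derivative f (at (g x)) (frechet_derivative g (at x) v))) (at x)" for x
    using has_derivative_compose[OF g f] .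
  have "frechet_derivative f (at (g x)) (frechet_derivative g (at x) v) =
      (\<Sum>b\<in>Basis. (frechet_derivative g (at x) v \<bullet> b) *\<^sub>R frechet_derivative f (at (g x)) b)" for x v
  proof -
    have "linear (frechet_derivative f (at (g x)))"
      using f has_derivative_linear by blast
    then show ?thesis
      by (subst euclidean_representation[of "frechet_derivative g (at x) v", symmetric])
        (simp only: linear_sum linear_cmul)
  qed
  then have "frechet_derivative (\<lambda>x. f (g x)) (at x) =
     (\<lambda>v. \<Sum>b\<in>Basis. (frechet_derivative g (at x) v \<bullet> b) *\<^sub>R frechet_derivative f (at (g x)) b)" for x
    using frechet_derivative_at[OF d] by metis
  moreover have "(\<lambda>x. f (g x)) differentiable at x" for x
    using d differentiable_def by blast
  moreover have "n_times_differentiable n g"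
    using Suc.prems n_times_differentiable_Suc_imp by blast
  moreover have "n_times_differentiable n (\<lambda>x. frechet_derivative g (at x) v \<bullet> b)" for v b
    using Suc.prems
    by (intro n_times_differentiable_bounded_linear[OF bounded_linear_inner_left[of b]]) simp
  moreover have "n_times_differentiable n (\<lambda>x. frechet_derivative f (at (g x)) b)" for b
    using Suc.IH[of "\<lambda>y. frechet_derivative f (at y) b" g] Suc.prems
      n_times_differentiable_Suc_imp by auto
  ultimately show ?case
    by (simp add: n_times_differentiable_sum n_times_differentiable_scaleR)
qed

lemma n_times_differentiable_ident: "n_times_differentiable n (\<lambda>x. x)"
proof (cases n)
  case (Suc m)
  then show ?thesis
    by (simp add: n_times_differentiable_const)
qed simp

lemma smooth_bounded_linear: "bounded_linear T \<Longrightarrow> smooth T"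
  unfolding smooth_def
  using n_times_differentiable_bounded_linear[OF _ n_times_differentiable_ident] by blast

lemma smooth_compose:
  fixes f :: "'b::euclidean_space \<Rightarrow> 'c::real_normed_vector"
  shows "smooth f \<Longrightarrow> smooth g \<Longrightarrow> smooth (\<lambda>x. f (g x))"
  unfolding smooth_def by (blast intro: n_times_differentiable_compose)

lemma smooth_Pair_right: "smooth (\<lambda>y. (a::'a::real_normed_vector, y::'b::real_normed_vector))"
proof -
  have "bounded_linear (\<lambda>y. (0::'a, y::'b))"
    by (intro bounded_linear_Pair bounded_linear_zero bounded_linear_ident)
  then have "n_times_differentiable n (\<lambda>y::'b. (a, 0) + (0, y))" for n
    by (intro n_times_differentiable_add n_times_differentiable_const
        n_times_differentiable_bounded_linear[OF _ n_times_differentiable_ident])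
  then show ?thesis by (simp add: smooth_def)
qed

lemma smooth_imp_differentiable: "smooth f \<Longrightarrow> f differentiable (at x)"
  unfolding smooth_def by (metis n_times_differentiable.simps(2))

lemma smooth_imp_continuous_on: "smooth f \<Longrightarrow> continuous_on UNIV f"
  unfolding smooth_def by (metis n_times_differentiable.simps(1))

lemma smooth_imp_continuous_on_frechet_derivative:
  "smooth f \<Longrightarrow> continuous_on UNIV (\<lambda>x. frechet_derivative f (at x) v)"
  unfolding smooth_def by (metis n_times_differentiable.simps)

lemma smooth_real_polynomial:
  fixes \<phi> :: "'a::real_normed_vector \<Rightarrow> real"
  assumes "smooth \<phi>"
  shows "smooth (\<lambda>x. \<Sum>i\<le>n. a i * \<phi> x ^ Suc i)"
proof -
  have "n_times_differentiable m (\<lambda>x. \<phi> x ^ i)" for m i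
  proof (induction i)
    case (Suc i)
    then show ?case
      using assms n_times_differentiable_scaleR[of m \<phi> "\<lambda>x. \<phi> x ^ i"] by (simp add: smooth_def)
  qed (simp add: n_times_differentiable_const)
  then have "n_times_differentiable m (\<lambda>x. a i * \<phi> x ^ i')" for m i i'
    by (intro n_times_differentiable_bounded_linear[OF bounded_linear_mult_right])
  then show ?thesis
    unfolding smooth_def by (intro allI n_times_differentiable_sum)
qed

lemma smooth_add: "smooth f \<Longrightarrow> smooth g \<Longrightarrow> smooth (\<lambda>x. f x + g x)"
  unfolding smooth_def by (blast intro: n_times_differentiable_add)

lemma test_functionsI:
  assumes "smooth \<phi>" "compact S" "S \<subseteq> \<Omega>" "\<And>x. \<phi> x \<noteq> 0 \<Longrightarrow> x \<in> S"
  shows "\<phi> \<in> test_functions \<Omega>"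
proof -
  have "closure {x. \<phi> x \<noteq> 0} \<subseteq> S"
    using assms by (intro closure_minimal) (auto intro: compact_imp_closed)
  moreover from this have "compact (closure {x. \<phi> x \<noteq> 0})"
    using assms(2) closed_subset_compact closed_closure by blast
  ultimately show ?thesis
    using assms by (auto simp: test_functions_def)
qed

text \<open>The exponents start at 1, so the polynomial vanishes wherever \<phi> does and the
  support does not grow.\<close>

lemma test_functions_real_polynomial:
  assumes "\<phi> \<in> test_functions \<Omega>"
  shows "(\<lambda>x. \<Sum>i\<le>n. a i * \<phi> x ^ Suc i) \<in> test_functions \<Omega>"
proof (rule test_functionsI[of _ "closure {x. \<phi> x \<noteq> 0}"])
  show "x \<in> closure {x. \<phi> x \<noteq> 0}" if "(\<Sum>i\<le>n. a i * \<phi> x ^ Suc i) \<noteq> 0" for x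
  proof -
    have "\<phi> x \<noteq> 0" using that by auto
    then show ?thesis using closure_subset[of "{x. \<phi> x \<noteq> 0}"] by blast
  qed
qed (use assms smooth_real_polynomial in \<open>auto simp: test_functions_def\<close>)

lemma test_functions_lincomb:
  assumes "\<phi> \<in> test_functions \<Omega>" "\<psi> \<in> test_functions \<Omega>"
  shows "(\<lambda>x. a * \<phi> x + b * \<psi> x) \<in> test_functions \<Omega>"
proof (rule test_functionsI[of _ "closure {x. \<phi> x \<noteq> 0} \<union> closure {x. \<psi> x \<noteq> 0}"])
  show "x \<in> closure {x. \<phi> x \<noteq> 0} \<union> closure {x. \<psi> x \<noteq> 0}" if "a * \<phi> x + b * \<psi> x \<noteq> 0" for x
  proof -
    have "\<phi> x \<noteq> 0 \<or> \<psi> x \<noteq> 0" using that by auto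
    then show ?thesis using closure_subset[of "{x. \<phi> x \<noteq> 0}"] closure_subset[of "{x. \<psi> x \<noteq> 0}"] by blast
  qed
  show "smooth (\<lambda>x. a * \<phi> x + b * \<psi> x)"
    using assms n_times_differentiable_bounded_linear[OF bounded_linear_mult_right]
    by (intro smooth_add) (auto simp: test_functions_def smooth_def)
qed (use assms in \<open>auto simp: test_functions_def\<close>)

section \<open>Elementary inequalities for powers\<close>

text \<open>Weierstrass approximation of F alone gives no control of slopes. So F is replaced by its
  average G over windows of length h, whose derivative is the difference quotient g with |g| \<le>
  L. A polynomial q close to g is integrated from 0, and the resulting P is close to G and inherits
  the slope bound.\<close>

lemma lipschitz_polynomial_approximation:
  fixes F :: "real \<Rightarrow> real"
  assumes lip: "\<And>x y. \<bar>F x - F y\<bar> \<le> L * \<bar>x - y\<bar>" and F0: "F 0 = 0" and M: "0 < M" and e: "0 < e"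
  obtains a :: "nat \<Rightarrow> real" and n :: nat where
    "\<And>t. \<bar>t\<bar> \<le> M \<Longrightarrow> \<bar>(\<Sum>i\<le>n. a i * t ^ Suc i) - F t\<bar> \<le> e"
    "\<And>t r. \<bar>t\<bar> \<le> M \<Longrightarrow> \<bar>r\<bar> \<le> M \<Longrightarrow>
       \<bar>(\<Sum>i\<le>n. a i * t ^ Suc i) - (\<Sum>i\<le>n. a i * r ^ Suc i)\<bar> \<le> (L + 1) * \<bar>t - r\<bar>"
proof -
  have L: "0 \<le> L" using lip[of 1 0] by simp
  have "L-lipschitz_on UNIV F"
    using lip L by (auto intro!: lipschitz_onI simp: dist_real_def)
  then have contF: "continuous_on S F" for S
    using lipschitz_on_continuous_on continuous_on_subset by blast
  \<comment> \<open>Averaging over a window of length h moves F by at most L h, which this choice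
    keeps below e / 4. The error e splits as e / 2 for P against G, e / 4 for G 0, and e / 4 for G
    against F.\<close>
  define h where "h = min 1 (e / (4 * (L + 1)))"
  have h: "0 < h" "h \<le> 1" using e L by (auto simp: h_def)
  have Lh: "L * h \<le> e / 4"
  proof -
    have "L * h \<le> L * (e / (4 * (L + 1)))"
      using L by (intro mult_left_mono) (auto simp: h_def)
    also have "\<dots> \<le> e / 4"
      using L e by (simp add: field_simps)
    finally show ?thesis .
  qed
  \<comment> \<open>Leaves room for t + h with |t| \<le> M and h \<le> 1 strictly inside the
    interval of the antiderivative.\<close>
  define N where "N = M + 2"
  obtain \<Phi> where \<Phi>: "\<And>x. x \<in> {-N..N} \<Longrightarrow> (\<Phi> has_vector_derivative F x) (at x within {-N..N})"
    using antiderivative_continuous[OF contF] by blast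
  have \<Phi>': "(\<Phi> has_real_derivative F x) (at x)" if "\<bar>x\<bar> < N" for x
  proof -
    have "x \<in> interior {-N..N}" using that by auto
    then show ?thesis
      using \<Phi>[of x] that at_within_interior[of x "{-N..N}"]
      by (auto simp: has_real_derivative_iff_has_vector_derivative)
  qed
  define g where "g t = (F (t + h) - F t) / h" for t
  define G where "G t = (\<Phi> (t + h) - \<Phi> t) / h" for t
  have G': "(G has_real_derivative g t) (at t)" if "\<bar>t\<bar> \<le> M" for t
  proof -
    have "((\<lambda>t. \<Phi> (t + h)) has_real_derivative F (t + h)) (at t)"
      using DERIV_shift[of \<Phi> "F (t + h)" t h] \<Phi>'[of "t + h"] that h by (auto simp: N_def)
    moreover have "(\<Phi> has_real_derivative F t) (at t)"
      using that by (intro \<Phi>') (auto simp: N_def)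
    ultimately show ?thesis
      unfolding G_def[abs_def] g_def by (intro DERIV_cdivide DERIV_diff)
  qed
  have gb: "\<bar>g t\<bar> \<le> L" for t
    using lip[of "t + h" t] h by (simp add: g_def field_simps)
  have GF: "\<bar>G t - F t\<bar> \<le> L * h" if "\<bar>t\<bar> \<le> M" for t
  proof -
    have "(\<Phi> has_real_derivative F x) (at x)" if "t \<le> x" "x \<le> t + h" for x
      using that \<open>\<bar>t\<bar> \<le> M\<close> h by (intro \<Phi>') (auto simp: N_def)
    then obtain z where z: "t < z" "z < t + h" "\<Phi> (t + h) - \<Phi> t = (t + h - t) * F z"
      using MVT2[of t "t + h" \<Phi> F] h by auto
    then have "G t = F z" using h by (simp add: G_def)
    then have "\<bar>G t - F t\<bar> \<le> L * \<bar>z - t\<bar>" using lip by simp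
    also have "\<dots> \<le> L * h" using z L by (intro mult_left_mono) auto
    finally show ?thesis .
  qed
  \<comment> \<open>The bound 1 gives the slope L + 1; the other bound makes the error accumulated
    from 0 to t at most e / 2.\<close>
  define \<delta> where "\<delta> = min 1 (e / (2 * M))"
  have \<delta>: "0 < \<delta>" "\<delta> \<le> 1" "\<delta> * M \<le> e / 2"
    using e M by (auto simp: \<delta>_def min_def field_simps)
  have "continuous_on {-M..M} g"
    unfolding g_def using h by (intro continuous_intros continuous_on_compose2[OF contF]) auto
  then obtain q where q: "real_polynomial_function q" "\<And>t. t \<in> {-M..M} \<Longrightarrow> \<bar>g t - q t\<bar> < \<delta>"
    using Stone_Weierstrass_real_polynomial_function[of "{-M..M}" g \<delta>] \<delta> by auto
  then obtain b n where qb: "q = (\<lambda>x. \<Sum>i\<le>n. b i * x ^ i)"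
    by (auto simp: real_polynomial_function_iff_sum)
  define a where "a i = b i / real (Suc i)" for i
  define P where "P t = (\<Sum>i\<le>n. a i * t ^ Suc i)" for t
  have P': "(P has_real_derivative q t) (at t)" for t
    unfolding P_def[abs_def] qb
    by (auto intro!: derivative_eq_intros sum.cong simp: a_def simp del: power_Suc)
  have P0: "P 0 = 0" by (simp add: P_def)
  have lipP: "\<bar>P t - P r\<bar> \<le> (L + 1) * \<bar>t - r\<bar>" if "\<bar>t\<bar> \<le> M" "\<bar>r\<bar> \<le> M" for t r
  proof -
    have "norm (P t - P r) \<le> (L + 1) * norm (t - r)"
    proof (rule field_differentiable_bound[of "{-M..M}" P q])
      show "norm (q z) \<le> L + 1" if "z \<in> {-M..M}" for z
        using gb[of z] q(2)[OF that] \<delta> by simp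
    qed (use P' that in \<open>auto intro: has_field_derivative_at_within\<close>)
    then show ?thesis by simp
  qed
  have "\<bar>P t - F t\<bar> \<le> e" if t: "\<bar>t\<bar> \<le> M" for t
  proof -
    have "norm ((P t - G t) - (P 0 - G 0)) \<le> \<delta> * norm (t - 0)"
    proof (rule field_differentiable_bound[of "{-M..M}" "\<lambda>t. P t - G t" "\<lambda>t. q t - g t"])
      show "norm (q z - g z) \<le> \<delta>" if "z \<in> {-M..M}" for z
        using q(2)[OF that] by simp
      show "((\<lambda>t. P t - G t) has_field_derivative q z - g z) (at z within {-M..M})"
        if "z \<in> {-M..M}" for z
        by (rule has_field_derivative_at_within, rule DERIV_diff[OF P'[of z] G'[of z]]) (use that in auto)
    qed (use M t in auto)
    also have "\<delta> * norm (t - 0) \<le> \<delta> * M"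
      using t \<delta> by (intro mult_left_mono) auto
    finally have "\<bar>(P t - G t) - (P 0 - G 0)\<bar> \<le> e / 2" using \<delta> by simp
    moreover have "\<bar>G 0\<bar> \<le> e / 4" using GF[of 0] F0 M Lh by simp
    moreover have "\<bar>G t - F t\<bar> \<le> e / 4" using GF[OF t] Lh by simp
    ultimately show ?thesis using P0 by linarith
  qed
  then show ?thesis using that lipP unfolding P_def by blast
qed

lemma abs_add_powr_le:
  fixes a b p :: real
  assumes "0 \<le> p"
  shows "\<bar>a + b\<bar> powr p \<le> 2 powr p * (\<bar>a\<bar> powr p + \<bar>b\<bar> powr p)"
proof -
  have "\<bar>a + b\<bar> powr p \<le> (2 * max \<bar>a\<bar> \<bar>b\<bar>) powr p"
    using assms by (intro powr_mono2) auto
  also have "\<dots> = 2 powr p * max \<bar>a\<bar> \<bar>b\<bar> powr p"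
    by (simp add: powr_mult)
  also have "max \<bar>a\<bar> \<bar>b\<bar> powr p \<le> \<bar>a\<bar> powr p + \<bar>b\<bar> powr p"
    by (auto simp: max_def)
  finally show ?thesis by (auto simp: mult_left_mono)
qed

lemma signed_power_eq: "signed_power p t = sgn t * \<bar>t\<bar> powr (p - 1)"
proof (cases "t = 0")
  case False
  then have "\<bar>t\<bar> powr (p - 1) = \<bar>t\<bar> powr (p - 2) * \<bar>t\<bar>"
    using powr_mult_base[of "\<bar>t\<bar>" "p - 2"] by (simp add: mult.commute)
  then show ?thesis by (simp add: signed_power_def sgn_if)
qed (simp add: signed_power_def)

lemma signed_power_mult_self: "p \<noteq> 0 \<Longrightarrow> signed_power p t * t = \<bar>t\<bar> powr p"
proof (cases "t = 0")
  case False
  then have "\<bar>t\<bar> powr p = \<bar>t\<bar> * \<bar>t\<bar> powr (p - 1)"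
    using powr_mult_base[of "\<bar>t\<bar>" "p - 1"] by simp
  then show ?thesis by (simp add: signed_power_eq sgn_if)
qed (simp add: signed_power_def)

lemma signed_power_minus: "signed_power p (- t) = - signed_power p t"
  by (simp add: signed_power_def)

lemma borel_measurable_signed_power [measurable]: "signed_power p \<in> borel_measurable borel"
  unfolding signed_power_def[abs_def] by measurable

lemma abs_signed_power: "p > 1 \<Longrightarrow> \<bar>signed_power p t\<bar> = \<bar>t\<bar> powr (p - 1)"
  by (simp add: signed_power_eq abs_mult abs_sgn_eq)

text \<open>A Young inequality with a free weight \<eta> and crude constants: if |e| \<le> \<eta>
  |d| the product is absorbed by the first term, otherwise |d| < |e| / \<eta> and the second term
  absorbs it. It plays the role of Hoelder's inequality in the pairings below.\<close>

lemma signed_power_mult_le: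
  assumes p: "1 < p" and "0 < \<eta>"
  shows "\<bar>signed_power p d * e\<bar> \<le> \<eta> * \<bar>d\<bar> powr p + \<eta> powr (1 - p) * \<bar>e\<bar> powr p"
proof -
  have *: "\<bar>x\<bar> powr p = \<bar>x\<bar> powr (p - 1) * \<bar>x\<bar>" for x
    using powr_mult_base[of "\<bar>x\<bar>" "p - 1"] by (simp add: mult.commute)
  have eq: "\<bar>signed_power p d * e\<bar> = \<bar>d\<bar> powr (p - 1) * \<bar>e\<bar>"
    using p by (simp add: abs_mult abs_signed_power)
  show ?thesis
  proof (cases "\<bar>e\<bar> \<le> \<eta> * \<bar>d\<bar>")
    case True
    then have "\<bar>d\<bar> powr (p - 1) * \<bar>e\<bar> \<le> \<bar>d\<bar> powr (p - 1) * (\<eta> * \<bar>d\<bar>)"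
      by (intro mult_left_mono) auto
    also have "\<dots> = \<eta> * \<bar>d\<bar> powr p"
      by (simp add: *)
    finally show ?thesis unfolding eq by (simp add: add_increasing2)
  next
    case False
    then have "\<bar>d\<bar> powr (p - 1) \<le> (\<bar>e\<bar> / \<eta>) powr (p - 1)"
      using assms by (intro powr_mono2) (auto simp: field_simps)
    also have "\<dots> = \<eta> powr (1 - p) * \<bar>e\<bar> powr (p - 1)"
      using assms by (simp add: powr_divide powr_diff field_simps)
    finally have "\<bar>d\<bar> powr (p - 1) * \<bar>e\<bar> \<le> \<eta> powr (1 - p) * \<bar>e\<bar> powr (p - 1) * \<bar>e\<bar>"
      by (intro mult_right_mono) auto
    then show ?thesis unfolding eq using assms by (simp add: * add_increasing mult.assoc)
  qed
qed

lemma DERIV_abs_powr: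
  fixes p :: real
  assumes p: "1 < p"
  shows "((\<lambda>t. \<bar>t\<bar> powr p) has_real_derivative p * signed_power p t) (at t)"
proof -
  consider "0 < t" | "t < 0" | "t = 0" by linarith
  then show ?thesis
  proof cases
    case 1
    have "((\<lambda>t. t powr p) has_real_derivative p * t powr (p - 1)) (at t)"
      using 1 by (auto intro!: derivative_eq_intros)
    moreover have "\<forall>\<^sub>F x in nhds t. \<bar>x\<bar> powr p = x powr p"
      using eventually_nhds_in_open[of "{0<..}" t] 1 by (auto elim!: eventually_mono)
    ultimately show ?thesis
      using 1 by (simp add: signed_power_eq DERIV_cong_ev[OF refl _ refl])
  next
    case 2
    have "((\<lambda>t. (- t) powr p) has_real_derivative - (p * (- t) powr (p - 1))) (at t)"
      using 2 by (auto intro!: derivative_eq_intros)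
    moreover have "\<forall>\<^sub>F x in nhds t. \<bar>x\<bar> powr p = (- x) powr p"
      using eventually_nhds_in_open[of "{..<0}" t] 2 by (auto elim!: eventually_mono)
    ultimately show ?thesis
      using 2 by (simp add: signed_power_eq DERIV_cong_ev[OF refl _ refl])
  next
    \<comment> \<open>At 0 the difference quotient has absolute value |h|^(p-1), which tends to 0
      because p > 1.\<close>
    case 3
    have "((\<lambda>h. \<bar>h\<bar> powr (p - 1)) \<longlongrightarrow> 0) (at (0::real))"
      using p by (intro tendsto_zero_powrI[OF _ tendsto_const] tendsto_rabs_zero) (auto intro: tendsto_ident_at)
    then have "((\<lambda>h::real. \<bar>h\<bar> powr p / h) \<longlongrightarrow> 0) (at 0)"
    proof (rule Lim_null_comparison[rotated])
      have "norm (\<bar>h\<bar> powr p / h) \<le> \<bar>h\<bar> powr (p - 1)" for h :: real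
      proof (cases "h = 0")
        case False
        then have "\<bar>h\<bar> powr p = \<bar>h\<bar> powr (p - 1) * \<bar>h\<bar>"
          using powr_mult_base[of "\<bar>h\<bar>" "p - 1"] by (simp add: mult.commute)
        then show ?thesis using False by (simp add: abs_mult)
      qed simp
      then show "\<forall>\<^sub>F h in at 0. norm (\<bar>h\<bar> powr p / h) \<le> \<bar>h\<bar> powr (p - 1)" by simp
    qed
    then show ?thesis using 3 p by (simp add: DERIV_def signed_power_def)
  qed
qed

lemma signed_power_strict_mono:
  assumes "1 < p" "a < b" shows "signed_power p a < signed_power p b"
proof -
  consider "0 \<le> a" | "b \<le> 0" | "a < 0" "0 < b" by linarith
  then show ?thesis
  proof cases
    case 1
    then show ?thesis using assms powr_less_mono2[of "p - 1" a b] by (auto simp: signed_power_eq sgn_if)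
  next
    case 2
    then show ?thesis using assms powr_less_mono2[of "p - 1" "-b" "-a"] by (auto simp: signed_power_eq sgn_if)
  next
    case 3
    then have "signed_power p a < 0" "0 < signed_power p b"
      by (auto simp: signed_power_eq sgn_if)
    then show ?thesis by linarith
  qed
qed

text \<open>R and T lie strictly between Q and P and have the same sum, so the outer gaps on the
  left and on the right have equal length. The mean value theorem on these two gaps, with the
  strictly increasing derivative of |t|^p, shows that the right gap contributes more.\<close>

lemma abs_powr_strict_exchange:
  fixes p :: real
  assumes p: "1 < p" and "Q < R" "R < P" "R + T = P + Q"
  shows "\<bar>R\<bar> powr p + \<bar>T\<bar> powr p < \<bar>P\<bar> powr p + \<bar>Q\<bar> powr p"
proof -
  have main: "\<bar>R\<bar> powr p + \<bar>T\<bar> powr p < \<bar>P\<bar> powr p + \<bar>Q\<bar> powr p"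
    if h: "Q < R" "R \<le> T" "R + T = P + Q" for R T :: real
  proof -
    obtain x where x: "Q < x" "x < R" "\<bar>R\<bar> powr p - \<bar>Q\<bar> powr p = (R - Q) * (p * signed_power p x)"
      using MVT2[of Q R "\<lambda>t. \<bar>t\<bar> powr p" "\<lambda>t. p * signed_power p t", OF h(1) DERIV_abs_powr[OF p]]
      by blast
    obtain y where y: "T < y" "y < P" "\<bar>P\<bar> powr p - \<bar>T\<bar> powr p = (P - T) * (p * signed_power p y)"
      using MVT2[of T P "\<lambda>t. \<bar>t\<bar> powr p" "\<lambda>t. p * signed_power p t", OF _ DERIV_abs_powr[OF p]] h
      by force
    have "p * signed_power p x < p * signed_power p y"
      using x y h p by (intro mult_strict_left_mono signed_power_strict_mono) auto
    then have "(R - Q) * (p * signed_power p x) < (R - Q) * (p * signed_power p y)"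
      using mult_strict_left_mono[of "p * signed_power p x" "p * signed_power p y" "R - Q"] h by simp
    moreover have "P - T = R - Q" using h by linarith
    ultimately show ?thesis using x(3) y(3) by simp
  qed
  show ?thesis
  proof (cases "R \<le> T")
    case True
    then show ?thesis using main[of R T] assms by simp
  next
    case False
    then show ?thesis using main[of T R] assms by simp
  qed
qed

text \<open>Here a, b are the values of two functions at one point and c, d their values at another,
  in crossed order. Maximum and minimum recombine the differences a - c and b - d into a - d and b -
  c, which have the same sum and lie strictly between them.\<close>

lemma abs_powr_max_min_strict:
  fixes p :: real
  assumes "1 < p" "b < a" "c < d"
  shows "\<bar>max a b - max c d\<bar> powr p + \<bar>min a b - min c d\<bar> powr p < \<bar>a - c\<bar> powr p + \<bar>b - d\<bar> powr p"
  using abs_powr_strict_exchange[of p "b - d" "a - d" "a - c" "b - c"] assms by (simp add: max_def min_def)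

lemma abs_powr_max_min:
  fixes p :: real
  assumes p: "1 < p"
  shows "\<bar>max a b - max c d\<bar> powr p + \<bar>min a b - min c d\<bar> powr p \<le> \<bar>a - c\<bar> powr p + \<bar>b - d\<bar> powr p"
proof -
  consider "b < a" "c < d" | "a < b" "d < c" | "b \<le> a" "d \<le> c" | "a \<le> b" "c \<le> d" by linarith
  then show ?thesis
  proof cases
    case 1
    then show ?thesis using abs_powr_max_min_strict[OF p, of b a c d] by simp
  next
    case 2
    then show ?thesis using abs_powr_max_min_strict[OF p, of a b d c] by (simp add: max.commute min.commute)
  qed (auto simp: max_def min_def)
qed

text \<open>By symmetry A > B may be assumed. If moreover a > b, then a / A is the convex
  combination of b / B and (a - b) / (A - B) with weights B / A and 1 - B / A, and convexity of the
  p-th power, multiplied by A, is the claim. For a \<le> b the left side is not positive.\<close>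

lemma discrete_Picone:
  fixes p A B a b :: real
  assumes p: "1 < p" and AB: "0 < A" "0 < B" and ab: "0 \<le> a" "0 \<le> b"
  shows "signed_power p (A - B) * (a powr p / A powr (p - 1) - b powr p / B powr (p - 1)) \<le> \<bar>a - b\<bar> powr p"
proof -
  have pm: "x powr p = x * x powr (p - 1)" if "0 \<le> x" for x :: real
    using powr_mult_base[OF that, of "p - 1"] by simp
  have main: "signed_power p (A - B) * (a powr p / A powr (p - 1) - b powr p / B powr (p - 1)) \<le> \<bar>a - b\<bar> powr p"
    if h: "B < A" "0 < B" "0 \<le> a" "0 \<le> b" for A B a b
  proof -
    define D where "D = (A - B) powr (p - 1)"
    have D: "0 < D" "signed_power p (A - B) = D"
      using h by (auto simp: D_def signed_power_eq)
    show ?thesis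
    proof (cases "a \<le> b")
      case True
      have "a powr p / A powr (p - 1) \<le> b powr p / B powr (p - 1)"
        using True h p by (intro frac_le powr_mono2) auto
      then have "D * (a powr p / A powr (p - 1) - b powr p / B powr (p - 1)) \<le> 0"
        using D by (simp add: mult_le_0_iff)
      then show ?thesis using D by (simp add: order_trans[OF _ powr_ge_zero])
    next
      case ab: False
      show ?thesis
      proof (cases "b = 0")
        case True
        have "D \<le> A powr (p - 1)" using h p by (auto simp: D_def intro: powr_mono2)
        then have "a powr p * D \<le> a powr p * A powr (p - 1)" by (intro mult_left_mono) auto
        then show ?thesis using True D h p by (simp add: field_simps)
      next
        case False
        \<comment> \<open>The weight of (a - b) / (A - B) in the convex combination equal to a /
          A.\<close>
        define t where "t = (A - B) / A"
        have t: "0 \<le> t" "t \<le> 1" "1 - t = B / A" using h by (auto simp: t_def field_simps)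
        have "((1 - t) *\<^sub>R (b / B) + t *\<^sub>R ((a - b) / (A - B))) powr p
            \<le> (1 - t) * (b / B) powr p + t * ((a - b) / (A - B)) powr p"
          using False ab h p t by (intro convex_onD[OF powr_convex]) auto
        also have "(1 - t) *\<^sub>R (b / B) + t *\<^sub>R ((a - b) / (A - B)) = a / A"
          unfolding t(3) using h by (simp add: t_def field_simps)
        finally have "A * (a / A) powr p \<le> A * ((B / A) * (b / B) powr p + ((A - B) / A) * ((a - b) / (A - B)) powr p)"
          using h by (intro mult_left_mono) (simp_all only: t(3) t_def[symmetric] less_imp_le)
        also have "\<dots> = B * (b / B) powr p + (A - B) * ((a - b) / (A - B)) powr p"
          using h by (simp add: distrib_left)
        finally have *: "A * (a / A) powr p \<le> B * (b / B) powr p + (A - B) * ((a - b) / (A - B)) powr p" .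
        have q: "c * (x / c) powr p = x powr p / c powr (p - 1)" if "0 < c" "0 \<le> x" for c x :: real
          using that pm[of c] by (simp add: powr_divide)
        have "a powr p / A powr (p - 1) \<le> b powr p / B powr (p - 1) + (a - b) powr p / D"
          using * q[of A a] q[of B b] q[of "A - B" "a - b"] h ab by (simp add: D_def)
        then have "D * (a powr p / A powr (p - 1) - b powr p / B powr (p - 1)) \<le> D * ((a - b) powr p / D)"
          using D by (intro mult_left_mono) auto
        then show ?thesis using D ab by simp
      qed
    qed
  qed
  consider "B < A" | "A < B" | "A = B" by linarith
  then show ?thesis
  proof cases
    case 1
    then show ?thesis using main AB ab by blast
  next
    case 2
    have "signed_power p (A - B) = - signed_power p (B - A)"
      using signed_power_minus[of p "B - A"] by simp
    then show ?thesis using main[OF 2 AB(1) ab(2,1)] by (simp add: algebra_simps abs_minus_commute)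
  next
    case 3
    then show ?thesis by (simp add: signed_power_def)
  qed
qed

text \<open>Truncation at M makes the p-th power globally Lipschitz, so that powers of a bounded
  element stay in the space by \<open>X0_lipschitz\<close>.\<close>

lemma truncated_powr_lipschitz:
  fixes p M :: real
  assumes p: "1 < p" and M: "0 \<le> M"
  defines "c \<equiv> \<lambda>t::real. max 0 (min t M)"
  shows "\<bar>c x powr p - c y powr p\<bar> \<le> (p * M powr (p - 1)) * \<bar>x - y\<bar>"
proof -
  have c: "0 \<le> c t" "c t \<le> M" for t using M by (auto simp: c_def)
  have "norm (\<bar>c x\<bar> powr p - \<bar>c y\<bar> powr p) \<le> (p * M powr (p - 1)) * norm (c x - c y)"
  proof (rule field_differentiable_bound[of "{0..M}" "\<lambda>t. \<bar>t\<bar> powr p" "\<lambda>t. p * signed_power p t"])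
    show "((\<lambda>t. \<bar>t\<bar> powr p) has_real_derivative p * signed_power p z) (at z within {0..M})" for z
      by (rule has_field_derivative_at_within[OF DERIV_abs_powr[OF p]])
    show "norm (p * signed_power p z) \<le> p * M powr (p - 1)" if "z \<in> {0..M}" for z
      using that p by (auto simp: abs_mult abs_signed_power intro!: mult_left_mono powr_mono2)
  qed (use c in auto)
  then have "\<bar>c x powr p - c y powr p\<bar> \<le> (p * M powr (p - 1)) * \<bar>c x - c y\<bar>"
    using c by simp
  also have "\<dots> \<le> (p * M powr (p - 1)) * \<bar>x - y\<bar>"
    using p by (intro mult_left_mono) (auto simp: c_def)
  finally show ?thesis .
qed

text \<open>The shift by e keeps the argument away from the singularity at 0, and the maximum keeps
  it there for negative values of the function, which are excluded only almost everywhere.\<close>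

lemma shifted_negative_powr_lipschitz:
  fixes p e :: real
  assumes p: "1 < p" and e: "0 < e"
  defines "c \<equiv> \<lambda>t::real. max t 0 + e"
  shows "\<bar>c x powr (1 - p) - c y powr (1 - p)\<bar> \<le> ((p - 1) * e powr (- p)) * \<bar>x - y\<bar>"
proof -
  have c: "e \<le> c t" for t by (auto simp: c_def)
  have "norm (c x powr (1 - p) - c y powr (1 - p)) \<le> ((p - 1) * e powr (- p)) * norm (c x - c y)"
  proof (rule field_differentiable_bound[of "{e..}" "\<lambda>t. t powr (1 - p)" "\<lambda>t. (1 - p) * t powr (- p)"])
    show "((\<lambda>t. t powr (1 - p)) has_real_derivative (1 - p) * z powr (- p)) (at z within {e..})"
      if "z \<in> {e..}" for z
    proof -
      have "((\<lambda>t. t powr (1 - p)) has_real_derivative (1 - p) * z powr (1 - p - 1)) (at z)"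
        using that e by (intro has_real_derivative_powr) auto
      then have "((\<lambda>t. t powr (1 - p)) has_real_derivative (1 - p) * z powr (- p)) (at z)"
        by simp
      then show ?thesis by (rule has_field_derivative_at_within)
    qed
    show "norm ((1 - p) * z powr (- p)) \<le> (p - 1) * e powr (- p)" if "z \<in> {e..}" for z
    proof -
      have "z powr (- p) \<le> e powr (- p)"
        using that p e by (intro powr_mono2') auto
      then have "(p - 1) * z powr (- p) \<le> (p - 1) * e powr (- p)"
        using p by (intro mult_left_mono) auto
      then show ?thesis using p by (simp add: abs_mult)
    qed
  qed (use c in auto)
  also have "\<dots> \<le> ((p - 1) * e powr (- p)) * \<bar>x - y\<bar>"
    using p by (intro mult_left_mono) (auto simp: c_def)
  finally show ?thesis by simp
qed

section \<open>Convergence of integrals\<close>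

text \<open>Stated for an arbitrary measure because it is used twice: for functions with
  \<open>M\<Omega>\<close> and for their differences with \<open>MK\<close>.\<close>

definition in_Lp :: "'a measure \<Rightarrow> real \<Rightarrow> ('a \<Rightarrow> real) \<Rightarrow> bool" where
  "in_Lp M p f \<longleftrightarrow> f \<in> borel_measurable M \<and> integrable M (\<lambda>x. \<bar>f x\<bar> powr p)"

lemma in_LpD [measurable_dest]: "in_Lp M p f \<Longrightarrow> f \<in> borel_measurable M"
  by (simp add: in_Lp_def)

lemma in_Lp_cmult:
  assumes "in_Lp M p f" shows "in_Lp M p (\<lambda>x. c * f x)"
  using assms unfolding in_Lp_def by (auto simp: abs_mult powr_mult)

lemma in_Lp_add:
  assumes "0 \<le> p" "in_Lp M p f" "in_Lp M p g"
  shows "in_Lp M p (\<lambda>x. f x + g x)"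
  unfolding in_Lp_def
proof
  show [measurable]: "(\<lambda>x. f x + g x) \<in> borel_measurable M"
    using assms by (auto simp: in_Lp_def)
  show "integrable M (\<lambda>x. \<bar>f x + g x\<bar> powr p)"
  proof (rule Bochner_Integration.integrable_bound)
    show "integrable M (\<lambda>x. 2 powr p * (\<bar>f x\<bar> powr p + \<bar>g x\<bar> powr p))"
      using assms by (auto simp: in_Lp_def)
    show "AE x in M. norm (\<bar>f x + g x\<bar> powr p) \<le> norm (2 powr p * (\<bar>f x\<bar> powr p + \<bar>g x\<bar> powr p))"
      using abs_add_powr_le[OF assms(1)] by (auto simp: abs_mult)
  qed measurable
qed

lemma in_Lp_diff:
  assumes "0 \<le> p" "in_Lp M p f" "in_Lp M p g"
  shows "in_Lp M p (\<lambda>x. f x - g x)"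
  using in_Lp_add[OF assms(1,2) in_Lp_cmult[OF assms(3), of "-1"]] by simp

lemma in_Lp_bound:
  assumes "0 \<le> p" "in_Lp M p f" "g \<in> borel_measurable M" "AE x in M. \<bar>g x\<bar> \<le> L * \<bar>f x\<bar>" "0 \<le> L"
  shows "in_Lp M p g"
    and "(\<integral>x. \<bar>g x\<bar> powr p \<partial>M) \<le> L powr p * (\<integral>x. \<bar>f x\<bar> powr p \<partial>M)"
proof -
  note [measurable] = assms(3)
  have i: "integrable M (\<lambda>x. L powr p * \<bar>f x\<bar> powr p)"
    using assms(2) by (auto simp: in_Lp_def)
  have le: "AE x in M. \<bar>g x\<bar> powr p \<le> L powr p * \<bar>f x\<bar> powr p"
    using assms(4)
  proof eventually_elim
    case (elim x)
    then have "\<bar>g x\<bar> powr p \<le> (L * \<bar>f x\<bar>) powr p"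
      using assms(1) by (intro powr_mono2) auto
    then show ?case using assms(5) by (simp add: powr_mult)
  qed
  show g: "in_Lp M p g"
    unfolding in_Lp_def
  proof (intro conjI Bochner_Integration.integrable_bound[OF i])
    show "AE x in M. norm (\<bar>g x\<bar> powr p) \<le> norm (L powr p * \<bar>f x\<bar> powr p)"
      using le by eventually_elim auto
  qed measurable
  have "(\<integral>x. \<bar>g x\<bar> powr p \<partial>M) \<le> (\<integral>x. L powr p * \<bar>f x\<bar> powr p \<partial>M)"
    using g i le by (intro integral_mono_AE) (auto simp: in_Lp_def)
  then show "(\<integral>x. \<bar>g x\<bar> powr p \<partial>M) \<le> L powr p * (\<integral>x. \<bar>f x\<bar> powr p \<partial>M)"
    by simp
qed

text \<open>Dominated convergence with a dominating function that may vary by an error h n vanishing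
  in L^1. The positive part of f n - h n is dominated by the fixed g and tends to 0, and f n exceeds
  it by at most h n.\<close>

lemma integral_tendsto_zero_dominated:
  fixes f h :: "nat \<Rightarrow> 'a \<Rightarrow> real"
  assumes [measurable]: "\<And>n. f n \<in> borel_measurable M"
    and h: "\<And>n. integrable M (h n)" and g: "integrable M g"
    and nn: "\<And>n. AE x in M. 0 \<le> f n x" "\<And>n. AE x in M. 0 \<le> h n x" "AE x in M. 0 \<le> g x"
    and le: "\<And>n. AE x in M. f n x \<le> g x + h n x"
    and h0: "(\<lambda>n. \<integral>x. h n x \<partial>M) \<longlonglongrightarrow> 0"
    and f0: "AE x in M. (\<lambda>n. f n x) \<longlonglongrightarrow> 0"
  shows "(\<lambda>n. \<integral>x. f n x \<partial>M) \<longlonglongrightarrow> 0"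
proof -
  note [measurable] = borel_measurable_integrable[OF h] borel_measurable_integrable[OF g]
  define k where "k n x = max 0 (f n x - h n x)" for n x
  have [measurable]: "k n \<in> borel_measurable M" for n
    unfolding k_def[abs_def] by measurable
  have fi: "integrable M (f n)" for n
  proof (rule Bochner_Integration.integrable_bound)
    show "integrable M (\<lambda>x. g x + h n x)" using g h by auto
    show "AE x in M. norm (f n x) \<le> norm (g x + h n x)"
      using nn(1)[of n] nn(2)[of n] nn(3) le[of n] by eventually_elim auto
  qed measurable
  have kg: "AE x in M. norm (k n x) \<le> g x" for n
    using nn(1)[of n] nn(2)[of n] nn(3) le[of n]
    by eventually_elim (auto simp: k_def max_def)
  have ki: "integrable M (k n)" for n
    unfolding k_def[abs_def] using fi h by auto
  have "AE x in M. \<forall>n. 0 \<le> f n x \<and> 0 \<le> h n x"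
    using nn(1,2) by (simp add: AE_all_countable)
  with f0 have "AE x in M. (\<lambda>n. k n x) \<longlonglongrightarrow> 0"
  proof eventually_elim
    case (elim x)
    then show ?case
      by (intro tendsto_sandwich[of "\<lambda>_. 0" "\<lambda>n. k n x" _ "\<lambda>n. f n x"]) (auto simp: k_def)
  qed
  then have "(\<lambda>n. \<integral>x. k n x \<partial>M) \<longlonglongrightarrow> (\<integral>x. 0 \<partial>M)"
    using g kg by (intro integral_dominated_convergence[where w = g]) auto
  then have lim: "(\<lambda>n. (\<integral>x. k n x \<partial>M) + (\<integral>x. h n x \<partial>M)) \<longlonglongrightarrow> 0"
    using tendsto_add[OF _ h0] by fastforce
  show ?thesis
  proof (rule tendsto_sandwich[OF _ _ tendsto_const lim])
    show "\<forall>\<^sub>F n in sequentially. 0 \<le> (\<integral>x. f n x \<partial>M)"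
      by (rule always_eventually, intro allI integral_nonneg_AE nn(1))
    have "(\<integral>x. f n x \<partial>M) \<le> (\<integral>x. k n x + h n x \<partial>M)" for n
      using fi ki h by (intro integral_mono) (auto simp: k_def)
    then show "\<forall>\<^sub>F n in sequentially. (\<integral>x. f n x \<partial>M) \<le> (\<integral>x. k n x \<partial>M) + (\<integral>x. h n x \<partial>M)"
      using ki h by auto
  qed
qed

text \<open>Transfers strong convergence through a nonlinear map: the \<open>dn n\<close> need only
  converge almost everywhere and be dominated by the strongly convergent \<open>en n\<close>. The
  domination bounds |d - dn n|^p by a fixed integrable function plus a multiple of |e - en
  n|^p.\<close>

lemma Lp_convergence_dominated:
  assumes p: "0 \<le> p" and e: "in_Lp M p e" "\<And>n. in_Lp M p (en n)"
    and lim: "(\<lambda>n. \<integral>x. \<bar>e x - en n x\<bar> powr p \<partial>M) \<longlonglongrightarrow> 0"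
    and [measurable]: "d \<in> borel_measurable M" "\<And>n. dn n \<in> borel_measurable M"
    and dom: "\<And>x. \<bar>d x\<bar> \<le> L * \<bar>e x\<bar>" "\<And>n x. \<bar>dn n x\<bar> \<le> L * \<bar>en n x\<bar>" and L: "0 \<le> L"
    and ae: "AE x in M. (\<lambda>n. dn n x) \<longlonglongrightarrow> d x"
    and p0: "0 < p"
  shows "(\<lambda>n. \<integral>x. \<bar>d x - dn n x\<bar> powr p \<partial>M) \<longlonglongrightarrow> 0"
proof (rule integral_tendsto_zero_dominated)
  \<comment> \<open>Collects the factors of two uses of \<open>abs_add_powr_le\<close>, one to split
    d - dn n and one to split en n around e.\<close>
  define C where "C = 2 powr p * L powr p * (2 powr p + 1)"
  have C: "0 \<le> C" by (simp add: C_def)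
  note [measurable] = in_LpD[OF e(1)] in_LpD[OF e(2)]
  have i: "integrable M (\<lambda>x. \<bar>e x - en n x\<bar> powr p)" for n
    using in_Lp_diff[OF p e(1) e(2)] by (simp add: in_Lp_def)
  show "(\<lambda>x. \<bar>d x - dn n x\<bar> powr p) \<in> borel_measurable M" for n by measurable
  show "integrable M (\<lambda>x. C * \<bar>e x - en n x\<bar> powr p)" for n
    using i by auto
  show "integrable M (\<lambda>x. C * \<bar>e x\<bar> powr p)"
    using e by (auto simp: in_Lp_def)
  show "(\<lambda>n. \<integral>x. C * \<bar>e x - en n x\<bar> powr p \<partial>M) \<longlonglongrightarrow> 0"
    using tendsto_mult_left[OF lim, of C] by simp
  show "AE x in M. \<bar>d x - dn n x\<bar> powr p \<le> C * \<bar>e x\<bar> powr p + C * \<bar>e x - en n x\<bar> powr p" for n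
  proof (rule AE_I2)
    fix x
    have a: "\<bar>dn n x\<bar> powr p \<le> L powr p * \<bar>en n x\<bar> powr p"
      using dom(2)[of n x] p L by (metis abs_ge_zero powr_mono2 powr_mult)
    have b: "\<bar>d x\<bar> powr p \<le> L powr p * \<bar>e x\<bar> powr p"
      using dom(1)[of x] p L by (metis abs_ge_zero powr_mono2 powr_mult)
    have "\<bar>en n x\<bar> powr p \<le> 2 powr p * (\<bar>e x\<bar> powr p + \<bar>e x - en n x\<bar> powr p)"
      using abs_add_powr_le[OF p, of "e x" "en n x - e x"] by (simp add: abs_minus_commute)
    then have a': "\<bar>dn n x\<bar> powr p \<le> L powr p * (2 powr p * (\<bar>e x\<bar> powr p + \<bar>e x - en n x\<bar> powr p))"
      using a by (meson order_trans mult_left_mono powr_ge_zero)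
    have "\<bar>d x - dn n x\<bar> powr p \<le> 2 powr p * (\<bar>d x\<bar> powr p + \<bar>dn n x\<bar> powr p)"
      using abs_add_powr_le[OF p, of "d x" "- dn n x"] by simp
    also have "\<dots> \<le> 2 powr p * (L powr p * \<bar>e x\<bar> powr p + L powr p * (2 powr p * (\<bar>e x\<bar> powr p + \<bar>e x - en n x\<bar> powr p)))"
      using a' b by (intro mult_left_mono add_mono) auto
    also have "\<dots> = C * \<bar>e x\<bar> powr p + (2 powr p * L powr p * 2 powr p) * \<bar>e x - en n x\<bar> powr p"
      by (simp add: C_def algebra_simps)
    also have "\<dots> \<le> C * \<bar>e x\<bar> powr p + C * \<bar>e x - en n x\<bar> powr p"
      by (intro add_left_mono mult_right_mono) (auto simp: C_def algebra_simps)
    finally show "\<bar>d x - dn n x\<bar> powr p \<le> C * \<bar>e x\<bar> powr p + C * \<bar>e x - en n x\<bar> powr p" .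
  qed
  show "AE x in M. (\<lambda>n. \<bar>d x - dn n x\<bar> powr p) \<longlonglongrightarrow> 0"
    using ae
  proof eventually_elim
    case (elim x)
    have "(\<lambda>n. \<bar>d x - dn n x\<bar>) \<longlonglongrightarrow> \<bar>d x - d x\<bar>"
      by (intro tendsto_intros elim)
    then show ?case using p0 tendsto_zero_powrI[of "\<lambda>n. \<bar>d x - dn n x\<bar>" sequentially "\<lambda>_. p" p] by simp
  qed
qed (auto simp: mult_nonneg_nonneg)

lemma Lp_convergence_AE_subseq:
  assumes p: "0 < p" and e: "in_Lp M p e" "\<And>n. in_Lp M p (en n)"
    and lim: "(\<lambda>n. \<integral>x. \<bar>e x - en n x\<bar> powr p \<partial>M) \<longlonglongrightarrow> 0"
  obtains r :: "nat \<Rightarrow> nat" where "strict_mono r" "AE x in M. (\<lambda>n. en (r n) x) \<longlonglongrightarrow> e x"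
proof -
  have "integrable M (\<lambda>x. \<bar>e x - en n x\<bar> powr p)" for n
    using in_Lp_diff[OF _ e(1) e(2), of n] p by (simp add: in_Lp_def)
  then obtain r where r: "strict_mono r" "AE x in M. (\<lambda>n. \<bar>e x - en (r n) x\<bar> powr p) \<longlonglongrightarrow> 0"
    using tendsto_L1_AE_subseq[of M "\<lambda>n x. \<bar>e x - en n x\<bar> powr p"] lim by auto
  from r(2) have "AE x in M. (\<lambda>n. en (r n) x) \<longlonglongrightarrow> e x"
  proof eventually_elim
    case (elim x)
    have "(\<lambda>n. (\<bar>e x - en (r n) x\<bar> powr p) powr (1 / p)) \<longlonglongrightarrow> 0"
      using p elim tendsto_zero_powrI[OF elim, of "\<lambda>_. 1 / p" "1 / p"] by simp
    then have "(\<lambda>n. \<bar>e x - en (r n) x\<bar>) \<longlonglongrightarrow> 0"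
      using p by (simp add: powr_powr)
    then have "(\<lambda>n. e x - en (r n) x) \<longlonglongrightarrow> 0"
      by (rule tendsto_rabs_zero_cancel)
    then have "(\<lambda>n. e x - (e x - en (r n) x)) \<longlonglongrightarrow> e x - 0"
      by (intro tendsto_intros)
    then show ?case by simp
  qed
  with r(1) show ?thesis using that by blast
qed

lemma integrable_signed_power_mult:
  assumes p: "1 < p" and "in_Lp M p d" "in_Lp M p e"
  shows "integrable M (\<lambda>x. signed_power p (d x) * e x)"
proof (rule Bochner_Integration.integrable_bound)
  note [measurable] = in_LpD[OF assms(2)] in_LpD[OF assms(3)]
  show "integrable M (\<lambda>x. \<bar>d x\<bar> powr p + \<bar>e x\<bar> powr p)"
    using assms by (auto simp: in_Lp_def)
  show "AE x in M. norm (signed_power p (d x) * e x) \<le> norm (\<bar>d x\<bar> powr p + \<bar>e x\<bar> powr p)"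
    using signed_power_mult_le[OF p, of 1] by auto
qed (use assms in \<open>auto simp: in_Lp_def\<close>)

text \<open>Continuity in the second argument for a fixed first one. In the weighted Young
  inequality \<eta> is fixed so small that the part with d is below \<epsilon> / 2; the other part
  vanishes with n, however large its factor.\<close>

lemma signed_power_pairing_tendsto:
  assumes p: "1 < p" and d: "in_Lp M p d" and e: "in_Lp M p e" "\<And>n. in_Lp M p (en n)"
    and lim: "(\<lambda>n. \<integral>x. \<bar>e x - en n x\<bar> powr p \<partial>M) \<longlonglongrightarrow> 0"
  shows "(\<lambda>n. \<integral>x. signed_power p (d x) * en n x \<partial>M) \<longlonglongrightarrow> (\<integral>x. signed_power p (d x) * e x \<partial>M)"
proof (rule LIMSEQ_I)
  fix \<epsilon> :: real assume \<epsilon>: "0 < \<epsilon>"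
  define D where "D = (\<integral>x. \<bar>d x\<bar> powr p \<partial>M)"
  have D: "0 \<le> D" by (simp add: D_def)
  \<comment> \<open>D + 1 in place of D covers the case that d vanishes almost everywhere.\<close>
  define \<eta> where "\<eta> = \<epsilon> / (2 * (D + 1))"
  have \<eta>: "0 < \<eta>" using \<epsilon> D by (simp add: \<eta>_def)
  have \<eta>D: "\<eta> * D < \<epsilon> / 2" using \<epsilon> D by (simp add: \<eta>_def field_simps)
  have "(\<lambda>n. \<eta> powr (1 - p) * (\<integral>x. \<bar>e x - en n x\<bar> powr p \<partial>M)) \<longlonglongrightarrow> 0"
    using tendsto_mult_left[OF lim, of "\<eta> powr (1 - p)"] by simp
  from LIMSEQ_D[OF this, of "\<epsilon> / 2"] \<epsilon> obtain n0 where n0: "\<And>n. n0 \<le> n \<Longrightarrow> \<bar>\<eta> powr (1 - p) * (\<integral>x. \<bar>e x - en n x\<bar> powr p \<partial>M)\<bar> < \<epsilon> / 2"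
    by auto
  show "\<exists>n0. \<forall>n\<ge>n0. norm ((\<integral>x. signed_power p (d x) * en n x \<partial>M) - (\<integral>x. signed_power p (d x) * e x \<partial>M)) < \<epsilon>"
  proof (intro exI[of _ n0] allI impI)
    fix n assume n: "n0 \<le> n"
    have df: "in_Lp M p (\<lambda>x. e x - en n x)" using p e by (intro in_Lp_diff) auto
    have i1: "integrable M (\<lambda>x. signed_power p (d x) * en n x)" "integrable M (\<lambda>x. signed_power p (d x) * e x)"
      "integrable M (\<lambda>x. signed_power p (d x) * (e x - en n x))"
      using p d e df by (auto intro!: integrable_signed_power_mult)
    have "norm ((\<integral>x. signed_power p (d x) * en n x \<partial>M) - (\<integral>x. signed_power p (d x) * e x \<partial>M))
        = norm (\<integral>x. signed_power p (d x) * (e x - en n x) \<partial>M)"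
      using i1 by (simp add: right_diff_distrib norm_minus_commute)
    also have "\<dots> \<le> (\<integral>x. norm (signed_power p (d x) * (e x - en n x)) \<partial>M)"
      by (rule integral_norm_bound)
    also have "\<dots> \<le> (\<integral>x. \<eta> * \<bar>d x\<bar> powr p + \<eta> powr (1 - p) * \<bar>e x - en n x\<bar> powr p \<partial>M)"
      using i1(3) d df signed_power_mult_le[OF p \<eta>]
      by (intro integral_mono) (auto simp: in_Lp_def)
    also have "\<dots> = \<eta> * D + \<eta> powr (1 - p) * (\<integral>x. \<bar>e x - en n x\<bar> powr p \<partial>M)"
      using d df by (simp add: in_Lp_def D_def)
    also have "\<dots> < \<epsilon>" using \<eta>D n0[OF n] by linarith
    finally show "norm ((\<integral>x. signed_power p (d x) * en n x \<partial>M) - (\<integral>x. signed_power p (d x) * e x \<partial>M)) < \<epsilon>" .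
  qed
qed

lemma tendsto_zero_mult_bound:
  fixes f g :: "nat \<Rightarrow> real"
  assumes "\<And>n. 0 \<le> f n" "\<And>n. f n \<le> C * g n" "g \<longlonglongrightarrow> 0"
  shows "f \<longlonglongrightarrow> 0"
proof (rule tendsto_sandwich[OF _ _ tendsto_const])
  show "(\<lambda>n. C * g n) \<longlonglongrightarrow> 0"
    using tendsto_mult_left[OF assms(3), of C] by simp
qed (use assms in auto)

section \<open>Lebesgue measure on products and under Lipschitz maps\<close>

lemma sigma_finite_measure_lebesgue: "sigma_finite_measure (lebesgue :: 'a::euclidean_space measure)"
proof -
  obtain A :: "'a set set" where "countable A" "A \<subseteq> sets lborel" "\<Union>A = space lborel" "\<forall>a\<in>A. emeasure lborel a \<noteq> \<infinity>"
    using lborel.sigma_finite_countable by blast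
  then show ?thesis
    by unfold_locales (intro exI[of _ A], auto intro: sets_completionI_sets)
qed

interpretation lebesgue: sigma_finite_measure "lebesgue :: 'a::euclidean_space measure"
  by (rule sigma_finite_measure_lebesgue)

interpretation lebesgue_pair: pair_sigma_finite
  "lebesgue :: 'a::euclidean_space measure" "lebesgue :: 'b::euclidean_space measure" ..

text \<open>The product of two completed measures is not the completed measure on pairs; continuous
  functions of a pair become measurable by factoring through the Borel sets.\<close>

lemma measurable_ident_lebesgue_pair:
  "(\<lambda>z. z) \<in> (lebesgue :: 'a::euclidean_space measure) \<Otimes>\<^sub>M (lebesgue :: 'b::euclidean_space measure) \<rightarrow>\<^sub>M borel"
proof -
  have "(\<lambda>z::'a \<times> 'b. (fst z, snd z)) \<in> lebesgue \<Otimes>\<^sub>M lebesgue \<rightarrow>\<^sub>M borel \<Otimes>\<^sub>M borel"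
    by (intro measurable_Pair measurable_compose[OF measurable_fst] measurable_compose[OF measurable_snd]
        measurable_completion measurable_ident_sets) auto
  then show ?thesis by (simp add: borel_prod)
qed

lemma AE_pair_lebesgue_fst:
  assumes "AE x in (lebesgue :: 'a::euclidean_space measure). P x"
  shows "AE z in (lebesgue :: 'a measure) \<Otimes>\<^sub>M (lebesgue :: 'b::euclidean_space measure). P (fst z)"
proof -
  obtain N where N: "N \<in> null_sets (lebesgue :: 'a measure)" "{x. \<not> P x} \<subseteq> N"
    using assms by (auto simp: eventually_ae_filter)
  have "N \<times> UNIV \<in> null_sets ((lebesgue :: 'a measure) \<Otimes>\<^sub>M (lebesgue :: 'b measure))"
    using N(1) lebesgue.emeasure_pair_measure_Times[of N lebesgue UNIV]
    by (auto simp: null_sets_def)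
  then show ?thesis
    by (rule AE_I') (use N(2) in auto)
qed

lemma AE_pair_lebesgue_snd:
  assumes "AE x in (lebesgue :: 'b::euclidean_space measure). P x"
  shows "AE z in (lebesgue :: 'a::euclidean_space measure) \<Otimes>\<^sub>M (lebesgue :: 'b measure). P (snd z)"
proof -
  obtain N where N: "N \<in> null_sets (lebesgue :: 'b measure)" "{x. \<not> P x} \<subseteq> N"
    using assms by (auto simp: eventually_ae_filter)
  have "UNIV \<times> N \<in> null_sets ((lebesgue :: 'a measure) \<Otimes>\<^sub>M (lebesgue :: 'b measure))"
    using N(1) lebesgue.emeasure_pair_measure_Times[of UNIV lebesgue N]
    by (auto simp: null_sets_def)
  then show ?thesis
    by (rule AE_I') (use N(2) in auto)
qed

definition difference :: "('a \<Rightarrow> real) \<Rightarrow> 'a \<times> 'a \<Rightarrow> real" where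
  "difference u z = u (fst z) - u (snd z)"

lemma borel_measurable_difference [measurable]:
  assumes [measurable]: "u \<in> borel_measurable M"
  shows "difference u \<in> borel_measurable (M \<Otimes>\<^sub>M M)"
  unfolding difference_def[abs_def] by measurable

text \<open>The exceptional pairs form a rectangle, and a null rectangle has a null side. This
  converts statements on almost all pairs of points into an alternative between two statements on
  points.\<close>

lemma AE_pair_lebesgue_not_both:
  fixes P :: "'a::euclidean_space \<Rightarrow> bool" and Q :: "'b::euclidean_space \<Rightarrow> bool"
  assumes [measurable]: "{x. P x} \<in> sets lebesgue" "{x. Q x} \<in> sets lebesgue"
    and ae: "AE z in lebesgue \<Otimes>\<^sub>M lebesgue. \<not> (P (fst z) \<and> Q (snd z))"
  shows "(AE x in lebesgue. \<not> P x) \<or> (AE x in lebesgue. \<not> Q x)"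
proof -
  have "{x. P x} \<times> {x. Q x} \<in> sets ((lebesgue :: 'a measure) \<Otimes>\<^sub>M (lebesgue :: 'b measure))"
    by (intro pair_measureI) (use assms in auto)
  moreover have "AE z in lebesgue \<Otimes>\<^sub>M lebesgue. z \<notin> {x. P x} \<times> {x. Q x}"
    using ae by eventually_elim auto
  ultimately have "{x. P x} \<times> {x. Q x} \<in> null_sets ((lebesgue :: 'a measure) \<Otimes>\<^sub>M (lebesgue :: 'b measure))"
    by (simp add: AE_iff_null_sets)
  then have "emeasure lebesgue {x. P x} * emeasure lebesgue {x. Q x} = 0"
    using lebesgue.emeasure_pair_measure_Times[of "{x. P x}" lebesgue "{x. Q x}"] by (auto simp: null_sets_def)
  then have "{x. P x} \<in> null_sets lebesgue \<or> {x. Q x} \<in> null_sets lebesgue"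
    by (auto simp: null_sets_def)
  then show ?thesis
    by (auto dest: AE_not_in)
qed

lemma ennreal_add_right_cancel_le: "a + ennreal c \<le> b + ennreal c \<Longrightarrow> a \<le> b"
  using ennreal_add_left_cancel_le[of "ennreal c" a b] by (simp add: add.commute)

section \<open>Lipschitz images of measurable sets and maps of bounded distortion\<close>

lemma emeasure_countable_cover_le:
  fixes f :: "'a set \<Rightarrow> 'b set"
  assumes D: "countable D" "\<And>X. X \<in> D \<Longrightarrow> interior' X \<in> sets M" "disjoint_family_on interior' D"
    and f: "\<And>X. X \<in> D \<Longrightarrow> f X \<in> sets N"
    and le: "\<And>X. X \<in> D \<Longrightarrow> emeasure N (f X) \<le> c * emeasure M (interior' X)"
  shows "emeasure N (\<Union>X\<in>D. f X) \<le> c * emeasure M (\<Union>X\<in>D. interior' X)"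
proof -
  define e where "e n = (if n \<in> to_nat_on D ` D then f (from_nat_into D n) else {})" for n
  define i where "i n = (if n \<in> to_nat_on D ` D then interior' (from_nat_into D n) else {})" for n
  have fr: "from_nat_into D n \<in> D" if "n \<in> to_nat_on D ` D" for n
    using that from_nat_into by (metis empty_iff image_empty)
  have e: "(\<Union>X\<in>D. f X) = (\<Union>n. e n)" and i: "(\<Union>X\<in>D. interior' X) = (\<Union>n. i n)"
    unfolding e_def i_def using D(1) fr from_nat_into_to_nat_on[OF D(1)]
    by (auto split: if_splits)
  have "disjoint_family i"
    unfolding disjoint_family_on_def
  proof (intro ballI impI)
    fix m n :: nat assume "m \<noteq> n"
    show "i m \<inter> i n = {}"
    proof (cases "m \<in> to_nat_on D ` D \<and> n \<in> to_nat_on D ` D")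
      case True
      then have "from_nat_into D m \<noteq> from_nat_into D n"
        using \<open>m \<noteq> n\<close> D(1) by auto
      then show ?thesis
        using D(3) fr True unfolding i_def disjoint_family_on_def by auto
    qed (auto simp: i_def)
  qed
  moreover have "range i \<subseteq> sets M" "range e \<subseteq> sets N"
    using D(2) f fr by (auto simp: i_def e_def)
  ultimately have "emeasure N (\<Union>n. e n) \<le> (\<Sum>n. emeasure N (e n))"
    and s: "(\<Sum>n. emeasure M (i n)) = emeasure M (\<Union>n. i n)"
    by (auto intro: emeasure_subadditive_countably suminf_emeasure)
  note this(1)
  also have "(\<Sum>n. emeasure N (e n)) \<le> (\<Sum>n. c * emeasure M (i n))"
    using le fr by (intro suminf_le) (auto simp: e_def i_def)
  also have "\<dots> = c * emeasure M (\<Union>n. i n)"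
    by (simp add: s)
  finally show ?thesis unfolding e i .
qed

text \<open>S is covered by non-overlapping cubes of total measure at most that of S plus e. A cube
  of side h has its image in a cube of side 2 L DIM h, so each measure grows by at most the stated
  factor; summing over the interiors and letting e tend to 0 gives the claim. Equal sides of the
  surrounding box make the covering intervals cubes.\<close>

lemma measure_lipschitz_image_le:
  fixes f :: "'a::euclidean_space \<Rightarrow> 'a"
  assumes S: "S \<in> lmeasurable" "S \<subseteq> cbox a b" and side: "\<And>i. i \<in> Basis \<Longrightarrow> b \<bullet> i - a \<bullet> i = side" "0 < side"
    and L: "0 \<le> L" "\<And>x y. x \<in> cbox a b \<Longrightarrow> y \<in> cbox a b \<Longrightarrow> norm (f x - f y) \<le> L * norm (x - y)"
    and fS: "f ` S \<in> sets lebesgue"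
  shows "emeasure lebesgue (f ` S) \<le> ennreal ((2 * L * DIM('a)) ^ DIM('a)) * emeasure lebesgue S"
proof -
  define C where "C = (2 * L * DIM('a)) ^ DIM('a)"
  have C: "0 \<le> C" using L by (simp add: C_def)
  have le: "emeasure lebesgue (f ` S) \<le> ennreal C * ennreal (measure lebesgue S + e)" if "0 < e" for e
  proof -
    have bab: "box a b \<noteq> {}"
      using side by (auto simp: box_ne_empty) (metis diff_gt_0_iff_gt)
    obtain D where D: "countable D" "\<And>K. K \<in> D \<Longrightarrow> K \<subseteq> cbox a b \<and> K \<noteq> {} \<and> (\<exists>c d. K = cbox c d)"
      "pairwise (\<lambda>A B. interior A \<inter> interior B = {}) D"
      "\<And>u v. cbox u v \<in> D \<Longrightarrow> \<exists>n. \<forall>i\<in>Basis. v \<bullet> i - u \<bullet> i = (b \<bullet> i - a \<bullet> i) / 2 ^ n"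
      "S \<subseteq> \<Union>D" "\<Union>D \<in> lmeasurable" "measure lebesgue (\<Union>D) \<le> measure lebesgue S + e"
      using measurable_outer_intervals_bounded[OF S \<open>0 < e\<close>] by metis
    have "\<exists>J. J \<in> sets lebesgue \<and> f ` K \<subseteq> J \<and> emeasure lebesgue J \<le> ennreal C * emeasure lebesgue (interior K)"
      if K: "K \<in> D" for K
    proof -
      obtain u v where uv: "K = cbox u v" "cbox u v \<noteq> {}" "cbox u v \<subseteq> cbox a b" using D(2)[OF K] by blast
      obtain n where n: "\<And>i. i \<in> Basis \<Longrightarrow> v \<bullet> i - u \<bullet> i = side / 2 ^ n"
        using D(4)[of u v] K uv side by auto
      define h where "h = side / 2 ^ n"
      have h: "0 < h" using side by (simp add: h_def)
      define r where "r = L * (DIM('a) * h)"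
      have r: "0 \<le> r" using L h by (simp add: r_def)
      \<comment> \<open>A cube around the image of the corner u; its half-side r bounds the distance
        of f x from f u, because the norm is at most the sum of the coordinates.\<close>
      define J where "J = cbox (f u - r *\<^sub>R One) (f u + r *\<^sub>R One)"
      have "f x \<in> J" if x: "x \<in> cbox u v" for x
      proof -
        have u: "u \<in> cbox u v" using uv(2) by (auto simp: box_ne_empty mem_box)
        have "norm (x - u) \<le> (\<Sum>i\<in>Basis. \<bar>(x - u) \<bullet> i\<bar>)" by (rule norm_le_l1)
        also have "\<dots> \<le> (\<Sum>i\<in>(Basis::'a set). h)"
        proof (rule sum_mono)
          fix i :: 'a assume i: "i \<in> Basis"
          have "u \<bullet> i \<le> x \<bullet> i" "x \<bullet> i \<le> v \<bullet> i" using x i by (auto simp: mem_box)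
          then show "\<bar>(x - u) \<bullet> i\<bar> \<le> h" using n[OF i] by (simp add: inner_diff_left h_def)
        qed
        finally have "norm (x - u) \<le> DIM('a) * h" by simp
        moreover have "norm (f x - f u) \<le> L * norm (x - u)"
          using L(2)[of x u] x u uv by blast
        ultimately have fr: "norm (f x - f u) \<le> r"
          unfolding r_def using L(1) by (meson order_trans mult_left_mono)
        show ?thesis
          unfolding J_def mem_box
        proof
          fix i :: 'a assume i: "i \<in> Basis"
          then have "\<bar>(f x - f u) \<bullet> i\<bar> \<le> r" using Basis_le_norm[OF i, of "f x - f u"] fr by linarith
          then show "(f u - r *\<^sub>R One) \<bullet> i \<le> f x \<bullet> i \<and> f x \<bullet> i \<le> (f u + r *\<^sub>R One) \<bullet> i"
            using i by (auto simp: inner_diff_left inner_add_left)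
        qed
      qed
      moreover have "emeasure lebesgue J \<le> ennreal C * emeasure lebesgue (interior K)"
      proof -
        have "emeasure lebesgue J = emeasure lborel J" by (simp add: J_def)
        also have "\<dots> = ennreal (\<Prod>i\<in>(Basis::'a set). (2 * r))"
          unfolding J_def using r
          by (subst emeasure_lborel_cbox)
            (auto simp: inner_diff_left inner_add_left algebra_simps intro!: arg_cong[where f=ennreal] prod.cong)
        also have "2 * r = (2 * L * DIM('a)) * h" by (simp add: r_def)
        also have "(\<Prod>i\<in>(Basis::'a set). (2 * L * DIM('a)) * h) = C * h ^ DIM('a)"
          by (simp only: C_def power_mult_distrib prod_constant)
        also have "ennreal (C * h ^ DIM('a)) = ennreal C * ennreal (h ^ DIM('a))"
          using C h by (simp add: ennreal_mult)
        also have "ennreal (h ^ DIM('a)) = emeasure lebesgue (interior K)"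
        proof -
          have "u \<bullet> i \<le> v \<bullet> i" if "i \<in> Basis" for i using n[OF that] h by (simp add: h_def)
          then have "emeasure lborel (box u v) = ennreal (\<Prod>i\<in>(Basis::'a set). (v - u) \<bullet> i)"
            by (rule emeasure_lborel_box)
          also have "(\<Prod>i\<in>(Basis::'a set). (v - u) \<bullet> i) = h ^ DIM('a)"
            using n by (simp add: inner_diff_left h_def)
          finally show ?thesis by (simp add: uv interior_cbox)
        qed
        finally show ?thesis by simp
      qed
      moreover have "J \<in> sets lebesgue" by (simp add: J_def)
      ultimately show ?thesis using uv(1) by blast
    qed
    then obtain J where J: "\<And>K. K \<in> D \<Longrightarrow> J K \<in> sets lebesgue" "\<And>K. K \<in> D \<Longrightarrow> f ` K \<subseteq> J K"
      "\<And>K. K \<in> D \<Longrightarrow> emeasure lebesgue (J K) \<le> ennreal C * emeasure lebesgue (interior K)"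
      by metis
    have JU: "(\<Union>K\<in>D. J K) \<in> sets lebesgue" using J(1) D(1) by (intro sets.countable_UN') auto
    have "f ` S \<subseteq> (\<Union>K\<in>D. J K)" using D(5) J(2) by blast
    then have "emeasure lebesgue (f ` S) \<le> emeasure lebesgue (\<Union>K\<in>D. J K)"
      using JU by (rule emeasure_mono)
    also have "\<dots> \<le> ennreal C * emeasure lebesgue (\<Union>K\<in>D. interior K)"
      using D(1,3) J(1,3)
      by (intro emeasure_countable_cover_le) (auto simp: disjoint_family_on_def pairwise_def)
    also have "\<dots> \<le> ennreal C * emeasure lebesgue (\<Union>D)"
      using D(6) interior_subset by (intro mult_left_mono emeasure_mono) (auto intro: fmeasurableD)
    also have "emeasure lebesgue (\<Union>D) = ennreal (measure lebesgue (\<Union>D))"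
      using D(6) by (simp add: emeasure_eq_measure2)
    also have "ennreal C * \<dots> \<le> ennreal C * ennreal (measure lebesgue S + e)"
      using D(7) by (intro mult_left_mono ennreal_leI) auto
    finally show ?thesis .
  qed
  have "(\<lambda>n. ennreal C * ennreal (measure lebesgue S + 1 / real (Suc n))) \<longlonglongrightarrow>
      ennreal C * ennreal (measure lebesgue S + 0)"
    using LIMSEQ_inverse_real_of_nat
    by (intro tendsto_intros ennreal_tendsto_cmult) (auto simp: inverse_eq_divide)
  then have "emeasure lebesgue (f ` S) \<le> ennreal C * ennreal (measure lebesgue S + 0)"
    by (rule LIMSEQ_le_const) (use le in \<open>auto simp del: of_nat_Suc\<close>)
  then show ?thesis
    using S(1) by (simp add: C_def emeasure_eq_measure2)
qed

text \<open>Smoothness controls the derivative in one fixed direction at a time. Summing the bounds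
  for the basis directions bounds the operator norm, and convexity allows the mean value
  estimate.\<close>

lemma smooth_lipschitz_on_compact_convex:
  fixes f :: "'a::euclidean_space \<Rightarrow> 'b::real_normed_vector"
  assumes f: "smooth f" and S: "compact S" "convex S"
  obtains B where "0 \<le> B" "\<And>x y. x \<in> S \<Longrightarrow> y \<in> S \<Longrightarrow> norm (f x - f y) \<le> B * norm (x - y)"
proof -
  have "\<exists>M. \<forall>x\<in>S. norm (frechet_derivative f (at x) v) \<le> M" for v
  proof -
    have "compact ((\<lambda>x. frechet_derivative f (at x) v) ` S)"
      using continuous_on_subset[OF smooth_imp_continuous_on_frechet_derivative[OF f]] S
      by (intro compact_continuous_image) auto
    from compact_imp_bounded[OF this] obtain M
      where "\<forall>y\<in>(\<lambda>x. frechet_derivative f (at x) v) ` S. norm y \<le> M"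
      unfolding bounded_iff by blast
    then show ?thesis by auto
  qed
  then have "\<forall>v. \<exists>M. \<forall>x\<in>S. norm (frechet_derivative f (at x) v) \<le> M" by blast
  from choice[OF this] obtain M where M: "\<And>v x. x \<in> S \<Longrightarrow> norm (frechet_derivative f (at x) v) \<le> M v"
    by blast
  define B where "B = (\<Sum>i\<in>Basis. \<bar>M i\<bar>)"
  have d: "(f has_derivative frechet_derivative f (at x)) (at x)" for x
    using smooth_imp_differentiable[OF f] by (simp add: frechet_derivative_works)
  have on: "onorm (frechet_derivative f (at x)) \<le> B" if x: "x \<in> S" for x
  proof (rule onorm_le)
    fix v
    have lin: "linear (frechet_derivative f (at x))" using d has_derivative_linear by blast
    have "frechet_derivative f (at x) v = (\<Sum>i\<in>Basis. (v \<bullet> i) *\<^sub>R frechet_derivative f (at x) i)"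
      by (subst euclidean_representation[of v, symmetric]) (simp only: linear_sum[OF lin] linear_cmul[OF lin])
    then have "norm (frechet_derivative f (at x) v) \<le> (\<Sum>i\<in>Basis. \<bar>v \<bullet> i\<bar> * norm (frechet_derivative f (at x) i))"
      using norm_sum[of "\<lambda>i. (v \<bullet> i) *\<^sub>R frechet_derivative f (at x) i" Basis] by simp
    also have "\<dots> \<le> (\<Sum>i\<in>Basis. norm v * \<bar>M i\<bar>)"
      using M[OF x] by (intro sum_mono mult_mono) (auto simp: Basis_le_norm intro: order_trans[OF _ abs_ge_self])
    finally show "norm (frechet_derivative f (at x) v) \<le> B * norm v"
      by (simp add: B_def sum_distrib_left mult.commute)
  qed
  have "norm (f x - f y) \<le> B * norm (x - y)" if "x \<in> S" "y \<in> S" for x y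
    by (rule differentiable_bound[OF S(2) has_derivative_at_withinI[OF d] on that])
  moreover have "0 \<le> B" by (simp add: B_def sum_nonneg)
  ultimately show ?thesis using that by blast
qed

text \<open>A quantitative substitute for invariance of the measure. It is formulated with
  preimages, so that it passes to integrals of f (T x) directly.\<close>

definition quasi_preserving :: "('a::euclidean_space \<Rightarrow> 'a) \<Rightarrow> real \<Rightarrow> bool" where
  "quasi_preserving T C \<longleftrightarrow> 0 \<le> C \<and> T \<in> lebesgue \<rightarrow>\<^sub>M lebesgue \<and>
     (\<forall>S\<in>sets lebesgue. emeasure lebesgue (T -` S) \<le> ennreal C * emeasure lebesgue S)"

text \<open>T has the smooth inverse h, so its preimages are images under h. The bound on bounded
  sets extends to all measurable sets by exhausting them with balls.\<close>

lemma quasi_preservingI: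
  fixes T h :: "'a::euclidean_space \<Rightarrow> 'a"
  assumes h: "smooth h" and inv: "\<And>x. T (h x) = x" "\<And>x. h (T x) = x" and C: "0 \<le> C"
    and le: "\<And>S. bounded S \<Longrightarrow> S \<in> lmeasurable \<Longrightarrow> emeasure lebesgue (h ` S) \<le> ennreal C * emeasure lebesgue S"
  shows "quasi_preserving T C"
proof -
  have vi: "T -` S = h ` S" for S using inv by (auto simp: image_iff) metis
  have m: "h ` S \<in> sets lebesgue" if "S \<in> sets lebesgue" for S
    using that smooth_imp_differentiable[OF h]
    by (intro differentiable_image_in_sets_lebesgue) (auto simp: differentiable_on_def intro: differentiable_at_withinI)
  have "emeasure lebesgue (h ` S) \<le> ennreal C * emeasure lebesgue S" if S: "S \<in> sets lebesgue" for S
  proof -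
    define B where "B n = S \<inter> cball 0 (real n)" for n
    have B: "B n \<in> lmeasurable" "bounded (B n)" for n
      using S by (auto simp: B_def intro: bounded_subset[OF bounded_cball] fmeasurable_Int_fmeasurable
          intro!: bounded_set_imp_lmeasurable)
    have inc: "incseq (\<lambda>n. h ` B n)" by (auto simp: incseq_def B_def)
    have "h ` S = (\<Union>n. h ` B n)"
      unfolding image_UN[symmetric] B_def using real_arch_simple by fastforce
    then have "emeasure lebesgue (h ` S) = (SUP n. emeasure lebesgue (h ` B n))"
      using SUP_emeasure_incseq[OF _ inc, of lebesgue] m fmeasurableD[OF B(1)]
      by (simp add: image_subset_iff del: emeasure_completion)
    also have "\<dots> \<le> ennreal C * emeasure lebesgue S"
    proof (rule SUP_least)
      fix n
      have "emeasure lebesgue (h ` B n) \<le> ennreal C * emeasure lebesgue (B n)" using le B by blast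
      also have "\<dots> \<le> ennreal C * emeasure lebesgue S"
        using S by (intro mult_left_mono emeasure_mono) (auto simp: B_def)
      finally show "emeasure lebesgue (h ` B n) \<le> ennreal C * emeasure lebesgue S" .
    qed
    finally show ?thesis .
  qed
  moreover have "T \<in> lebesgue \<rightarrow>\<^sub>M lebesgue"
    by (rule measurableI) (use m in \<open>simp_all add: vi\<close>)
  ultimately show ?thesis
    unfolding quasi_preserving_def vi using C by blast
qed

lemma quasi_preserving_compose:
  assumes "quasi_preserving T C" "quasi_preserving T' C'"
  shows "quasi_preserving (\<lambda>x. T (T' x)) (C' * C)"
  unfolding quasi_preserving_def
proof (intro conjI ballI)
  show "(\<lambda>x. T (T' x)) \<in> lebesgue \<rightarrow>\<^sub>M lebesgue"
    using assms measurable_compose[of T' lebesgue lebesgue T lebesgue] by (auto simp: quasi_preserving_def)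
  fix S :: "'a set" assume S: "S \<in> sets lebesgue"
  have m: "T -` S \<in> sets lebesgue"
    using assms(1) S measurable_sets[of T lebesgue lebesgue S] by (auto simp: quasi_preserving_def)
  have "emeasure lebesgue ((\<lambda>x. T (T' x)) -` S) = emeasure lebesgue (T' -` (T -` S))"
    by (simp add: vimage_def)
  also have "\<dots> \<le> ennreal C' * emeasure lebesgue (T -` S)"
    using assms(2) m by (auto simp: quasi_preserving_def)
  also have "\<dots> \<le> ennreal C' * (ennreal C * emeasure lebesgue S)"
    using assms(1) S by (intro mult_left_mono) (auto simp: quasi_preserving_def)
  also have "\<dots> = ennreal (C' * C) * emeasure lebesgue S"
    using assms by (simp add: quasi_preserving_def ennreal_mult mult.assoc)
  finally show "emeasure lebesgue ((\<lambda>x. T (T' x)) -` S) \<le> ennreal (C' * C) * emeasure lebesgue S" .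
qed (use assms in \<open>auto simp: quasi_preserving_def\<close>)

lemma quasi_preserving_nn_integral:
  assumes T: "quasi_preserving T C" and [measurable]: "f \<in> borel_measurable lebesgue"
  shows "(\<integral>\<^sup>+x. f (T x) \<partial>lebesgue) \<le> ennreal C * (\<integral>\<^sup>+x. f x \<partial>lebesgue)"
proof -
  have [measurable]: "T \<in> lebesgue \<rightarrow>\<^sub>M lebesgue" using T by (simp add: quasi_preserving_def)
  have "distr lebesgue lebesgue T \<le> scale_measure (ennreal C) lebesgue"
    using T by (subst le_measure) (auto simp: emeasure_distr quasi_preserving_def)
  then have "nn_integral (distr lebesgue lebesgue T) f \<le> nn_integral (scale_measure (ennreal C) lebesgue) f"
    by (intro nn_integral_mono_measure) auto
  then show ?thesis by (simp add: nn_integral_distr nn_integral_scale_measure)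
qed

text \<open>The same map acts on both variables; by Tonelli each of them costs one factor C.\<close>

lemma quasi_preserving_nn_integral_pair:
  fixes T :: "'a::euclidean_space \<Rightarrow> 'a"
  assumes T: "quasi_preserving T C"
    and f[measurable]: "f \<in> borel_measurable ((lebesgue :: 'a measure) \<Otimes>\<^sub>M (lebesgue :: 'a measure))"
  shows "(\<integral>\<^sup>+z. f (T (fst z), T (snd z)) \<partial>(lebesgue \<Otimes>\<^sub>M lebesgue)) \<le>
    ennreal (C * C) * (\<integral>\<^sup>+z. f z \<partial>(lebesgue \<Otimes>\<^sub>M lebesgue))"
proof -
  have [measurable]: "T \<in> lebesgue \<rightarrow>\<^sub>M lebesgue" and C: "0 \<le> C" using T by (auto simp: quasi_preserving_def)
  have "(\<integral>\<^sup>+z. f (T (fst z), T (snd z)) \<partial>(lebesgue \<Otimes>\<^sub>M lebesgue)) =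
      (\<integral>\<^sup>+x. \<integral>\<^sup>+y. f (T x, T y) \<partial>lebesgue \<partial>lebesgue)"
    by (subst lebesgue.nn_integral_fst[symmetric]) auto
  also have "\<dots> \<le> (\<integral>\<^sup>+x. ennreal C * (\<integral>\<^sup>+y. f (T x, y) \<partial>lebesgue) \<partial>lebesgue)"
  proof (rule nn_integral_mono)
    fix x
    show "(\<integral>\<^sup>+y. f (T x, T y) \<partial>lebesgue) \<le> ennreal C * (\<integral>\<^sup>+y. f (T x, y) \<partial>lebesgue)"
      by (rule quasi_preserving_nn_integral[OF T]) measurable
  qed
  also have "\<dots> = ennreal C * (\<integral>\<^sup>+x. (\<integral>\<^sup>+y. f (T x, y) \<partial>lebesgue) \<partial>lebesgue)"
    by (intro nn_integral_cmult) measurable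
  also have "\<dots> \<le> ennreal C * (ennreal C * (\<integral>\<^sup>+x. (\<integral>\<^sup>+y. f (x, y) \<partial>lebesgue) \<partial>lebesgue))"
    by (intro mult_left_mono quasi_preserving_nn_integral[OF T]) auto
  also have "(\<integral>\<^sup>+x. (\<integral>\<^sup>+y. f (x, y) \<partial>lebesgue) \<partial>lebesgue) = (\<integral>\<^sup>+z. f z \<partial>(lebesgue \<Otimes>\<^sub>M lebesgue))"
    by (rule lebesgue.nn_integral_fst) measurable
  finally show ?thesis using C by (simp add: ennreal_mult mult.assoc)
qed

section \<open>The fractional Sobolev space\<close>

locale fractional_eigenproblem =
  fixes G :: "('n::finite) graded_group" and s p :: real and \<Omega> :: "(real ^ 'n) set"
  assumes s_pos: "0 < s" and p_gt_1: "1 < p"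
    and stratified: "stratified_lie_group G"
    and quasi_norm: "homogeneous_quasi_norm G"
    and open_domain: "open \<Omega>" and bounded_domain: "bounded \<Omega>"
begin

lemma p_pos: "0 < p" "0 \<le> p" "p \<noteq> 0"
  using p_gt_1 by auto

sublocale G: group "gmult G" 0 "ginv G"
  using stratified by (simp add: stratified_lie_group_def)

section \<open>The kernel and the two measures that carry the norms\<close>

abbreviation K :: "real ^ 'n \<Rightarrow> real ^ 'n \<Rightarrow> real" where "K \<equiv> frac_weight G s p"

lemma K_exponent_pos: "0 < real (homogeneous_dim G) + p * s"
  using s_pos p_gt_1 by (simp add: add_nonneg_pos)

lemma K_nonneg: "0 \<le> K x y"
  by (simp add: frac_weight_def)

lemma K_pos: "x \<noteq> y \<Longrightarrow> 0 < K x y"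
proof -
  assume "x \<noteq> y"
  then have "gmult G (ginv G y) x \<noteq> 0"
    by (metis G.assoc G.group_left_neutral G.left_inverse G.right_inverse G.right_neutral)
  then have "0 < qnorm G (gmult G (ginv G y) x)"
    using quasi_norm unfolding homogeneous_quasi_norm_def by (metis order_less_le)
  then show ?thesis by (simp add: frac_weight_def)
qed

lemma qnorm_ginv: "qnorm G (ginv G x) = qnorm G x"
  using quasi_norm by (simp add: homogeneous_quasi_norm_def)

lemma qnorm_difference_commute: "qnorm G (gmult G (ginv G x) y) = qnorm G (gmult G (ginv G y) x)"
  using qnorm_ginv[of "gmult G (ginv G x) y"] by (simp add: G.inverse_distrib_swap)

lemma smooth_gmult_right: "smooth (gmult G a)"
proof -
  have "smooth (\<lambda>(x, y). gmult G x y)"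
    using stratified by (simp add: stratified_lie_group_def)
  from smooth_compose[OF this smooth_Pair_right[of a]] show ?thesis by simp
qed

lemma continuous_on_gmult [continuous_intros]:
  assumes "continuous_on S f" "continuous_on S g"
  shows "continuous_on S (\<lambda>x. gmult G (f x) (g x))"
proof -
  have "continuous_on UNIV (\<lambda>z. gmult G (fst z) (snd z))"
    using stratified smooth_imp_continuous_on
    unfolding stratified_lie_group_def split_beta by blast
  from continuous_on_compose2[OF this continuous_on_Pair[OF assms]] show ?thesis by simp
qed

lemma continuous_on_ginv [continuous_intros]:
  assumes "continuous_on S f" shows "continuous_on S (\<lambda>x. ginv G (f x))"
proof -
  have "continuous_on UNIV (ginv G)"
    using stratified smooth_imp_continuous_on unfolding stratified_lie_group_def by blast
  from continuous_on_compose2[OF this assms] show ?thesis by simp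
qed

lemma continuous_on_qnorm [continuous_intros]:
  assumes "continuous_on S f" shows "continuous_on S (\<lambda>x. qnorm G (f x))"
proof -
  have "continuous_on UNIV (qnorm G)"
    using quasi_norm unfolding homogeneous_quasi_norm_def by blast
  from continuous_on_compose2[OF this assms] show ?thesis by simp
qed

lemma qnorm_nonneg: "0 \<le> qnorm G x"
  using quasi_norm by (simp add: homogeneous_quasi_norm_def)

lemma continuous_on_K: "continuous_on UNIV (\<lambda>z. K (fst z) (snd z))"
  unfolding frac_weight_def using K_exponent_pos
  by (intro continuous_on_powr' continuous_intros) (auto simp: qnorm_nonneg)

lemma borel_measurable_K [measurable]:
  "(\<lambda>z. K (fst z) (snd z)) \<in> borel_measurable (lebesgue \<Otimes>\<^sub>M lebesgue)"
  using measurable_compose[OF measurable_ident_lebesgue_pair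
      borel_measurable_continuous_onI[OF continuous_on_K]] by simp

text \<open>With \<open>M\<Omega>\<close> and \<open>MK\<close> the two parts of the norm become
  plain L^p norms, of u and of \<open>difference u\<close>. On the diagonal \<open>K\<close> is 0
  and 1 / 0 = 0, so there the density of \<open>MK\<close> is 0.\<close>

definition M\<Omega> :: "(real ^ 'n) measure" where
  "M\<Omega> = density lebesgue (\<lambda>x. ennreal (indicator \<Omega> x))"

definition MK :: "((real ^ 'n) \<times> (real ^ 'n)) measure" where
  "MK = density (lebesgue \<Otimes>\<^sub>M lebesgue) (\<lambda>z. ennreal (1 / K (fst z) (snd z)))"

lemma sets_M\<Omega> [measurable_cong, simp]: "sets M\<Omega> = sets lebesgue"
  by (simp add: M\<Omega>_def)

lemma sets_MK [measurable_cong, simp]: "sets MK = sets (lebesgue \<Otimes>\<^sub>M lebesgue)"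
  by (simp add: MK_def)

lemma domain_measurable [measurable]: "\<Omega> \<in> sets lebesgue"
  using open_domain by simp

lemma AE_M\<Omega>_iff: "(AE x in M\<Omega>. P x) \<longleftrightarrow> (AE x in lebesgue. x \<in> \<Omega> \<longrightarrow> P x)"
  unfolding M\<Omega>_def by (subst AE_density) (auto simp: indicator_def)

lemma AE_M\<Omega>I: "AE x in lebesgue. P x \<Longrightarrow> AE x in M\<Omega>. P x"
  unfolding AE_M\<Omega>_iff by auto

lemma AE_MKI: "AE x in lebesgue \<Otimes>\<^sub>M lebesgue. P x \<Longrightarrow> AE x in MK. P x"
  unfolding MK_def by (subst AE_density) auto

lemma integrable_M\<Omega>_iff:
  fixes f :: "real ^ 'n \<Rightarrow> real"
  assumes "f \<in> borel_measurable lebesgue"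
  shows "integrable M\<Omega> f \<longleftrightarrow> set_integrable lebesgue \<Omega> f"
  unfolding M\<Omega>_def set_integrable_def using assms by (subst integrable_density) auto

lemma integral_M\<Omega>:
  fixes f :: "real ^ 'n \<Rightarrow> real"
  assumes "f \<in> borel_measurable lebesgue"
  shows "integral\<^sup>L M\<Omega> f = (LINT x:\<Omega>|lebesgue. f x)"
  unfolding M\<Omega>_def set_lebesgue_integral_def using assms by (subst integral_density) auto

lemma integrable_MK_iff:
  fixes f :: "(real ^ 'n) \<times> (real ^ 'n) \<Rightarrow> real"
  assumes "f \<in> borel_measurable (lebesgue \<Otimes>\<^sub>M lebesgue)"
  shows "integrable MK f \<longleftrightarrow> integrable (lebesgue \<Otimes>\<^sub>M lebesgue) (\<lambda>z. f z / K (fst z) (snd z))"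
  unfolding MK_def using assms K_nonneg by (subst integrable_density) auto

lemma integral_MK:
  fixes f :: "(real ^ 'n) \<times> (real ^ 'n) \<Rightarrow> real"
  assumes "f \<in> borel_measurable (lebesgue \<Otimes>\<^sub>M lebesgue)"
  shows "integral\<^sup>L MK f = (\<integral>z. f z / K (fst z) (snd z) \<partial>(lebesgue \<Otimes>\<^sub>M lebesgue))"
  unfolding MK_def using assms K_nonneg by (subst integral_density) auto

definition mass :: "(real ^ 'n \<Rightarrow> real) \<Rightarrow> real" where
  "mass u = (\<integral>x. \<bar>u x\<bar> powr p \<partial>M\<Omega>)"

definition energy :: "(real ^ 'n \<Rightarrow> real) \<Rightarrow> real" where
  "energy u = (\<integral>z. \<bar>difference u z\<bar> powr p \<partial>MK)"

lemma mass_nonneg: "0 \<le> mass u"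
  by (simp add: mass_def)

lemma energy_nonneg: "0 \<le> energy u"
  by (simp add: energy_def)

lemma Lp_norm_eq: "u \<in> borel_measurable lebesgue \<Longrightarrow> Lp_norm p \<Omega> u = mass u powr (1 / p)"
  unfolding Lp_norm_def mass_def by (subst integral_M\<Omega>) auto

lemma gagliardo_integrand_eq:
  "gagliardo_integrand G s p u = (\<lambda>z. \<bar>difference u z\<bar> powr p / K (fst z) (snd z))"
  by (auto simp: gagliardo_integrand_def difference_def)

lemma gagliardo_seminorm_eq:
  assumes [measurable]: "u \<in> borel_measurable lebesgue"
  shows "gagliardo_seminorm G s p u = energy u powr (1 / p)"
  unfolding gagliardo_seminorm_def energy_def gagliardo_integrand_eq by (subst integral_MK) auto

lemma finite_norm_iff:
  "finite_norm G s p \<Omega> u \<longleftrightarrow>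
     u \<in> borel_measurable lebesgue \<and> in_Lp M\<Omega> p u \<and> in_Lp MK p (difference u)"
proof (cases "u \<in> borel_measurable lebesgue")
  case True
  note [measurable] = True
  have "set_integrable lebesgue \<Omega> (\<lambda>x. \<bar>u x\<bar> powr p) \<longleftrightarrow> integrable M\<Omega> (\<lambda>x. \<bar>u x\<bar> powr p)"
    by (rule integrable_M\<Omega>_iff[symmetric]) measurable
  moreover have "integrable (lebesgue \<Otimes>\<^sub>M lebesgue) (gagliardo_integrand G s p u) \<longleftrightarrow>
      integrable MK (\<lambda>z. \<bar>difference u z\<bar> powr p)"
    unfolding gagliardo_integrand_eq by (rule integrable_MK_iff[symmetric]) measurable
  moreover have "u \<in> borel_measurable M\<Omega>" "difference u \<in> borel_measurable MK"
    by measurable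
  ultimately show ?thesis
    unfolding finite_norm_def in_Lp_def using True by blast
qed (simp add: finite_norm_def)

text \<open>\<open>finite_norm\<close> expressed through the two measures. Being a test function
  does not include this, so \<open>fin\<close> accompanies every approximating sequence.\<close>

definition fin :: "(real ^ 'n \<Rightarrow> real) \<Rightarrow> bool" where
  "fin u \<longleftrightarrow> u \<in> borel_measurable lebesgue \<and> in_Lp M\<Omega> p u \<and> in_Lp MK p (difference u)"

lemma fin_measurable [measurable_dest]: "fin u \<Longrightarrow> u \<in> borel_measurable lebesgue"
  by (simp add: fin_def)

lemma fin_Lp: "fin u \<Longrightarrow> in_Lp M\<Omega> p u" "fin u \<Longrightarrow> in_Lp MK p (difference u)"
  by (auto simp: fin_def)

lemma difference_add: "difference (\<lambda>x. u x + v x) = (\<lambda>z. difference u z + difference v z)"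
  and difference_diff: "difference (\<lambda>x. u x - v x) = (\<lambda>z. difference u z - difference v z)"
  and difference_cmult: "difference (\<lambda>x. c * u x) = (\<lambda>z. c * difference u z)"
  by (auto simp: difference_def algebra_simps)

lemma fin_add: "fin u \<Longrightarrow> fin v \<Longrightarrow> fin (\<lambda>x. u x + v x)"
  using p_pos by (auto simp: fin_def difference_add intro!: in_Lp_add)

lemma fin_cmult: "fin u \<Longrightarrow> fin (\<lambda>x. c * u x)"
  by (auto simp: fin_def difference_cmult intro!: in_Lp_cmult)

lemma fin_diff: "fin u \<Longrightarrow> fin v \<Longrightarrow> fin (\<lambda>x. u x - v x)"
  using fin_add[OF _ fin_cmult[of v "-1"]] by simp

lemma mass_cmult: "mass (\<lambda>x. c * u x) = \<bar>c\<bar> powr p * mass u"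
  by (simp add: mass_def abs_mult powr_mult)

lemma energy_cmult: "energy (\<lambda>x. c * u x) = \<bar>c\<bar> powr p * energy u"
  by (simp add: energy_def difference_cmult abs_mult powr_mult)

section \<open>Strong convergence and the linear structure of the space\<close>

definition strongly_tendsto :: "(nat \<Rightarrow> real ^ 'n \<Rightarrow> real) \<Rightarrow> (real ^ 'n \<Rightarrow> real) \<Rightarrow> bool" where
  "strongly_tendsto f u \<longleftrightarrow>
     (\<lambda>n. mass (\<lambda>x. u x - f n x)) \<longlonglongrightarrow> 0 \<and> (\<lambda>n. energy (\<lambda>x. u x - f n x)) \<longlonglongrightarrow> 0"

abbreviation XX :: "(real ^ 'n \<Rightarrow> real) set" where "XX \<equiv> X0 G s p \<Omega>"

lemma powr_inverse_p: "0 \<le> x \<Longrightarrow> (x powr (1 / p)) powr p = x"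
  using p_pos by (simp add: powr_powr)

lemma X0_fin: "u \<in> XX \<Longrightarrow> fin u"
  by (simp add: X0_def finite_norm_iff fin_def)

lemma X0_measurable: "u \<in> XX \<Longrightarrow> u \<in> borel_measurable lebesgue"
  by (rule fin_measurable[OF X0_fin])

lemma X0_Lp: "u \<in> XX \<Longrightarrow> in_Lp M\<Omega> p u" "u \<in> XX \<Longrightarrow> in_Lp MK p (difference u)"
  by (auto dest: X0_fin fin_Lp)

lemma X0_zero_outside: "u \<in> XX \<Longrightarrow> AE x in lebesgue. x \<notin> \<Omega> \<longrightarrow> u x = 0"
  by (simp add: X0_def)

lemma X0_approximable:
  assumes "u \<in> XX"
  obtains f where "\<And>n. f n \<in> test_functions \<Omega>" "\<And>n. fin (f n)" "strongly_tendsto f u"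
proof -
  define \<epsilon> where "\<epsilon> n = (1 / real (Suc n))" for n
  have "\<exists>\<phi>\<in>test_functions \<Omega>. fin (\<lambda>x. u x - \<phi> x) \<and>
      mass (\<lambda>x. u x - \<phi> x) powr (1/p) + energy (\<lambda>x. u x - \<phi> x) powr (1/p) < \<epsilon> n" for n
  proof -
    have "0 < \<epsilon> n" by (simp add: \<epsilon>_def)
    then obtain \<phi> where \<phi>: "\<phi> \<in> test_functions \<Omega>" "finite_norm G s p \<Omega> (\<lambda>x. u x - \<phi> x)"
      "Lp_norm p \<Omega> (\<lambda>x. u x - \<phi> x) + gagliardo_seminorm G s p (\<lambda>x. u x - \<phi> x) < \<epsilon> n"
      using assms unfolding X0_def by blast
    have fin: "fin (\<lambda>x. u x - \<phi> x)" using \<phi>(2) unfolding finite_norm_iff fin_def .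
    show ?thesis
      using \<phi>(3) fin
      unfolding Lp_norm_eq[OF fin_measurable[OF fin]] gagliardo_seminorm_eq[OF fin_measurable[OF fin]]
      by (intro bexI[OF _ \<phi>(1)] conjI)
  qed
  then have "\<forall>n. \<exists>\<phi>. \<phi> \<in> test_functions \<Omega> \<and> fin (\<lambda>x. u x - \<phi> x) \<and>
      mass (\<lambda>x. u x - \<phi> x) powr (1/p) + energy (\<lambda>x. u x - \<phi> x) powr (1/p) < \<epsilon> n"
    by blast
  from choice[OF this] obtain f where f: "\<And>n. f n \<in> test_functions \<Omega>" "\<And>n. fin (\<lambda>x. u x - f n x)"
    "\<And>n. mass (\<lambda>x. u x - f n x) powr (1/p) + energy (\<lambda>x. u x - f n x) powr (1/p) < \<epsilon> n"
    by blast
  \<comment> \<open>The definition of \<open>X0\<close> bounds only u - f n; since u is finite as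
    well, so is f n.\<close>
  have "fin (f n)" for n
    using fin_diff[OF X0_fin[OF assms] f(2)[of n]] by simp
  moreover have "strongly_tendsto f u"
    unfolding strongly_tendsto_def
  proof
    have \<epsilon>0: "(\<lambda>n. \<epsilon> n powr p) \<longlonglongrightarrow> 0"
    proof (rule tendsto_zero_powrI[OF _ tendsto_const])
      show "\<epsilon> \<longlonglongrightarrow> 0" unfolding \<epsilon>_def using LIMSEQ_inverse_real_of_nat by (simp add: inverse_eq_divide)
    qed (use p_pos in \<open>auto simp: \<epsilon>_def\<close>)
    have "mass (\<lambda>x. u x - f n x) \<le> \<epsilon> n powr p" for n
    proof -
      have "(mass (\<lambda>x. u x - f n x) powr (1/p)) powr p \<le> \<epsilon> n powr p"
        using f(3)[of n] p_pos powr_ge_zero[of "mass (\<lambda>x. u x - f n x)" "1/p"]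
          powr_ge_zero[of "energy (\<lambda>x. u x - f n x)" "1/p"]
        by (intro powr_mono2) linarith+
      then show ?thesis by (simp add: powr_inverse_p mass_nonneg)
    qed
    then show "(\<lambda>n. mass (\<lambda>x. u x - f n x)) \<longlonglongrightarrow> 0"
      by (intro tendsto_sandwich[OF _ _ tendsto_const \<epsilon>0] always_eventually) (auto simp: mass_nonneg)
    have "energy (\<lambda>x. u x - f n x) \<le> \<epsilon> n powr p" for n
    proof -
      have "(energy (\<lambda>x. u x - f n x) powr (1/p)) powr p \<le> \<epsilon> n powr p"
        using f(3)[of n] p_pos powr_ge_zero[of "mass (\<lambda>x. u x - f n x)" "1/p"]
          powr_ge_zero[of "energy (\<lambda>x. u x - f n x)" "1/p"]
        by (intro powr_mono2) linarith+
      then show ?thesis by (simp add: powr_inverse_p energy_nonneg)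
    qed
    then show "(\<lambda>n. energy (\<lambda>x. u x - f n x)) \<longlonglongrightarrow> 0"
      by (intro tendsto_sandwich[OF _ _ tendsto_const \<epsilon>0] always_eventually) (auto simp: energy_nonneg)
  qed
  ultimately show ?thesis using that f(1) by blast
qed

lemma X0I:
  assumes u: "fin u" "AE x in lebesgue. x \<notin> \<Omega> \<longrightarrow> u x = 0"
    and f: "\<And>n. f n \<in> test_functions \<Omega>" "\<And>n. fin (f n)" "strongly_tendsto f u"
  shows "u \<in> XX"
proof -
  have "\<exists>\<phi>\<in>test_functions \<Omega>. finite_norm G s p \<Omega> (\<lambda>x. u x - \<phi> x) \<and>
      Lp_norm p \<Omega> (\<lambda>x. u x - \<phi> x) + gagliardo_seminorm G s p (\<lambda>x. u x - \<phi> x) < \<epsilon>"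
    if "0 < \<epsilon>" for \<epsilon>
  proof -
    have "(\<lambda>n. mass (\<lambda>x. u x - f n x) powr (1/p) + energy (\<lambda>x. u x - f n x) powr (1/p)) \<longlonglongrightarrow> 0 + 0"
      using f(3) p_pos unfolding strongly_tendsto_def
      by (intro tendsto_add tendsto_zero_powrI[OF _ tendsto_const]) (auto simp: mass_nonneg energy_nonneg)
    then have "\<forall>\<^sub>F n in sequentially. mass (\<lambda>x. u x - f n x) powr (1/p) + energy (\<lambda>x. u x - f n x) powr (1/p) < \<epsilon>"
      using that by (intro order_tendstoD(2)) auto
    then obtain n where n: "mass (\<lambda>x. u x - f n x) powr (1/p) + energy (\<lambda>x. u x - f n x) powr (1/p) < \<epsilon>"
      using eventually_happens'[OF sequentially_bot] by blast
    have fin: "fin (\<lambda>x. u x - f n x)" using u(1) f(2) by (rule fin_diff)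
    show ?thesis
    proof (intro bexI[OF _ f(1)[of n]] conjI)
      show "finite_norm G s p \<Omega> (\<lambda>x. u x - f n x)"
        using fin unfolding finite_norm_iff fin_def .
    qed (use n in \<open>unfold Lp_norm_eq[OF fin_measurable[OF fin]] gagliardo_seminorm_eq[OF fin_measurable[OF fin]]\<close>)
  qed
  then show ?thesis using u by (auto simp: X0_def finite_norm_iff fin_def)
qed

lemma mass_add_le:
  assumes "fin u" "fin v"
  shows "mass (\<lambda>x. u x + v x) \<le> 2 powr p * (mass u + mass v)"
proof -
  have "mass (\<lambda>x. u x + v x) \<le> (\<integral>x. 2 powr p * (\<bar>u x\<bar> powr p + \<bar>v x\<bar> powr p) \<partial>M\<Omega>)"
    unfolding mass_def using fin_Lp(1)[OF fin_add[OF assms]] fin_Lp(1)[OF assms(1)] fin_Lp(1)[OF assms(2)]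
      abs_add_powr_le p_pos(2)
    by (intro integral_mono) (auto simp: in_Lp_def)
  also have "\<dots> = 2 powr p * (mass u + mass v)"
    using fin_Lp(1)[OF assms(1)] fin_Lp(1)[OF assms(2)] by (simp add: in_Lp_def mass_def)
  finally show ?thesis .
qed

lemma energy_add_le:
  assumes "fin u" "fin v"
  shows "energy (\<lambda>x. u x + v x) \<le> 2 powr p * (energy u + energy v)"
proof -
  have "energy (\<lambda>x. u x + v x) \<le> (\<integral>z. 2 powr p * (\<bar>difference u z\<bar> powr p + \<bar>difference v z\<bar> powr p) \<partial>MK)"
    unfolding energy_def
    using fin_Lp(2)[OF fin_add[OF assms]] fin_Lp(2)[OF assms(1)] fin_Lp(2)[OF assms(2)]
      abs_add_powr_le p_pos(2)
    by (intro integral_mono) (auto simp: in_Lp_def difference_add)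
  also have "\<dots> = 2 powr p * (energy u + energy v)"
    using fin_Lp(2)[OF assms(1)] fin_Lp(2)[OF assms(2)] by (simp add: in_Lp_def energy_def)
  finally show ?thesis .
qed

lemma strongly_tendsto_trans:
  assumes u: "fin u" "\<And>n. fin (f n)" "\<And>n. fin (g n)"
    and f: "strongly_tendsto f u"
    and g: "(\<lambda>n. mass (\<lambda>x. f n x - g n x)) \<longlonglongrightarrow> 0" "(\<lambda>n. energy (\<lambda>x. f n x - g n x)) \<longlonglongrightarrow> 0"
  shows "strongly_tendsto g u"
  unfolding strongly_tendsto_def
proof
  have f': "fin (\<lambda>x. u x - f n x)" "fin (\<lambda>x. f n x - g n x)" for n
    using u by (auto intro: fin_diff)
  show "(\<lambda>n. mass (\<lambda>x. u x - g n x)) \<longlonglongrightarrow> 0"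
  proof (rule tendsto_zero_mult_bound)
    show "mass (\<lambda>x. u x - g n x) \<le> 2 powr p * (mass (\<lambda>x. u x - f n x) + mass (\<lambda>x. f n x - g n x))" for n
      using mass_add_le[OF f'(1)[of n] f'(2)[of n]] by simp
    show "(\<lambda>n. mass (\<lambda>x. u x - f n x) + mass (\<lambda>x. f n x - g n x)) \<longlonglongrightarrow> 0"
      using f g tendsto_add_zero unfolding strongly_tendsto_def by blast
  qed (rule mass_nonneg)
  show "(\<lambda>n. energy (\<lambda>x. u x - g n x)) \<longlonglongrightarrow> 0"
  proof (rule tendsto_zero_mult_bound)
    show "energy (\<lambda>x. u x - g n x) \<le> 2 powr p * (energy (\<lambda>x. u x - f n x) + energy (\<lambda>x. f n x - g n x))" for n
      using energy_add_le[OF f'(1)[of n] f'(2)[of n]] by simp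
    show "(\<lambda>n. energy (\<lambda>x. u x - f n x) + energy (\<lambda>x. f n x - g n x)) \<longlonglongrightarrow> 0"
      using f g tendsto_add_zero unfolding strongly_tendsto_def by blast
  qed (rule energy_nonneg)
qed

text \<open>A diagonal choice: each f n is replaced by a test function whose mass and energy
  distance from it are below 1 / (n + 1).\<close>

lemma X0_closed:
  assumes u: "fin u" "AE x in lebesgue. x \<notin> \<Omega> \<longrightarrow> u x = 0"
    and f: "\<And>n. f n \<in> XX" "strongly_tendsto f u"
  shows "u \<in> XX"
proof -
  have "\<exists>\<phi>. \<phi> \<in> test_functions \<Omega> \<and> fin \<phi> \<and>
     mass (\<lambda>x. f n x - \<phi> x) < 1 / real (Suc n) \<and> energy (\<lambda>x. f n x - \<phi> x) < 1 / real (Suc n)" for n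
  proof -
    obtain \<psi> where \<psi>: "\<And>k. \<psi> k \<in> test_functions \<Omega>" "\<And>k. fin (\<psi> k)" "strongly_tendsto \<psi> (f n)"
      using X0_approximable[OF f(1)] by blast
    have "\<forall>\<^sub>F k in sequentially. mass (\<lambda>x. f n x - \<psi> k x) < 1 / real (Suc n)"
      "\<forall>\<^sub>F k in sequentially. energy (\<lambda>x. f n x - \<psi> k x) < 1 / real (Suc n)"
      using \<psi>(3) unfolding strongly_tendsto_def by (auto intro: order_tendstoD(2))
    then have "\<forall>\<^sub>F k in sequentially. mass (\<lambda>x. f n x - \<psi> k x) < 1 / real (Suc n) \<and>
        energy (\<lambda>x. f n x - \<psi> k x) < 1 / real (Suc n)"
      by eventually_elim auto
    then obtain k where "mass (\<lambda>x. f n x - \<psi> k x) < 1 / real (Suc n) \<and>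
        energy (\<lambda>x. f n x - \<psi> k x) < 1 / real (Suc n)"
      using eventually_happens'[OF sequentially_bot] by blast
    then show ?thesis using \<psi>(1,2) by blast
  qed
  then obtain \<phi> where \<phi>: "\<And>n. \<phi> n \<in> test_functions \<Omega>" "\<And>n. fin (\<phi> n)"
    "\<And>n. mass (\<lambda>x. f n x - \<phi> n x) < 1 / real (Suc n)" "\<And>n. energy (\<lambda>x. f n x - \<phi> n x) < 1 / real (Suc n)"
    using choice[of "\<lambda>n \<phi>. \<phi> \<in> test_functions \<Omega> \<and> fin \<phi> \<and>
     mass (\<lambda>x. f n x - \<phi> x) < 1 / real (Suc n) \<and> energy (\<lambda>x. f n x - \<phi> x) < 1 / real (Suc n)"] by blast
  have lim: "(\<lambda>n. 1 / real (Suc n)) \<longlonglongrightarrow> 0"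
    using LIMSEQ_inverse_real_of_nat by (simp add: inverse_eq_divide)
  have "(\<lambda>n. mass (\<lambda>x. f n x - \<phi> n x)) \<longlonglongrightarrow> 0"
    by (rule tendsto_sandwich[OF _ _ tendsto_const lim])
      (auto intro!: always_eventually less_imp_le[OF \<phi>(3)] simp: mass_nonneg simp del: of_nat_Suc)
  moreover have "(\<lambda>n. energy (\<lambda>x. f n x - \<phi> n x)) \<longlonglongrightarrow> 0"
    by (rule tendsto_sandwich[OF _ _ tendsto_const lim])
      (auto intro!: always_eventually less_imp_le[OF \<phi>(4)] simp: energy_nonneg simp del: of_nat_Suc)
  ultimately have "strongly_tendsto \<phi> u"
    by (rule strongly_tendsto_trans[OF u(1) X0_fin[OF f(1)] \<phi>(2) f(2)])
  then show ?thesis by (rule X0I[OF u \<phi>(1,2)])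
qed

lemma X0_add:
  assumes "u \<in> XX" "v \<in> XX" shows "(\<lambda>x. u x + v x) \<in> XX"
proof -
  obtain f where f: "\<And>k. f k \<in> test_functions \<Omega>" "\<And>k. fin (f k)" "strongly_tendsto f u"
    using X0_approximable[OF assms(1)] by blast
  obtain g where g: "\<And>k. g k \<in> test_functions \<Omega>" "\<And>k. fin (g k)" "strongly_tendsto g v"
    using X0_approximable[OF assms(2)] by blast
  note fu = X0_fin[OF assms(1)] and fv = X0_fin[OF assms(2)]
  show ?thesis
  proof (rule X0I)
    show "fin (\<lambda>x. u x + v x)" using fu fv by (rule fin_add)
    show "AE x in lebesgue. x \<notin> \<Omega> \<longrightarrow> u x + v x = 0"
      using X0_zero_outside[OF assms(1)] X0_zero_outside[OF assms(2)] by eventually_elim auto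
    show "(\<lambda>x. f n x + g n x) \<in> test_functions \<Omega>" for n
      using test_functions_lincomb[OF f(1) g(1), of 1 n 1 n] by simp
    show "fin (\<lambda>x. f n x + g n x)" for n using f(2) g(2) by (rule fin_add)
    \<comment> \<open>The summands are replaced one at a time: u + g n serves as the intermediate
      sequence between u + v and f n + g n.\<close>
    have "strongly_tendsto (\<lambda>n x. u x + g n x) (\<lambda>x. u x + v x)"
      using g(3) by (simp add: strongly_tendsto_def)
    then show "strongly_tendsto (\<lambda>n x. f n x + g n x) (\<lambda>x. u x + v x)"
      by (rule strongly_tendsto_trans[rotated 3])
        (use f g fu fv in \<open>auto intro: fin_add simp: strongly_tendsto_def\<close>)
  qed
qed

lemma X0_cmult:
  assumes "u \<in> XX" shows "(\<lambda>x. c * u x) \<in> XX"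
proof -
  obtain f where f: "\<And>k. f k \<in> test_functions \<Omega>" "\<And>k. fin (f k)" "strongly_tendsto f u"
    using X0_approximable[OF assms(1)] by blast
  show ?thesis
  proof (rule X0I)
    show "fin (\<lambda>x. c * u x)" using X0_fin[OF assms] by (rule fin_cmult)
    show "AE x in lebesgue. x \<notin> \<Omega> \<longrightarrow> c * u x = 0"
      using X0_zero_outside[OF assms(1)] by eventually_elim auto
    show "(\<lambda>x. c * f n x) \<in> test_functions \<Omega>" for n
      using test_functions_lincomb[OF f(1) f(1), of c n 0 n] by simp
    show "fin (\<lambda>x. c * f n x)" for n using f(2) by (rule fin_cmult)
    show "strongly_tendsto (\<lambda>n x. c * f n x) (\<lambda>x. c * u x)"
      using f(3) unfolding strongly_tendsto_def right_diff_distrib[symmetric] mass_cmult energy_cmult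
      by (intro conjI tendsto_mult_right_zero) auto
  qed
qed

lemma X0_diff: "u \<in> XX \<Longrightarrow> v \<in> XX \<Longrightarrow> (\<lambda>x. u x - v x) \<in> XX"
  using X0_add[OF _ X0_cmult[of v "-1"]] by simp

lemma test_function_zero_outside: "\<phi> \<in> test_functions \<Omega> \<Longrightarrow> x \<notin> \<Omega> \<Longrightarrow> \<phi> x = 0"
  using closure_subset[of "{x. \<phi> x \<noteq> 0}"] unfolding test_functions_def by blast

lemma test_function_bounded:
  assumes "\<phi> \<in> test_functions \<Omega>"
  obtains M :: real where "0 < M" "\<And>x. \<bar>\<phi> x\<bar> \<le> M"
proof -
  have "compact (\<phi> ` closure {x. \<phi> x \<noteq> 0})"
    using assms by (intro compact_continuous_image)
      (auto simp: test_functions_def intro: continuous_on_subset[OF smooth_imp_continuous_on])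
  then obtain M where M: "0 < M" "\<And>x. x \<in> closure {x. \<phi> x \<noteq> 0} \<Longrightarrow> \<bar>\<phi> x\<bar> \<le> M"
    using compact_imp_bounded bounded_pos by (metis imageI real_norm_def)
  have "\<bar>\<phi> x\<bar> \<le> M" for x
  proof (cases "\<phi> x = 0")
    case False
    then show ?thesis using M(2)[of x] closure_subset[of "{x. \<phi> x \<noteq> 0}"] by auto
  qed (use M in auto)
  with M(1) show ?thesis using that by blast
qed

section \<open>Composition with Lipschitz functions\<close>

lemma lipschitz_measurable:
  fixes F :: "real \<Rightarrow> real"
  assumes "\<And>x y. \<bar>F x - F y\<bar> \<le> L * \<bar>x - y\<bar>"
  shows "continuous_on UNIV F" "F \<in> borel_measurable borel"
proof -
  have "0 \<le> L" using assms[of 1 0] by simp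
  then have "L-lipschitz_on UNIV F"
    using assms by (auto intro!: lipschitz_onI simp: dist_real_def)
  then show "continuous_on UNIV F" by (rule lipschitz_on_continuous_on)
  then show "F \<in> borel_measurable borel" by (rule borel_measurable_continuous_onI)
qed

lemma fin_lipschitz:
  assumes u: "fin u" and [measurable]: "v \<in> borel_measurable lebesgue" and L: "0 \<le> L"
    and "\<And>x. \<bar>v x\<bar> \<le> L * \<bar>u x\<bar>" "\<And>x y. \<bar>v x - v y\<bar> \<le> L * \<bar>u x - u y\<bar>"
  shows "fin v" "mass v \<le> L powr p * mass u" "energy v \<le> L powr p * energy u"
proof -
  note 1 = in_Lp_bound[OF p_pos(2) fin_Lp(1)[OF u], of v L]
  note 2 = in_Lp_bound[OF p_pos(2) fin_Lp(2)[OF u], of "difference v" L]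
  have a: "AE x in M\<Omega>. \<bar>v x\<bar> \<le> L * \<bar>u x\<bar>" "AE z in MK. \<bar>difference v z\<bar> \<le> L * \<bar>difference u z\<bar>"
    "v \<in> borel_measurable M\<Omega>" "difference v \<in> borel_measurable MK"
    using assms(4,5) by (auto simp: difference_def)
  show "fin v" unfolding fin_def using 1(1) 2(1) a L by simp
  show "mass v \<le> L powr p * mass u" unfolding mass_def using 1(2) a L by simp
  show "energy v \<le> L powr p * energy u" unfolding energy_def using 2(2) a L by simp
qed

text \<open>\<open>Lp_convergence_dominated\<close> is used once for values and once for
  differences; almost everywhere convergence on points lifts to pairs through both
  projections.\<close>

lemma strongly_tendsto_dominated:
  assumes u: "fin u" "\<And>n. fin (f n)" "strongly_tendsto f u"
    and [measurable]: "v \<in> borel_measurable lebesgue" "\<And>n. g n \<in> borel_measurable lebesgue" and L: "0 \<le> L"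
    and v: "\<And>x. \<bar>v x\<bar> \<le> L * \<bar>u x\<bar>" "\<And>x y. \<bar>v x - v y\<bar> \<le> L * \<bar>u x - u y\<bar>"
    and g: "\<And>n x. \<bar>g n x\<bar> \<le> L * \<bar>f n x\<bar>" "\<And>n x y. \<bar>g n x - g n y\<bar> \<le> L * \<bar>f n x - f n y\<bar>"
    and ae: "AE x in lebesgue. (\<lambda>n. g n x) \<longlonglongrightarrow> v x"
  shows "strongly_tendsto g v"
  unfolding strongly_tendsto_def
proof
  show "(\<lambda>n. mass (\<lambda>x. v x - g n x)) \<longlonglongrightarrow> 0"
    unfolding mass_def
  proof (rule Lp_convergence_dominated[OF p_pos(2) fin_Lp(1)[OF u(1)] fin_Lp(1)[OF u(2)] _ _ _ v(1) g(1) L])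
    show "(\<lambda>n. \<integral>x. \<bar>u x - f n x\<bar> powr p \<partial>M\<Omega>) \<longlonglongrightarrow> 0"
      using u(3) by (simp add: strongly_tendsto_def mass_def)
    show "AE x in M\<Omega>. (\<lambda>n. g n x) \<longlonglongrightarrow> v x"
      using ae by (rule AE_M\<Omega>I)
    show "v \<in> borel_measurable M\<Omega>" "\<And>n. g n \<in> borel_measurable M\<Omega>" "0 < p"
      by (measurable, rule p_pos)
  qed
  have *: "AE z in MK. (\<lambda>n. difference (g n) z) \<longlonglongrightarrow> difference v z"
    using AE_MKI[OF AE_pair_lebesgue_fst[OF ae]] AE_MKI[OF AE_pair_lebesgue_snd[OF ae]]
    by eventually_elim (auto simp: difference_def intro: tendsto_diff)
  show "(\<lambda>n. energy (\<lambda>x. v x - g n x)) \<longlonglongrightarrow> 0"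
    unfolding energy_def difference_diff
  proof (rule Lp_convergence_dominated[OF p_pos(2) fin_Lp(2)[OF u(1)] fin_Lp(2)[OF u(2)] _ _ _ _ _ L])
    show "(\<lambda>n. \<integral>z. \<bar>difference u z - difference (f n) z\<bar> powr p \<partial>MK) \<longlonglongrightarrow> 0"
      using u(3) by (simp add: strongly_tendsto_def energy_def difference_diff)
    show "difference v \<in> borel_measurable MK" "\<And>n. difference (g n) \<in> borel_measurable MK" "0 < p"
      by (measurable, rule p_pos)
    show "\<bar>difference v z\<bar> \<le> L * \<bar>difference u z\<bar>" for z
      unfolding difference_def by (rule v)
    show "\<bar>difference (g n) z\<bar> \<le> L * \<bar>difference (f n) z\<bar>" for n z
      unfolding difference_def by (rule g)
  qed (rule *)
qed

text \<open>F composed with \<phi> need not be smooth, but polynomials in \<phi> without constant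
  term are test functions. On the bounded range of \<phi> they approximate F with the common
  Lipschitz constant L + 1, so values and differences of all approximants are dominated by those of
  \<phi>.\<close>

lemma test_function_lipschitz_in_X0:
  assumes \<phi>: "\<phi> \<in> test_functions \<Omega>" "fin \<phi>"
    and F: "\<And>x y. \<bar>F x - F y\<bar> \<le> L * \<bar>x - y\<bar>" "F 0 = 0"
  shows "(\<lambda>x. F (\<phi> x)) \<in> XX"
proof -
  have L: "0 \<le> L" using F(1)[of 1 0] by simp
  obtain M where M: "0 < M" "\<And>x. \<bar>\<phi> x\<bar> \<le> M"
    using test_function_bounded[OF \<phi>(1)] by blast
  define Q where "Q k a n \<longleftrightarrow>
    (\<forall>t. \<bar>t\<bar> \<le> M \<longrightarrow> \<bar>(\<Sum>i\<le>n. a i * t ^ Suc i) - F t\<bar> \<le> 1 / real (Suc k)) \<and>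
    (\<forall>t r. \<bar>t\<bar> \<le> M \<longrightarrow> \<bar>r\<bar> \<le> M \<longrightarrow>
       \<bar>(\<Sum>i\<le>n. a i * t ^ Suc i) - (\<Sum>i\<le>n. a i * r ^ Suc i)\<bar> \<le> (L + 1) * \<bar>t - r\<bar>)"
    for k n :: nat and a :: "nat \<Rightarrow> real"
  have "\<exists>a n. Q k a n" for k
  proof -
    have "0 < 1 / real (Suc k)" by simp
    show ?thesis
    proof (rule lipschitz_polynomial_approximation[OF F M(1) \<open>0 < 1 / real (Suc k)\<close>])
      fix a n
      assume "\<And>t. \<bar>t\<bar> \<le> M \<Longrightarrow> \<bar>(\<Sum>i\<le>n. a i * t ^ Suc i) - F t\<bar> \<le> 1 / real (Suc k)"
        "\<And>t r. \<bar>t\<bar> \<le> M \<Longrightarrow> \<bar>r\<bar> \<le> M \<Longrightarrow>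
          \<bar>(\<Sum>i\<le>n. a i * t ^ Suc i) - (\<Sum>i\<le>n. a i * r ^ Suc i)\<bar> \<le> (L + 1) * \<bar>t - r\<bar>"
      then show "\<exists>a n. Q k a n"
        unfolding Q_def by (intro exI[of _ a] exI[of _ n] conjI allI impI)
    qed
  qed
  then obtain a n where Q: "\<And>k. Q k (a k) (n k)"
    by metis
  have P: "\<bar>t\<bar> \<le> M \<Longrightarrow> \<bar>(\<Sum>i\<le>n k. a k i * t ^ Suc i) - F t\<bar> \<le> 1 / real (Suc k)"
    "\<bar>t\<bar> \<le> M \<Longrightarrow> \<bar>r\<bar> \<le> M \<Longrightarrow>
       \<bar>(\<Sum>i\<le>n k. a k i * t ^ Suc i) - (\<Sum>i\<le>n k. a k i * r ^ Suc i)\<bar> \<le> (L + 1) * \<bar>t - r\<bar>" for k t r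
    using Q[of k] unfolding Q_def by blast+
  define f where "f k x = (\<Sum>i\<le>n k. a k i * \<phi> x ^ Suc i)" for k x
  note [measurable] = fin_measurable[OF \<phi>(2)] lipschitz_measurable(2)[OF F(1)]
  have [measurable]: "f k \<in> borel_measurable lebesgue" for k
    unfolding f_def[abs_def] by measurable
  have f1: "\<bar>f k x - f k y\<bar> \<le> (L + 1) * \<bar>\<phi> x - \<phi> y\<bar>" for k x y
    unfolding f_def by (intro P(2) M(2))
  have f0: "\<bar>f k x\<bar> \<le> (L + 1) * \<bar>\<phi> x\<bar>" for k x
    using P(2)[of "\<phi> x" 0 k] M by (simp add: f_def)
  have v1: "\<bar>F (\<phi> x) - F (\<phi> y)\<bar> \<le> (L + 1) * \<bar>\<phi> x - \<phi> y\<bar>" for x y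
    using F(1)[of "\<phi> x" "\<phi> y"] abs_ge_zero[of "\<phi> x - \<phi> y"] by (simp add: distrib_right)
  have v0: "\<bar>F (\<phi> x)\<bar> \<le> (L + 1) * \<bar>\<phi> x\<bar>" for x
    using F(1)[of "\<phi> x" 0] F(2) abs_ge_zero[of "\<phi> x"] by (simp add: distrib_right)
  have lim: "(\<lambda>k. f k x) \<longlonglongrightarrow> F (\<phi> x)" for x
  proof (rule Lim_null_comparison[THEN LIM_zero_cancel])
    show "\<forall>\<^sub>F k in sequentially. norm (f k x - F (\<phi> x)) \<le> 1 / real (Suc k)"
      using P(1) M(2) by (simp add: f_def del: of_nat_Suc)
    show "(\<lambda>k. 1 / real (Suc k)) \<longlonglongrightarrow> 0"
      using LIMSEQ_inverse_real_of_nat by (simp add: inverse_eq_divide)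
  qed
  show ?thesis
  proof (rule X0I)
    show "fin (\<lambda>x. F (\<phi> x))"
      by (rule fin_lipschitz(1)[OF \<phi>(2) _ _ v0 v1]) (measurable, use L in simp)
    show "AE x in lebesgue. x \<notin> \<Omega> \<longrightarrow> F (\<phi> x) = 0"
      using test_function_zero_outside[OF \<phi>(1)] F(2) by auto
    show "f k \<in> test_functions \<Omega>" for k
      unfolding f_def[abs_def] by (rule test_functions_real_polynomial[OF \<phi>(1)])
    show "fin (f k)" for k
      by (rule fin_lipschitz(1)[OF \<phi>(2) _ _ f0 f1]) (measurable, use L in simp)
    show "strongly_tendsto f (\<lambda>x. F (\<phi> x))"
    \<comment> \<open>The dominating sequence is constant, equal to \<phi>.\<close>
    proof (rule strongly_tendsto_dominated[OF \<phi>(2) \<phi>(2) _ _ _ _ v0 v1 f0 f1])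
      show "strongly_tendsto (\<lambda>n. \<phi>) \<phi>"
        using p_pos by (simp add: strongly_tendsto_def mass_def energy_def difference_def)
      show "0 \<le> L + 1" using L by simp
      show "AE x in lebesgue. (\<lambda>n. f n x) \<longlonglongrightarrow> F (\<phi> x)"
        using lim by (rule AE_I2)
    qed measurable
  qed
qed

lemma X0_approximable_AE:
  assumes "u \<in> XX"
  obtains f where "\<And>n. f n \<in> test_functions \<Omega>" "\<And>n. fin (f n)" "strongly_tendsto f u"
    "AE x in lebesgue. (\<lambda>n. f n x) \<longlonglongrightarrow> u x"
proof -
  obtain f where f: "\<And>k. f k \<in> test_functions \<Omega>" "\<And>k. fin (f k)" "strongly_tendsto f u"
    using X0_approximable[OF assms(1)] by blast
  have "(\<lambda>n. \<integral>x. \<bar>u x - f n x\<bar> powr p \<partial>M\<Omega>) \<longlonglongrightarrow> 0"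
    using f(3) unfolding strongly_tendsto_def mass_def by blast
  from Lp_convergence_AE_subseq[OF p_pos(1) X0_Lp(1)[OF assms] fin_Lp(1)[OF f(2)] this]
  obtain r :: "nat \<Rightarrow> nat" where r: "strict_mono r" "AE x in M\<Omega>. (\<lambda>n. f (r n) x) \<longlonglongrightarrow> u x"
    by blast
  have "AE x in lebesgue. (\<lambda>n. f (r n) x) \<longlonglongrightarrow> u x"
    using r(2)[unfolded AE_M\<Omega>_iff] X0_zero_outside[OF assms]
  proof eventually_elim
    case (elim x)
    then show ?case
      using test_function_zero_outside[OF f(1)] by (cases "x \<in> \<Omega>") auto
  qed
  moreover have "strongly_tendsto (\<lambda>n. f (r n)) u"
    using f(3) LIMSEQ_subseq_LIMSEQ[OF _ r(1)] unfolding strongly_tendsto_def by (auto simp: o_def)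
  ultimately show ?thesis using that[of "\<lambda>n. f (r n)"] f by blast
qed

text \<open>Composition with F need not be Lipschitz for the energy, so strong convergence of the
  approximants does not pass through F by a direct estimate. A subsequence converging almost
  everywhere, with domination by the approximants, closes this gap.\<close>

lemma X0_lipschitz:
  assumes u: "u \<in> XX" and F: "\<And>x y. \<bar>F x - F y\<bar> \<le> L * \<bar>x - y\<bar>" "F 0 = 0"
  shows "(\<lambda>x. F (u x)) \<in> XX"
proof -
  have L: "0 \<le> L" using F(1)[of 1 0] by simp
  obtain f where f: "\<And>k. f k \<in> test_functions \<Omega>" "\<And>k. fin (f k)" "strongly_tendsto f u"
    "AE x in lebesgue. (\<lambda>n. f n x) \<longlonglongrightarrow> u x"
    using X0_approximable_AE[OF u] by blast
  note uf = X0_fin[OF u]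
  note [measurable] = fin_measurable[OF f(2)] fin_measurable[OF uf] lipschitz_measurable(2)[OF F(1)]
  have F0: "\<bar>F t\<bar> \<le> L * \<bar>t\<bar>" for t using F(1)[of t 0] F(2) by simp
  have "AE x in lebesgue. (\<lambda>n. F (f n x)) \<longlonglongrightarrow> F (u x)"
    using f(4)
  proof eventually_elim
    case (elim x)
    show ?case
      by (rule continuous_on_tendsto_compose[OF lipschitz_measurable(1)[OF F(1)] elim]) auto
  qed
  then have "strongly_tendsto (\<lambda>n x. F (f n x)) (\<lambda>x. F (u x))"
    by (intro strongly_tendsto_dominated[OF uf f(2,3) _ _ L F0 F(1) F0 F(1)]) measurable
  moreover have "fin (\<lambda>x. F (u x))"
    by (intro fin_lipschitz(1)[OF uf _ L F0 F(1)]) measurable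
  moreover have "AE x in lebesgue. x \<notin> \<Omega> \<longrightarrow> F (u x) = 0"
    using X0_zero_outside[OF u] by eventually_elim (auto simp: F(2))
  ultimately show ?thesis
    by (intro X0_closed[OF _ _ test_function_lipschitz_in_X0[OF f(1,2) F]])
qed

lemma X0_abs: "u \<in> XX \<Longrightarrow> (\<lambda>x. \<bar>u x\<bar>) \<in> XX"
  by (rule X0_lipschitz[of u abs 1]) auto

lemma X0_max: 
  assumes "u \<in> XX" "v \<in> XX" shows "(\<lambda>x. max (u x) (v x)) \<in> XX"
proof -
  have "(\<lambda>x. (1/2) * ((u x + v x) + \<bar>u x - v x\<bar>)) \<in> XX"
    using assms by (intro X0_cmult X0_add X0_abs X0_diff)
  moreover have "(\<lambda>x. (1/2) * ((u x + v x) + \<bar>u x - v x\<bar>)) = (\<lambda>x. max (u x) (v x))"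
    by (auto simp: max_def)
  ultimately show ?thesis by simp
qed

lemma X0_min: 
  assumes "u \<in> XX" "v \<in> XX" shows "(\<lambda>x. min (u x) (v x)) \<in> XX"
proof -
  have "(\<lambda>x. (u x + v x) - max (u x) (v x)) \<in> XX"
    using assms by (intro X0_add X0_diff X0_max)
  moreover have "(\<lambda>x. (u x + v x) - max (u x) (v x)) = (\<lambda>x. min (u x) (v x))"
    by (auto simp: max_def min_def)
  ultimately show ?thesis by simp
qed

text \<open>Polarisation: 4 u v is the difference of the squares of u + v and u - v. Both have
  absolute value at most 2 M, and the square truncated there is Lipschitz with constant 4 M.\<close>

lemma X0_mult:
  assumes "u \<in> XX" "v \<in> XX" and M: "\<And>x. \<bar>u x\<bar> \<le> M" "\<And>x. \<bar>v x\<bar> \<le> M"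
  shows "(\<lambda>x. u x * v x) \<in> XX"
proof -
  have M0: "0 \<le> M" using M(1)[of 0] by linarith
  define q where "q t = (max (- (2 * M)) (min (2 * M) t))\<^sup>2" for t
  have q: "\<bar>q t - q r\<bar> \<le> (4 * M) * \<bar>t - r\<bar>" for t r
  proof -
    define t' r' where "t' = max (- (2 * M)) (min (2 * M) t)" and "r' = max (- (2 * M)) (min (2 * M) r)"
    have "\<bar>q t - q r\<bar> = \<bar>t' + r'\<bar> * \<bar>t' - r'\<bar>"
      by (simp add: q_def t'_def r'_def square_diff_square_factored power2_eq_square flip: abs_mult)
    also have "\<dots> \<le> (4 * M) * \<bar>t - r\<bar>"
      using M0 by (intro mult_mono) (auto simp: t'_def r'_def)
    finally show ?thesis .
  qed
  have q0: "q 0 = 0" using M0 by (simp add: q_def)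
  have "(\<lambda>x. (1/4) * (q (u x + v x) - q (u x - v x))) \<in> XX"
    using assms(1,2) X0_lipschitz[OF _ q q0] by (intro X0_cmult X0_diff) (auto intro: X0_add X0_diff)
  moreover have "(1/4) * (q (u x + v x) - q (u x - v x)) = u x * v x" for x
  proof -
    have "max (- (2 * M)) (min (2 * M) t) = t" if "\<bar>t\<bar> \<le> 2 * M" for t
      using that by auto
    moreover have "\<bar>u x + v x\<bar> \<le> 2 * M" "\<bar>u x - v x\<bar> \<le> 2 * M"
      using M[of x] by linarith+
    ultimately have "q (u x + v x) = (u x + v x)\<^sup>2" "q (u x - v x) = (u x - v x)\<^sup>2"
      by (simp_all add: q_def)
    then show ?thesis by (simp add: power2_eq_square algebra_simps)
  qed
  ultimately show ?thesis by simp
qed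

section \<open>Eigenfunctions and minimisers\<close>

text \<open>A null set for \<open>MK\<close> can be charged by the product measure only where the
  density vanishes. The density is positive off the diagonal, which explains the side condition in
  the conclusion.\<close>

lemma AE_MKD: "AE z in MK. P z \<Longrightarrow> AE z in lebesgue \<Otimes>\<^sub>M lebesgue. fst z \<noteq> snd z \<longrightarrow> P z"
  unfolding MK_def by (subst (asm) AE_density, measurable) (auto elim!: eventually_mono simp: K_pos)

section \<open>The two sides of the weak equation as forms\<close>

definition energy_form :: "(real ^ 'n \<Rightarrow> real) \<Rightarrow> (real ^ 'n \<Rightarrow> real) \<Rightarrow> real" where
  "energy_form u w = (\<integral>z. signed_power p (difference u z) * difference w z \<partial>MK)"

definition mass_form :: "(real ^ 'n \<Rightarrow> real) \<Rightarrow> (real ^ 'n \<Rightarrow> real) \<Rightarrow> real" where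
  "mass_form u w = (\<integral>x. signed_power p (u x) * w x \<partial>M\<Omega>)"

lemma energy_form_self: "energy_form u u = energy u"
  using p_pos by (simp add: energy_form_def energy_def signed_power_mult_self)

lemma mass_form_self: "mass_form u u = mass u"
  using p_pos by (simp add: mass_form_def mass_def signed_power_mult_self)

text \<open>Both forms are continuous in the second argument under strong convergence, so the
  equation extends from test functions of finite energy to the whole space.\<close>

lemma weak_solution_X0:
  assumes u: "weak_solution G s p \<Omega> \<nu> u" and w: "w \<in> XX"
  shows "energy_form u w = \<nu> * mass_form u w"
proof -
  have uX: "u \<in> XX" using u by (simp add: weak_solution_def)
  note [measurable] = X0_measurable[OF uX]
  obtain f where f: "\<And>n. f n \<in> test_functions \<Omega>" "\<And>n. fin (f n)" "strongly_tendsto f w"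
    using X0_approximable[OF w] by blast
  note [measurable] = fin_measurable[OF f(2)]
  have eq: "energy_form u (f n) = \<nu> * mass_form u (f n)" for n
  proof -
    have "energy_form u (f n) = frac_p_sub_laplacian G s p u (f n)"
      unfolding energy_form_def frac_p_sub_laplacian_def
      by (subst integral_MK, measurable) (simp add: difference_def case_prod_beta')
    also have "\<dots> = \<nu> * (LINT x:\<Omega>|lebesgue. signed_power p (u x) * f n x)"
      using u f(1) by (simp add: weak_solution_def)
    also have "(LINT x:\<Omega>|lebesgue. signed_power p (u x) * f n x) = mass_form u (f n)"
      unfolding mass_form_def by (subst integral_M\<Omega>) measurable
    finally show ?thesis .
  qed
  have "(\<lambda>n. energy_form u (f n)) \<longlonglongrightarrow> energy_form u w"
    unfolding energy_form_def
    using f(3) by (intro signed_power_pairing_tendsto[OF p_gt_1 X0_Lp(2)[OF uX]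
        X0_Lp(2)[OF w] fin_Lp(2)[OF f(2)]])
      (auto simp: strongly_tendsto_def energy_def difference_diff)
  moreover have "(\<lambda>n. \<nu> * mass_form u (f n)) \<longlonglongrightarrow> \<nu> * mass_form u w"
    unfolding mass_form_def
    using f(3) by (intro tendsto_mult_left signed_power_pairing_tendsto[OF p_gt_1 X0_Lp(1)[OF uX]
        X0_Lp(1)[OF w] fin_Lp(1)[OF f(2)]])
      (auto simp: strongly_tendsto_def mass_def)
  ultimately show ?thesis
    unfolding eq by (rule LIMSEQ_unique)
qed

section \<open>The Rayleigh quotient and the functions that attain its infimum\<close>

abbreviation \<Lambda> :: real where "\<Lambda> \<equiv> first_eigenvalue G s p \<Omega>"

lemma Rayleigh_set_eq:
  "{gagliardo_seminorm G s p u powr p | u. u \<in> XX \<and> Lp_norm p \<Omega> u = 1} = {energy u | u. u \<in> XX \<and> mass u = 1}"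
proof -
  have "gagliardo_seminorm G s p u powr p = energy u" "Lp_norm p \<Omega> u = 1 \<longleftrightarrow> mass u = 1" if "u \<in> XX" for u
  proof -
    note [measurable] = X0_measurable[OF that]
    show "gagliardo_seminorm G s p u powr p = energy u"
      by (simp add: gagliardo_seminorm_eq[OF X0_measurable[OF that]] powr_inverse_p energy_nonneg)
    have "mass u powr (1/p) = 1 \<longleftrightarrow> mass u = 1"
      using powr_inverse_p[OF mass_nonneg[of u]] by force
    then show "Lp_norm p \<Omega> u = 1 \<longleftrightarrow> mass u = 1"
      by (simp add: Lp_norm_eq[OF X0_measurable[OF that]])
  qed
  then show ?thesis by (intro Collect_cong) metis
qed

lemma normalized_in_X0:
  assumes "w \<in> XX" "mass w \<noteq> 0"
  obtains v where "v \<in> XX" "mass v = 1" "energy v = energy w / mass w"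
proof -
  have m: "0 < mass w" using assms(2) mass_nonneg[of w] by linarith
  define c where "c = (1 / mass w) powr (1 / p)"
  have "\<bar>c\<bar> powr p = 1 / mass w"
    using m powr_inverse_p[of "1 / mass w"] by (simp add: c_def)
  then show ?thesis
    using that[OF X0_cmult[OF assms(1), of c]] m by (simp add: mass_cmult energy_cmult)
qed

text \<open>Homogeneity reduces to mass 1. Written as a product, the bound also holds for mass 0, so
  competitors such as maxima and minima need no nontriviality check.\<close>

lemma first_eigenvalue_le:
  assumes "w \<in> XX" shows "\<Lambda> * mass w \<le> energy w"
proof (cases "mass w = 0")
  case False
  then obtain v where v: "v \<in> XX" "mass v = 1" "energy v = energy w / mass w"
    using normalized_in_X0[OF assms] by blast
  have "bdd_below {energy u | u. u \<in> XX \<and> mass u = 1}"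
    by (rule bdd_belowI[of _ 0]) (auto simp: energy_nonneg)
  then have "\<Lambda> \<le> energy v"
    unfolding first_eigenvalue_def Rayleigh_set_eq using v(1,2) by (intro cInf_lower) auto
  then show ?thesis using v(3) False mass_nonneg[of w] by (simp add: field_simps)
qed (simp add: energy_nonneg)

text \<open>The function w only witnesses that the infimum is taken over a nonempty set.\<close>

lemma first_eigenvalue_ge:
  assumes "w \<in> XX" "mass w \<noteq> 0" and le: "\<And>v. v \<in> XX \<Longrightarrow> \<nu> * mass v \<le> energy v"
  shows "\<nu> \<le> \<Lambda>"
proof -
  obtain v where v: "v \<in> XX" "mass v = 1"
    using normalized_in_X0[OF assms(1,2)] by blast
  then show ?thesis
    unfolding first_eigenvalue_def Rayleigh_set_eq using le by (intro cInf_greatest) force+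
qed

lemma mass_eq_0_iff:
  assumes "u \<in> XX" shows "mass u = 0 \<longleftrightarrow> (AE x in lebesgue. u x = 0)"
proof -
  have "mass u = 0 \<longleftrightarrow> (AE x in M\<Omega>. \<bar>u x\<bar> powr p = 0)"
    unfolding mass_def using X0_Lp(1)[OF assms]
    by (intro integral_nonneg_eq_0_iff_AE) (auto simp: in_Lp_def)
  also have "\<dots> \<longleftrightarrow> (AE x in lebesgue. x \<in> \<Omega> \<longrightarrow> u x = 0)"
    by (simp add: AE_M\<Omega>_iff)
  also have "\<dots> \<longleftrightarrow> (AE x in lebesgue. u x = 0)"
  proof
    assume "AE x in lebesgue. x \<in> \<Omega> \<longrightarrow> u x = 0"
    with X0_zero_outside[OF assms] show "AE x in lebesgue. u x = 0"
      by eventually_elim auto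
  qed (auto elim: eventually_mono)
  finally show ?thesis .
qed

text \<open>Testing the equation with u itself gives the energy identity; the bounds on \<nu> follow
  by dividing by the positive mass.\<close>

lemma eigenfunctionD:
  assumes "eigenfunction G s p \<Omega> \<nu> u"
  shows "weak_solution G s p \<Omega> \<nu> u" "u \<in> XX" "0 < mass u" "energy u = \<nu> * mass u" "\<Lambda> \<le> \<nu>" "0 \<le> \<nu>"
proof -
  show w: "weak_solution G s p \<Omega> \<nu> u" and X: "u \<in> XX"
    using assms by (auto simp: eigenfunction_def weak_solution_def)
  show m: "0 < mass u"
    using assms mass_eq_0_iff[OF X] mass_nonneg[of u] by (auto simp: eigenfunction_def order_less_le)
  show e: "energy u = \<nu> * mass u"
    using weak_solution_X0[OF w X] by (simp add: energy_form_self mass_form_self)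
  show "\<Lambda> \<le> \<nu>" using first_eigenvalue_le[OF X] m e by simp
  show "0 \<le> \<nu>" using energy_nonneg[of u] m e by (simp add: zero_le_mult_iff)
qed

text \<open>The operator and the right-hand side are both odd in u. Statements about nonpositive
  functions or positive parts thus reduce to their mirror images.\<close>

lemma eigenfunction_minus:
  assumes "eigenfunction G s p \<Omega> \<nu> u" shows "eigenfunction G s p \<Omega> \<nu> (\<lambda>x. - u x)"
proof -
  have "frac_p_sub_laplacian G s p (\<lambda>x. - u x) \<phi> = - frac_p_sub_laplacian G s p u \<phi>" for \<phi>
  proof -
    have *: "signed_power p (- u x - - u y) = - signed_power p (u x - u y)" for x y
      using signed_power_minus[of p "u x - u y"] by (simp add: algebra_simps)
    show ?thesis
      unfolding frac_p_sub_laplacian_def * mult_minus_left minus_divide_left[symmetric]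
      by (simp add: case_prod_beta')
  qed
  then show ?thesis
    using assms X0_cmult[of u "-1"]
    unfolding eigenfunction_def weak_solution_def signed_power_minus set_lebesgue_integral_def
    by simp
qed

text \<open>At almost every point the masses of maximum and minimum redistribute those of u and w
  without loss, so the energy inequality cannot be strict. Strict submodularity then rules out
  almost all pairs x, y with w x < u x and u y < w y; since these form a rectangle, one of its two
  sides is null.\<close>

lemma minimizers_comparable:
  assumes u: "u \<in> XX" "energy u = \<Lambda> * mass u" and w: "w \<in> XX" "energy w = \<Lambda> * mass w"
  shows "(AE x in lebesgue. u x \<le> w x) \<or> (AE x in lebesgue. w x \<le> u x)"
proof -
  define M where "M x = max (u x) (w x)" for x
  define m where "m x = min (u x) (w x)" for x
  have M: "M \<in> XX" and m: "m \<in> XX"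
    unfolding M_def[abs_def] m_def[abs_def] using u w X0_max X0_min by auto
  note [measurable] = X0_measurable[OF u(1)] X0_measurable[OF w(1)]
  note i1 = X0_Lp(1)[OF u(1)] X0_Lp(1)[OF w(1)] X0_Lp(1)[OF M] X0_Lp(1)[OF m]
  note i2 = X0_Lp(2)[OF u(1)] X0_Lp(2)[OF w(1)] X0_Lp(2)[OF M] X0_Lp(2)[OF m]
  have "mass M + mass m = (\<integral>x. \<bar>M x\<bar> powr p + \<bar>m x\<bar> powr p \<partial>M\<Omega>)"
    unfolding mass_def using i1 by (simp add: in_Lp_def)
  also have "\<dots> = (\<integral>x. \<bar>u x\<bar> powr p + \<bar>w x\<bar> powr p \<partial>M\<Omega>)"
    by (intro Bochner_Integration.integral_cong) (auto simp: M_def m_def max_def min_def)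
  also have "\<dots> = mass u + mass w"
    unfolding mass_def using i1 by (simp add: in_Lp_def)
  finally have mass: "mass M + mass m = mass u + mass w" .
  \<comment> \<open>The pointwise deficit in submodularity. It is nonnegative, and its integral is
    at most 0 because both maximum and minimum obey the Rayleigh bound.\<close>
  define D where "D z = (\<bar>difference u z\<bar> powr p + \<bar>difference w z\<bar> powr p) -
    (\<bar>difference M z\<bar> powr p + \<bar>difference m z\<bar> powr p)" for z
  have Di: "integrable MK D"
    unfolding D_def using i2 by (auto simp: in_Lp_def)
  have D0: "0 \<le> D z" for z
    unfolding D_def difference_def M_def m_def using abs_powr_max_min[OF p_gt_1] by simp
  have "integral\<^sup>L MK D = (energy u + energy w) - (energy M + energy m)"
    unfolding D_def energy_def using i2 by (simp add: in_Lp_def)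
  also have "\<dots> \<le> \<Lambda> * (mass u + mass w) - \<Lambda> * (mass M + mass m)"
    using first_eigenvalue_le[OF M] first_eigenvalue_le[OF m] u(2) w(2) by (simp add: distrib_left)
  finally have "integral\<^sup>L MK D \<le> 0" by (simp add: mass)
  moreover have "0 \<le> integral\<^sup>L MK D" using D0 by simp
  ultimately have "integral\<^sup>L MK D = 0" by simp
  then have "AE z in MK. D z = 0"
    using integral_nonneg_eq_0_iff_AE[OF Di] D0 by auto
  then have "AE z in lebesgue \<Otimes>\<^sub>M lebesgue. fst z \<noteq> snd z \<longrightarrow> D z = 0"
    by (rule AE_MKD)
  then have "AE z in lebesgue \<Otimes>\<^sub>M lebesgue. \<not> (w (fst z) < u (fst z) \<and> u (snd z) < w (snd z))"
  proof eventually_elim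
    case (elim z)
    show ?case
    proof
      assume a: "w (fst z) < u (fst z) \<and> u (snd z) < w (snd z)"
      then have "fst z \<noteq> snd z" by auto
      then have "D z = 0" using elim by blast
      then show False
        using abs_powr_max_min_strict[OF p_gt_1, of "w (fst z)" "u (fst z)" "u (snd z)" "w (snd z)"] a
        by (simp add: D_def difference_def M_def m_def)
    qed
  qed
  moreover have "{x \<in> space lebesgue. w x < u x} \<in> sets lebesgue" "{x \<in> space lebesgue. u x < w x} \<in> sets lebesgue"
    by measurable
  ultimately have "(AE x in lebesgue. \<not> w x < u x) \<or> (AE x in lebesgue. \<not> u x < w x)"
    by (intro AE_pair_lebesgue_not_both) auto
  then show ?thesis by (simp add: not_less)
qed

lemma zero_in_X0: "u \<in> XX \<Longrightarrow> (\<lambda>x. 0) \<in> XX"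
  using X0_cmult[of u 0] by simp

lemma minimizer_constant_sign:
  assumes "u \<in> XX" "energy u = \<Lambda> * mass u"
  shows "(AE x in lebesgue. u x \<le> 0) \<or> (AE x in lebesgue. 0 \<le> u x)"
  using minimizers_comparable[OF assms zero_in_X0[OF assms(1)]] p_pos
  by (simp add: energy_def mass_def difference_def)

text \<open>A cut argument. Every multiple of \<phi> is a minimiser, hence comparable with \<psi>:
  if t \<phi> is not below \<psi>, it is above it. The set of t with t \<phi> \<le> \<psi> is a
  lower ray, and at its supremum c both inequalities hold in the limit.\<close>

lemma minimizers_proportional:
  assumes \<phi>: "\<phi> \<in> XX" "energy \<phi> = \<Lambda> * mass \<phi>" "AE x in lebesgue. 0 \<le> \<phi> x" "\<not> (AE x in lebesgue. \<phi> x = 0)"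
    and \<psi>: "\<psi> \<in> XX" "energy \<psi> = \<Lambda> * mass \<psi>"
    and pos: "AE x in lebesgue. x \<in> \<Omega> \<longrightarrow> 0 < \<phi> x"
  shows "\<exists>c. AE x in lebesgue. \<psi> x = c * \<phi> x"
proof -
  define T where "T = {t. AE x in lebesgue. t * \<phi> x \<le> \<psi> x}"
  have cmp: "t \<in> T \<or> (AE x in lebesgue. \<psi> x \<le> t * \<phi> x)" for t
  proof -
    have "energy (\<lambda>x. t * \<phi> x) = \<Lambda> * mass (\<lambda>x. t * \<phi> x)"
      using \<phi>(2) by (simp add: energy_cmult mass_cmult)
    then show ?thesis
      using minimizers_comparable[OF X0_cmult[OF \<phi>(1)] _ \<psi>] by (simp add: T_def)
  qed
  \<comment> \<open>The multiples of a nontrivial nonnegative function have no common upper bound.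
    This yields both that the cut is nonempty, applied to - \<psi>, and that it is bounded above,
    applied to \<psi>.\<close>
  have no_bound: False if "AE x in lebesgue. \<forall>n::nat. real n * \<phi> x \<le> f x" for f
  proof -
    have "AE x in lebesgue. \<phi> x = 0"
      using that \<phi>(3)
    proof eventually_elim
      case (elim x)
      show ?case
      proof (rule ccontr)
        assume "\<phi> x \<noteq> 0"
        then obtain n where "f x < real n * \<phi> x"
          using elim(2) reals_Archimedean3[of "\<phi> x"] by auto
        then show False using elim(1) by (metis not_less)
      qed
    qed
    then show False using \<phi>(4) by simp
  qed
  have mono: "r \<in> T" if "t \<in> T" "r \<le> t" for r t
  proof -
    have "AE x in lebesgue. t * \<phi> x \<le> \<psi> x" using that(1) by (simp add: T_def)
    then have "AE x in lebesgue. r * \<phi> x \<le> \<psi> x"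
      using \<phi>(3)
    proof eventually_elim
      case (elim x)
      then show ?case using mult_right_mono[OF that(2), of "\<phi> x"] by linarith
    qed
    then show ?thesis by (simp add: T_def)
  qed
  have "T \<noteq> {}"
  proof
    assume "T = {}"
    then have "AE x in lebesgue. \<psi> x \<le> - real n * \<phi> x" for n
      using cmp[of "- real n"] by auto
    then have "AE x in lebesgue. \<forall>n::nat. \<psi> x \<le> - real n * \<phi> x"
      by (simp add: AE_all_countable)
    then have "AE x in lebesgue. \<forall>n::nat. real n * \<phi> x \<le> - \<psi> x"
      by eventually_elim (metis le_minus_iff mult_minus_left)
    then show False by (rule no_bound)
  qed
  have "bdd_above T"
  proof (rule ccontr)
    assume "\<not> bdd_above T"
    then have "real n \<in> T" for n
      using mono unfolding bdd_above_def by (metis linear)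
    then have "AE x in lebesgue. \<forall>n::nat. real n * \<phi> x \<le> \<psi> x"
      by (simp add: AE_all_countable T_def)
    then show False by (rule no_bound)
  qed
  define c where "c = Sup T"
  have "c - 1 / real (Suc n) \<in> T" for n
  proof -
    have "c - 1 / real (Suc n) < Sup T" by (simp add: c_def)
    then obtain t where "t \<in> T" "c - 1 / real (Suc n) < t"
      using less_cSup_iff[OF \<open>T \<noteq> {}\<close> \<open>bdd_above T\<close>] by blast
    then show ?thesis using mono by (meson less_imp_le)
  qed
  then have 1: "AE x in lebesgue. \<forall>n. (c - 1 / real (Suc n)) * \<phi> x \<le> \<psi> x"
    by (simp add: AE_all_countable T_def)
  have "c + 1 / real (Suc n) \<notin> T" for n
  proof
    assume "c + 1 / real (Suc n) \<in> T"
    from cSup_upper[OF this \<open>bdd_above T\<close>] show False by (simp add: c_def)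
  qed
  then have "AE x in lebesgue. \<psi> x \<le> (c + 1 / real (Suc n)) * \<phi> x" for n
    using cmp by blast
  then have 2: "AE x in lebesgue. \<forall>n. \<psi> x \<le> (c + 1 / real (Suc n)) * \<phi> x"
    unfolding AE_all_countable by blast
  have lim: "(\<lambda>n. 1 / real (Suc n)) \<longlonglongrightarrow> 0"
    using LIMSEQ_inverse_real_of_nat by (simp add: inverse_eq_divide)
  from 1 2 have "AE x in lebesgue. \<psi> x = c * \<phi> x"
  proof eventually_elim
    case (elim x)
    have "(\<lambda>n. (c - 1 / real (Suc n)) * \<phi> x) \<longlonglongrightarrow> (c - 0) * \<phi> x"
      by (intro tendsto_intros lim)
    then have a: "c * \<phi> x \<le> \<psi> x" using elim(1) by (intro LIMSEQ_le_const2) auto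
    have "(\<lambda>n. (c + 1 / real (Suc n)) * \<phi> x) \<longlonglongrightarrow> (c + 0) * \<phi> x"
      by (intro tendsto_intros lim)
    then have "\<psi> x \<le> c * \<phi> x" using elim(2) by (intro LIMSEQ_le_const) auto
    then show ?case using a by simp
  qed
  then show ?thesis by blast
qed

text \<open>In the limit the test functions keep g on the zero set of u and vanish where u is
  positive. There the pairing is negative at every pair joining {u > 0} with {u = 0, g > 0}, while
  the equation makes the integrals before the limit nonnegative. So almost no such pairs exist, and
  as u is nontrivial the second set is null.\<close>

lemma strong_minimum_principle:
  assumes u: "eigenfunction G s p \<Omega> \<nu> u" and u0: "AE x in lebesgue. 0 \<le> u x"
    and g: "g \<in> XX" "\<And>x. 0 \<le> g x"
  shows "AE x in lebesgue. \<not> (u x = 0 \<and> 0 < g x)"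
proof -
  note uX = eigenfunctionD(2)[OF u]
  note [measurable] = X0_measurable[OF uX] X0_measurable[OF g(1)]
  define w where "w n x = max (g x - real n * u x) 0" for n x
  have wX: "w n \<in> XX" for n
    unfolding w_def[abs_def] using uX g by (intro X0_max X0_diff X0_cmult zero_in_X0)
  have [measurable]: "w n \<in> borel_measurable lebesgue" for n
    using X0_measurable[OF wX] .
  define T where "T n z = signed_power p (difference u z) * difference (w n) z" for n z
  define H where "H z = \<bar>signed_power p (difference u z) * difference g z\<bar>" for z
  \<comment> \<open>The pointwise limit of T n wherever u is nonnegative at both points.\<close>
  define T' where "T' z = signed_power p (difference u z) *
    ((if u (fst z) = 0 then g (fst z) else 0) - (if u (snd z) = 0 then g (snd z) else 0))" for z
  have [measurable]: "T n \<in> borel_measurable MK" "H \<in> borel_measurable MK" "T' \<in> borel_measurable MK" for n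
    unfolding T_def[abs_def] H_def[abs_def] T'_def[abs_def] by measurable
  have Hi: "integrable MK H"
    unfolding H_def by (intro integrable_abs integrable_signed_power_mult[OF p_gt_1]
        X0_Lp(2)[OF uX] X0_Lp(2)[OF g(1)])
  have Ti: "integrable MK (T n)" for n
    unfolding T_def by (intro integrable_signed_power_mult[OF p_gt_1]
        X0_Lp(2)[OF uX] X0_Lp(2)[OF wX])
  \<comment> \<open>Toward the point where u is larger, - n u decreases, so the increment of the
    truncated function in that direction is at most |g x - g y|, for every n. Only this one-sided
    bound is uniform in n.\<close>
  have TH: "T n z \<le> H z" for n z
  proof -
    obtain x y where z: "z = (x, y)" by force
    consider "u y < u x" | "u x < u y" | "u x = u y" by linarith
    then show ?thesis
    proof cases
      case 1
      then have "real n * u y \<le> real n * u x" by (simp add: mult_left_mono)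
      then have "w n x - w n y \<le> \<bar>g x - g y\<bar>" unfolding w_def by linarith
      moreover have "0 \<le> signed_power p (u x - u y)" using 1 by (simp add: signed_power_def)
      ultimately show ?thesis
        by (simp add: T_def H_def difference_def z abs_mult mult_left_mono)
    next
      case 2
      then have "real n * u x \<le> real n * u y" by (simp add: mult_left_mono)
      then have "w n y - w n x \<le> \<bar>g x - g y\<bar>" unfolding w_def by linarith
      moreover have s: "0 \<le> signed_power p (u y - u x)" using 2 by (simp add: signed_power_def)
      ultimately have "signed_power p (u y - u x) * (w n y - w n x) \<le> signed_power p (u y - u x) * \<bar>g x - g y\<bar>"
        by (intro mult_left_mono)
      moreover have "signed_power p (u x - u y) = - signed_power p (u y - u x)"
        using signed_power_minus[of p "u y - u x"] by simp
      moreover have "- signed_power p (u y - u x) * (w n x - w n y) = signed_power p (u y - u x) * (w n y - w n x)"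
        by (simp add: algebra_simps)
      ultimately show ?thesis
        using s by (simp only: T_def H_def difference_def z fst_conv snd_conv abs_mult abs_minus_cancel abs_of_nonneg)
    next
      case 3
      then show ?thesis by (simp add: T_def H_def difference_def z signed_power_def)
    qed
  qed
  have T_nonneg: "0 \<le> integral\<^sup>L MK (T n)" for n
  proof -
    have "integral\<^sup>L MK (T n) = \<nu> * mass_form u (w n)"
      using weak_solution_X0[OF eigenfunctionD(1)[OF u] wX] by (simp add: energy_form_def T_def[abs_def])
    moreover have "0 \<le> mass_form u (w n)"
      unfolding mass_form_def using AE_M\<Omega>I[OF u0]
      by (intro integral_nonneg_AE) (auto elim!: eventually_mono simp: signed_power_def w_def)
    ultimately show ?thesis using eigenfunctionD(6)[OF u] by simp
  qed
  have u0': "AE z in MK. 0 \<le> u (fst z) \<and> 0 \<le> u (snd z)"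
    using AE_MKI[OF AE_pair_lebesgue_fst[OF u0]] AE_MKI[OF AE_pair_lebesgue_snd[OF u0]]
    by eventually_elim auto
  have lim_w: "(\<lambda>n. w n x) \<longlonglongrightarrow> (if u x = 0 then g x else 0)" if "0 \<le> u x" for x
  proof (cases "u x = 0")
    case True
    then show ?thesis using g(2) by (simp add: w_def)
  next
    case False
    then have "0 < u x" using that by simp
    then obtain N where N: "g x < real N * u x"
      using reals_Archimedean3[of "u x"] by blast
    have "w n x = 0" if "N \<le> n" for n
    proof -
      have "real N * u x \<le> real n * u x" using that \<open>0 \<le> u x\<close> by (intro mult_right_mono) auto
      then show ?thesis using N by (simp add: w_def)
    qed
    then have "\<forall>\<^sub>F n in sequentially. w n x = 0" by (auto simp: eventually_sequentially)
    then show ?thesis using False by (simp add: tendsto_eventually)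
  qed
  have T'0: "AE z in MK. T' z \<le> 0"
    using u0'
  proof eventually_elim
    case (elim z)
    then show ?case
      using g(2)[of "fst z"] g(2)[of "snd z"]
      by (auto simp: T'_def difference_def signed_power_def mult_nonneg_nonneg mult_nonpos_nonneg mult_nonneg_nonpos)
  qed
  have lim_T: "AE z in MK. (\<lambda>n. T n z) \<longlonglongrightarrow> T' z"
    using u0'
  proof eventually_elim
    case (elim z)
    then show ?case
      unfolding T_def T'_def difference_def[of "w _"] by (intro tendsto_intros lim_w) auto
  qed
  have "(\<integral>\<^sup>+z. ennreal (H z - T' z) \<partial>MK) = (\<integral>\<^sup>+z. liminf (\<lambda>n. ennreal (H z - T n z)) \<partial>MK)"
    using lim_T
    by (intro nn_integral_cong_AE) (auto elim!: eventually_mono intro!: lim_imp_Liminf[symmetric] tendsto_intros)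
  also have "\<dots> \<le> liminf (\<lambda>n. \<integral>\<^sup>+z. ennreal (H z - T n z) \<partial>MK)"
    by (intro nn_integral_liminf) measurable
  also have "\<dots> \<le> liminf (\<lambda>n::nat. ennreal (integral\<^sup>L MK H))"
  proof (intro Liminf_mono always_eventually allI)
    fix n
    have "(\<integral>\<^sup>+z. ennreal (H z - T n z) \<partial>MK) = ennreal (\<integral>z. H z - T n z \<partial>MK)"
      using Hi Ti TH by (intro nn_integral_eq_integral) auto
    also have "\<dots> \<le> ennreal (integral\<^sup>L MK H)"
      using Hi Ti T_nonneg[of n] by (intro ennreal_leI) simp
    finally show "(\<integral>\<^sup>+z. ennreal (H z - T n z) \<partial>MK) \<le> ennreal (integral\<^sup>L MK H)" .
  qed
  also have "\<dots> = ennreal (integral\<^sup>L MK H)" by (simp add: Liminf_const)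
  \<comment> \<open>Fatou has been applied to H - T n \<ge> 0, whose integrals are at most that of
    H. Since T' \<le> 0, H - T' is a sum of two nonnegative functions, and cancelling the finite
    integral of H leaves that of - T' equal to 0.\<close>
  finally have le: "(\<integral>\<^sup>+z. ennreal (H z - T' z) \<partial>MK) \<le> ennreal (integral\<^sup>L MK H)" .
  have "(\<integral>\<^sup>+z. ennreal (H z - T' z) \<partial>MK) = (\<integral>\<^sup>+z. ennreal (H z) + ennreal (- T' z) \<partial>MK)"
    using T'0 by (intro nn_integral_cong_AE)
      (auto elim!: eventually_mono simp: H_def simp flip: ennreal_plus)
  also have "\<dots> = (\<integral>\<^sup>+z. ennreal (H z) \<partial>MK) + (\<integral>\<^sup>+z. ennreal (- T' z) \<partial>MK)"
    by (intro nn_integral_add) measurable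
  also have "(\<integral>\<^sup>+z. ennreal (H z) \<partial>MK) = ennreal (integral\<^sup>L MK H)"
    by (rule nn_integral_eq_integral[OF Hi]) (simp add: H_def)
  finally have "ennreal (integral\<^sup>L MK H) + (\<integral>\<^sup>+z. ennreal (- T' z) \<partial>MK) \<le> ennreal (integral\<^sup>L MK H) + 0"
    using le by simp
  then have "(\<integral>\<^sup>+z. ennreal (- T' z) \<partial>MK) = 0"
    by (subst (asm) ennreal_add_left_cancel_le) auto
  then have "AE z in MK. ennreal (- T' z) = 0"
    by (subst (asm) nn_integral_0_iff_AE) measurable
  then have "AE z in MK. T' z = 0"
    using T'0 by eventually_elim (auto simp: ennreal_eq_0_iff)
  then have "AE z in lebesgue \<Otimes>\<^sub>M lebesgue. fst z \<noteq> snd z \<longrightarrow> T' z = 0"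
    by (rule AE_MKD)
  then have "AE z in lebesgue \<Otimes>\<^sub>M lebesgue. \<not> (0 < u (fst z) \<and> (u (snd z) = 0 \<and> 0 < g (snd z)))"
    by eventually_elim (auto simp: T'_def difference_def signed_power_def)
  moreover have "{x \<in> space lebesgue. 0 < u x} \<in> sets lebesgue"
    "{x \<in> space lebesgue. u x = 0 \<and> 0 < g x} \<in> sets lebesgue"
    by measurable
  ultimately have "(AE x in lebesgue. \<not> 0 < u x) \<or> (AE x in lebesgue. \<not> (u x = 0 \<and> 0 < g x))"
    by (intro AE_pair_lebesgue_not_both) auto
  moreover have "\<not> (AE x in lebesgue. \<not> 0 < u x)"
  proof
    assume "AE x in lebesgue. \<not> 0 < u x"
    then have "AE x in lebesgue. u x = 0" using u0 by eventually_elim auto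
    then show False using u by (simp add: eigenfunction_def)
  qed
  ultimately show ?thesis by blast
qed

section \<open>Left translations and positivity\<close>

abbreviation \<delta> :: "real \<Rightarrow> real ^ 'n \<Rightarrow> real ^ 'n" where "\<delta> \<equiv> dilation G"

abbreviation Q :: nat where "Q \<equiv> homogeneous_dim G"

lemma weight_ge_1: "1 \<le> weight G j"
proof -
  have "weight G j \<in> {1..step G}"
    using stratified unfolding stratified_lie_group_def by blast
  then show ?thesis by simp
qed

text \<open>Summed by coordinates instead of layers, Q is the exponent of r in the determinant of
  the dilation.\<close>

lemma homogeneous_dim_eq: "Q = (\<Sum>j\<in>UNIV. weight G j)"
proof -
  have "(\<Sum>j\<in>UNIV. weight G j) = (\<Sum>i = 1..step G. \<Sum>j | j \<in> UNIV \<and> weight G j = i. weight G j)"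
  proof (rule sum.group[symmetric])
    show "range (weight G) \<subseteq> {1..step G}"
      using stratified unfolding stratified_lie_group_def by blast
  qed simp_all
  also have "\<dots> = (\<Sum>i = 1..step G. i * layer_dim G i)"
    by (intro sum.cong) (auto simp: layer_dim_def)
  finally show ?thesis by (simp add: homogeneous_dim_def)
qed

lemma dilation_gmult: "0 < r \<Longrightarrow> \<delta> r (gmult G x y) = gmult G (\<delta> r x) (\<delta> r y)"
  using stratified by (simp add: stratified_lie_group_def)

lemma dilation_dilation: "\<delta> r (\<delta> r' x) = \<delta> (r * r') x"
  by (simp add: dilation_def vec_eq_iff power_mult_distrib mult.assoc)

lemma dilation_1: "\<delta> 1 x = x"
  by (simp add: dilation_def vec_eq_iff)

lemma dilation_inverse: "r \<noteq> 0 \<Longrightarrow> \<delta> r (\<delta> (1 / r) x) = x" "r \<noteq> 0 \<Longrightarrow> \<delta> (1 / r) (\<delta> r x) = x"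
  by (simp_all add: dilation_dilation dilation_1)

lemma dilation_0: "\<delta> r 0 = 0"
  by (simp add: dilation_def vec_eq_iff)

lemma dilation_ginv: assumes "0 < r" shows "\<delta> r (ginv G x) = ginv G (\<delta> r x)"
proof -
  have "gmult G (\<delta> r (ginv G x)) (\<delta> r x) = 0"
    using dilation_gmult[OF assms, of "ginv G x" x] by (simp add: dilation_0)
  then show ?thesis
    by (metis G.assoc G.group_left_neutral G.right_inverse G.right_neutral)
qed

lemma qnorm_dilation: "0 < r \<Longrightarrow> qnorm G (\<delta> r x) = r * qnorm G x"
  using quasi_norm by (simp add: homogeneous_quasi_norm_def)

lemma bounded_linear_dilation: "bounded_linear (\<delta> r)"
proof -
  have "linear (\<delta> r)"
    by (rule linearI) (auto simp: dilation_def vec_eq_iff algebra_simps)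
  then show ?thesis by (simp add: linear_conv_bounded_linear)
qed

lemma dilation_component_le: "0 < r \<Longrightarrow> r \<le> 1 \<Longrightarrow> \<bar>\<delta> r x $ j\<bar> \<le> r * \<bar>x $ j\<bar>"
  using power_decreasing[of 1 "weight G j" r] weight_ge_1[of j]
  by (simp add: dilation_def abs_mult mult_right_mono)

lemma emeasure_dilation:
  assumes S: "S \<in> lmeasurable" and r: "0 < r"
  shows "emeasure lebesgue (\<delta> r ` S) = ennreal (r ^ Q) * emeasure lebesgue S" "\<delta> r ` S \<in> lmeasurable"
proof -
  have eq: "\<delta> r = (\<lambda>x. \<chi> k. r ^ weight G k * x $ k)"
    by (auto simp: dilation_def)
  have "measure lebesgue (\<delta> r ` S) = r ^ Q * measure lebesgue S"
    unfolding eq measure_stretch[OF S] homogeneous_dim_eq using r by (simp add: power_sum abs_prod prod_pos)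
  moreover show m: "\<delta> r ` S \<in> lmeasurable" unfolding eq by (rule measurable_stretch[OF S])
  ultimately show "emeasure lebesgue (\<delta> r ` S) = ennreal (r ^ Q) * emeasure lebesgue S"
    using S r by (simp add: emeasure_eq_measure2 ennreal_mult)
qed

lemma quasi_preserving_dilation:
  assumes r: "0 < r" shows "quasi_preserving (\<delta> r) ((1 / r) ^ Q)"
  by (rule quasi_preservingI[where h="\<delta> (1 / r)"])
    (use r emeasure_dilation[of _ "1 / r"] in
      \<open>auto intro: smooth_bounded_linear[OF bounded_linear_dilation] simp: dilation_inverse\<close>)

lemma cbox_one_iff: "x \<in> cbox (-1) (1 :: real ^ 'n) \<longleftrightarrow> (\<forall>j. \<bar>x $ j\<bar> \<le> 1)"
  by (auto simp: mem_box_cart abs_le_iff)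

text \<open>The estimate is made for the group law jointly on a product of two boxes, which makes
  the constant uniform in the left factor a.\<close>

lemma gmult_lipschitz_unit_box:
  obtains L where "0 \<le> L" "\<And>a x y. a \<in> cbox (-1) 1 \<Longrightarrow> x \<in> cbox (-1) 1 \<Longrightarrow> y \<in> cbox (-1) 1 \<Longrightarrow>
    norm (gmult G a x - gmult G a y) \<le> L * norm (x - y)"
proof -
  have sm: "smooth (\<lambda>(x, y). gmult G x y)"
    using stratified by (simp add: stratified_lie_group_def)
  have S: "compact (cbox (-1) 1 \<times> cbox (-1) (1 :: real ^ 'n))" "convex (cbox (-1) 1 \<times> cbox (-1) (1 :: real ^ 'n))"
    by (auto intro: compact_Times convex_Times)
  obtain L where L: "0 \<le> L" "\<And>x y. x \<in> cbox (-1) 1 \<times> cbox (-1) 1 \<Longrightarrow> y \<in> cbox (-1) 1 \<times> cbox (-1) 1 \<Longrightarrow>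
      norm ((case x of (x, y) \<Rightarrow> gmult G x y) - (case y of (x, y) \<Rightarrow> gmult G x y)) \<le> L * norm (x - y)"
    using smooth_lipschitz_on_compact_convex[OF sm S] by blast
  have "norm (gmult G a x - gmult G a y) \<le> L * norm (x - y)"
    if "a \<in> cbox (-1) 1" "x \<in> cbox (-1) 1" "y \<in> cbox (-1) 1" for a x y
    using L(2)[of "(a, x)" "(a, y)"] that by (simp add: norm_prod_def)
  with L(1) show ?thesis using that by blast
qed

lemma gmult_image_lmeasurable:
  assumes "S \<in> lmeasurable" "bounded S" shows "gmult G a ` S \<in> lmeasurable"
proof (rule bounded_set_imp_lmeasurable)
  have "compact (gmult G a ` closure S)"
    using assms by (intro compact_continuous_image continuous_on_gmult continuous_on_const continuous_on_id)
      (simp add: compact_closure)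
  then have "bounded (gmult G a ` closure S)" by (rule compact_imp_bounded)
  then show "bounded (gmult G a ` S)"
    by (rule bounded_subset[OF _ image_mono[OF closure_subset]])
  show "gmult G a ` S \<in> sets lebesgue"
    using assms smooth_imp_differentiable[OF smooth_gmult_right]
    by (intro differentiable_image_in_sets_lebesgue)
      (auto simp: differentiable_on_def intro: differentiable_at_withinI fmeasurableD)
qed

text \<open>By dilation, any translation of a bounded set is reduced to the unit box, where the group
  law is Lipschitz; this gives a constant independent of the translation.\<close>

lemma quasi_preserving_gmult:
  obtains C where "0 < C" "\<And>a. quasi_preserving (gmult G a) C"
proof -
  obtain L where L: "0 \<le> L" "\<And>a x y. a \<in> cbox (-1) 1 \<Longrightarrow> x \<in> cbox (-1) 1 \<Longrightarrow> y \<in> cbox (-1) 1 \<Longrightarrow>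
    norm (gmult G a x - gmult G a y) \<le> L * norm (x - y)"
    using gmult_lipschitz_unit_box by blast
  define C where "C = (2 * L * DIM(real ^ 'n)) ^ DIM(real ^ 'n)"
  have C: "0 \<le> C" using L(1) by (simp add: C_def)
  have main: "emeasure lebesgue (gmult G a ` S) \<le> ennreal C * emeasure lebesgue S"
    if S: "bounded S" "S \<in> lmeasurable" for a S
  proof -
    obtain B where B: "0 < B" "\<And>x. x \<in> insert a S \<Longrightarrow> norm x \<le> B"
      using S(1) bounded_pos[of "insert a S"] by auto
    \<comment> \<open>Small enough to send a and all of S into the unit box: a dilation by r \<le> 1
      shrinks every coordinate at least by the factor r, as all weights are at least 1.\<close>
    define r where "r = min 1 (1 / B)"
    have r: "0 < r" "r \<le> 1" "r * B \<le> 1" using B(1) by (auto simp: r_def min_def field_simps)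
    have box: "\<delta> r x \<in> cbox (-1) 1" if "x \<in> insert a S" for x
      unfolding cbox_one_iff
    proof
      fix j
      have "\<bar>\<delta> r x $ j\<bar> \<le> r * \<bar>x $ j\<bar>" using r by (intro dilation_component_le)
      also have "\<dots> \<le> r * B" using B(2)[OF that] component_le_norm_cart[of x j] r by (intro mult_left_mono) auto
      finally show "\<bar>\<delta> r x $ j\<bar> \<le> 1" using r by simp
    qed
    have eq: "\<delta> r ` gmult G a ` S = gmult G (\<delta> r a) ` \<delta> r ` S"
      by (simp add: image_image dilation_gmult[OF r(1)])
    note d = emeasure_dilation[OF S(2) r(1)]
    note m = gmult_image_lmeasurable[OF S(2,1), of a]
    have "ennreal (r ^ Q) * emeasure lebesgue (gmult G a ` S) = emeasure lebesgue (gmult G (\<delta> r a) ` \<delta> r ` S)"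
      using emeasure_dilation(1)[OF m r(1)] by (simp add: eq)
    also have "\<dots> \<le> ennreal C * emeasure lebesgue (\<delta> r ` S)"
      unfolding C_def
    proof (rule measure_lipschitz_image_le)
      show "\<delta> r ` S \<in> lmeasurable" by (rule d(2))
      show "\<delta> r ` S \<subseteq> cbox (-1) 1" using box by auto
      show "1 \<bullet> i - (-1) \<bullet> i = 2" if "i \<in> Basis" for i :: "real ^ 'n"
        using that by (auto simp: Basis_vec_def inner_axis)
      show "norm (gmult G (\<delta> r a) x - gmult G (\<delta> r a) y) \<le> L * norm (x - y)"
        if "x \<in> cbox (-1) 1" "y \<in> cbox (-1) 1" for x y
        using L(2) box that by auto
      show "gmult G (\<delta> r a) ` \<delta> r ` S \<in> sets lebesgue"
        unfolding eq[symmetric] using emeasure_dilation(2)[OF m r(1)] by (rule fmeasurableD)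
    qed (use L in auto)
    also have "\<dots> = ennreal (r ^ Q) * (ennreal C * emeasure lebesgue S)"
      by (simp only: d(1) mult.left_commute)
    finally have "ennreal (r ^ Q) * emeasure lebesgue (gmult G a ` S) \<le> ennreal (r ^ Q) * (ennreal C * emeasure lebesgue S)" .
    then have "r ^ Q * measure lebesgue (gmult G a ` S) \<le> r ^ Q * (C * measure lebesgue S)"
      using S(2) m r C by (simp add: emeasure_eq_measure2 flip: ennreal_mult)
    then have "measure lebesgue (gmult G a ` S) \<le> C * measure lebesgue S"
      using r by (simp add: mult_le_cancel_left)
    then show ?thesis
      using S(2) m C by (simp add: emeasure_eq_measure2 flip: ennreal_mult)
  qed
  \<comment> \<open>C may be 0 as defined; C + 1 is a positive constant, by which one can divide
    later.\<close>
  have "quasi_preserving (gmult G a) (C + 1)" for a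
  proof (rule quasi_preservingI[where h="gmult G (ginv G a)"])
    show "emeasure lebesgue (gmult G (ginv G a) ` S) \<le> ennreal (C + 1) * emeasure lebesgue S"
      if "bounded S" "S \<in> lmeasurable" for S
    proof -
      have "ennreal C * emeasure lebesgue S \<le> ennreal (C + 1) * emeasure lebesgue S"
        by (intro mult_right_mono ennreal_leI) auto
      then show ?thesis using main[OF that, of "ginv G a"] by (rule order_trans[rotated])
    qed
  qed (use C smooth_gmult_right in \<open>auto simp flip: G.assoc\<close>)
  then show ?thesis using that[of "C + 1"] C by auto
qed

section \<open>Moving a test function by translations and dilations\<close>

lemma domain_lmeasurable: "\<Omega> \<in> lmeasurable"
  using bounded_domain open_domain by (rule lmeasurable_open)

text \<open>Left translations cancel in y^(-1) x, so only the dilation acts on it, and the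
  quasi-norm is homogeneous of degree 1.\<close>

lemma K_transport:
  fixes b c :: "real ^ 'n"
  assumes R: "0 < R"
  defines "T \<equiv> \<lambda>x. gmult G b (\<delta> R (gmult G c x))"
  shows "K (T x) (T y) = R powr (real Q + p * s) * K x y"
proof -
  have "gmult G (ginv G (T y)) (T x) = \<delta> R (gmult G (ginv G y) x)"
  proof -
    have "gmult G (ginv G (T y)) (T x) =
        gmult G (ginv G (\<delta> R (gmult G c y))) (gmult G (gmult G (ginv G b) b) (\<delta> R (gmult G c x)))"
      by (simp add: T_def G.inverse_distrib_swap G.assoc del: G.left_inverse)
    also have "\<dots> = \<delta> R (gmult G (ginv G (gmult G c y)) (gmult G c x))"
      using R by (simp add: dilation_gmult dilation_ginv)
    also have "gmult G (ginv G (gmult G c y)) (gmult G c x) =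
        gmult G (ginv G y) (gmult G (gmult G (ginv G c) c) x)"
      by (simp add: G.inverse_distrib_swap G.assoc del: G.left_inverse)
    finally show ?thesis by simp
  qed
  then show ?thesis
    using R by (simp add: frac_weight_def qnorm_dilation powr_mult qnorm_nonneg)
qed

text \<open>The mass is finite because \<phi> is bounded and \<Omega> has finite measure. For the
  energy, the kernel changes by a constant factor under T and the product measure is distorted by at
  most another one.\<close>

lemma fin_transport:
  fixes b c :: "real ^ 'n"
  assumes \<phi>: "\<phi> \<in> test_functions \<Omega>" "fin \<phi>" and R: "0 < R"
  defines "T \<equiv> \<lambda>x. gmult G b (\<delta> R (gmult G c x))"
  shows "fin (\<lambda>x. \<phi> (T x))"
proof -
  obtain C where C: "0 < C" "\<And>a. quasi_preserving (gmult G a) C"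
    using quasi_preserving_gmult by blast
  obtain C' where qT: "quasi_preserving T C'"
    unfolding T_def using quasi_preserving_compose[OF C(2) quasi_preserving_compose[OF quasi_preserving_dilation[OF R] C(2)]]
    by blast
  have C': "0 \<le> C'" and [measurable]: "T \<in> lebesgue \<rightarrow>\<^sub>M lebesgue"
    using qT by (auto simp: quasi_preserving_def)
  note [measurable] = fin_measurable[OF \<phi>(2)]
  obtain M where M: "0 < M" "\<And>x. \<bar>\<phi> x\<bar> \<le> M" using test_function_bounded[OF \<phi>(1)] by blast
  have "integrable M\<Omega> (\<lambda>x. \<bar>\<phi> (T x)\<bar> powr p)"
  proof (subst integrable_M\<Omega>_iff, measurable)
    show "set_integrable lebesgue \<Omega> (\<lambda>x. \<bar>\<phi> (T x)\<bar> powr p)"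
    proof (rule set_integrable_bound)
      show "set_integrable lebesgue \<Omega> (\<lambda>x. M powr p)"
        using fmeasurableD2[OF domain_lmeasurable]
        by (simp add: set_integrable_def less_top del: emeasure_completion)
      show "AE x in lebesgue. x \<in> \<Omega> \<longrightarrow> norm (\<bar>\<phi> (T x)\<bar> powr p) \<le> norm (M powr p)"
        using M p_pos by (auto intro!: powr_mono2)
      show "set_borel_measurable lebesgue \<Omega> (\<lambda>x. \<bar>\<phi> (T x)\<bar> powr p)"
        unfolding set_borel_measurable_def by measurable
    qed
  qed
  moreover have "integrable MK (\<lambda>z. \<bar>difference (\<lambda>x. \<phi> (T x)) z\<bar> powr p)"
  proof (subst integrable_MK_iff, measurable)
    define k where "k = R powr (real Q + p * s)"
    have k: "0 < k" using R by (simp add: k_def)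
    define F where "F z = \<bar>difference \<phi> z\<bar> powr p / K (fst z) (snd z)" for z
    have [measurable]: "F \<in> borel_measurable (lebesgue \<Otimes>\<^sub>M lebesgue)"
      unfolding F_def[abs_def] by measurable
    have F0: "0 \<le> F z" for z using K_nonneg by (simp add: F_def)
    have eq: "\<bar>difference (\<lambda>x. \<phi> (T x)) z\<bar> powr p / K (fst z) (snd z) = k * F (T (fst z), T (snd z))" for z
      using K_transport[OF R, of b c "fst z" "snd z"] k
      by (simp add: F_def difference_def T_def k_def)
    have "integrable (lebesgue \<Otimes>\<^sub>M lebesgue) F"
      using fin_Lp(2)[OF \<phi>(2)] unfolding F_def in_Lp_def by (subst integrable_MK_iff[symmetric]) auto
    then have "(\<integral>\<^sup>+z. ennreal (F z) \<partial>(lebesgue \<Otimes>\<^sub>M lebesgue)) < \<infinity>"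
      using F0 by (simp add: integrable_iff_bounded)
    then have "ennreal (C' * C') * (\<integral>\<^sup>+z. ennreal (F z) \<partial>(lebesgue \<Otimes>\<^sub>M lebesgue)) < \<infinity>"
      by (simp add: ennreal_mult_less_top)
    with quasi_preserving_nn_integral_pair[OF qT, of F]
    have "(\<integral>\<^sup>+z. ennreal (F (T (fst z), T (snd z))) \<partial>(lebesgue \<Otimes>\<^sub>M lebesgue)) < \<infinity>"
      using quasi_preserving_nn_integral_pair[OF qT, of "\<lambda>z. ennreal (F z)"] by (simp add: le_less_trans)
    then have "integrable (lebesgue \<Otimes>\<^sub>M lebesgue) (\<lambda>z. F (T (fst z), T (snd z)))"
      using F0 by (simp add: integrable_iff_bounded)
    then show "integrable (lebesgue \<Otimes>\<^sub>M lebesgue)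
        (\<lambda>z. \<bar>difference (\<lambda>x. \<phi> (T x)) z\<bar> powr p / K (fst z) (snd z))"
      unfolding eq by simp
  qed
  ultimately show ?thesis
    unfolding fin_def in_Lp_def by (intro conjI; measurable)
qed

lemma smooth_transport:
  "smooth (\<lambda>x. gmult G b (\<delta> R (gmult G c x)))"
  by (intro smooth_compose[OF smooth_gmult_right] smooth_compose[OF smooth_bounded_linear[OF bounded_linear_dilation]]
      smooth_gmult_right)

lemma norm_dilation_le:
  assumes "0 < r" "r \<le> 1" shows "norm (\<delta> r x) \<le> r * norm x"
proof -
  have "norm (\<delta> r x) \<le> norm (r *\<^sub>R x)"
    by (rule norm_le_componentwise_cart)
      (use dilation_component_le[OF assms] assms in \<open>auto simp: abs_mult\<close>)
  then show ?thesis using assms by simp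
qed

text \<open>The nontrivial u supplies a test function of finite energy that is nonzero at some z0.
  Composing it with a map that takes x1 to z0 and expands strongly shrinks its support into \<Omega>
  near x1; the absolute value makes it nonnegative.\<close>

lemma X0_local_positive:
  assumes u: "u \<in> XX" "\<not> (AE x in lebesgue. u x = 0)" and x1: "x1 \<in> \<Omega>"
  obtains g U where "g \<in> XX" "\<And>x. 0 \<le> g x" "open U" "x1 \<in> U" "\<And>x. x \<in> U \<Longrightarrow> 0 < g x"
proof -
  obtain f where f: "\<And>n. f n \<in> test_functions \<Omega>" "\<And>n. fin (f n)" "strongly_tendsto f u"
    using X0_approximable[OF u(1)] by blast
  have "\<exists>n z. f n z \<noteq> 0"
  proof (rule ccontr)
    assume "\<nexists>n z. f n z \<noteq> 0"
    then have "(\<lambda>n. mass u) \<longlonglongrightarrow> 0"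
      using f(3) by (simp add: strongly_tendsto_def)
    then have "mass u = 0" by (simp add: LIMSEQ_const_iff)
    then show False using u mass_eq_0_iff by blast
  qed
  then obtain \<phi> z0 where \<phi>: "\<phi> \<in> test_functions \<Omega>" "fin \<phi>" "\<phi> z0 \<noteq> 0"
    using f by blast
  define S where "S = closure {x. \<phi> x \<noteq> 0}"
  have S: "compact S" using \<phi>(1) by (simp add: S_def test_functions_def)
  have S0: "x \<in> S" if "\<phi> x \<noteq> 0" for x
    using that closure_subset[of "{x. \<phi> x \<noteq> 0}"] by (auto simp: S_def)
  have "compact (gmult G (ginv G z0) ` S)"
    using S by (intro compact_continuous_image continuous_intros)
  from compact_imp_bounded[OF this]
  obtain B where B: "0 < B" "\<And>x. x \<in> S \<Longrightarrow> norm (gmult G (ginv G z0) x) \<le> B"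
    unfolding bounded_pos by blast
  have "continuous_on UNIV (gmult G x1)"
    by (intro continuous_intros)
  then have "open (gmult G x1 -` \<Omega>)"
    using open_domain by (simp add: open_vimage)
  moreover have "0 \<in> gmult G x1 -` \<Omega>" using x1 by simp
  ultimately obtain d where "0 < d" "ball 0 d \<subseteq> gmult G x1 -` \<Omega>"
    unfolding open_contains_ball by blast
  then have d: "0 < d" "\<And>v. norm v < d \<Longrightarrow> gmult G x1 v \<in> \<Omega>"
    by auto
  \<comment> \<open>Contracting by 1 / R brings the recentred support, of radius at most B, into the
    ball of radius d; the factor 2 makes the inclusion strict.\<close>
  define R where "R = max 1 (2 * B / d)"
  have R: "1 \<le> R" "0 < R" by (auto simp: R_def)
  have RB: "(1 / R) * B < d"
  proof -
    have "2 * B / d \<le> R" by (simp add: R_def)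
    then have "2 * B \<le> R * d" using d(1) by (simp add: pos_divide_le_eq)
    then have "B < R * d" using B(1) by linarith
    then show ?thesis using R by (simp add: pos_divide_less_eq mult.commute)
  qed
  \<comment> \<open>Translate x1 to 0, expand, translate 0 to z0. The map h below reverses this and
    carries the old support onto a set containing the new one.\<close>
  define T where "T = (\<lambda>x. gmult G z0 (\<delta> R (gmult G (ginv G x1) x)))"
  define h where "h = (\<lambda>x. gmult G x1 (\<delta> (1 / R) (gmult G (ginv G z0) x)))"
  have hT: "h (T x) = x" for x
  proof -
    have "h (T x) = gmult G x1 (\<delta> (1 / R) (gmult G (gmult G (ginv G z0) z0) (\<delta> R (gmult G (ginv G x1) x))))"
      by (simp add: h_def T_def G.assoc del: G.left_inverse)
    also have "\<dots> = gmult G (gmult G x1 (ginv G x1)) x"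
      using R(2) by (simp add: dilation_inverse G.assoc del: G.right_inverse)
    finally show ?thesis by simp
  qed
  have "(\<lambda>x. \<phi> (T x)) \<in> test_functions \<Omega>"
  proof (rule test_functionsI[of _ "h ` S"])
    show "smooth (\<lambda>x. \<phi> (T x))"
      unfolding T_def
      by (rule smooth_compose[OF _ smooth_transport]) (use \<phi>(1) in \<open>simp add: test_functions_def\<close>)
    show "compact (h ` S)"
      unfolding h_def using S
      by (intro compact_continuous_image continuous_intros bounded_linear.continuous_on[OF bounded_linear_dilation])
    show "h ` S \<subseteq> \<Omega>"
    proof
      fix y assume "y \<in> h ` S"
      then obtain x where x: "x \<in> S" "y = h x" by blast
      have "norm (\<delta> (1 / R) (gmult G (ginv G z0) x)) \<le> (1 / R) * norm (gmult G (ginv G z0) x)"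
        using R by (intro norm_dilation_le) auto
      also have "\<dots> \<le> (1 / R) * B" using B(2)[OF x(1)] R by (intro mult_left_mono) auto
      finally show "y \<in> \<Omega>" unfolding x(2) h_def using RB by (intro d(2)) linarith
    qed
    show "x \<in> h ` S" if "\<phi> (T x) \<noteq> 0" for x
      using S0[OF that] hT[of x] by (metis imageI)
  qed
  moreover have "fin (\<lambda>x. \<phi> (T x))"
    unfolding T_def by (rule fin_transport[OF \<phi>(1,2) R(2)])
  ultimately have "(\<lambda>x. \<bar>\<phi> (T x)\<bar>) \<in> XX"
    using test_function_lipschitz_in_X0[of "\<lambda>x. \<phi> (T x)" abs 1] by auto
  moreover have "open {x. \<phi> (T x) \<noteq> 0}"
  proof -
    have "continuous_on UNIV \<phi>" using \<phi>(1) smooth_imp_continuous_on by (auto simp: test_functions_def)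
    from continuous_on_compose2[OF this smooth_imp_continuous_on[OF smooth_transport[of z0 R "ginv G x1"]]]
    have "continuous_on UNIV (\<lambda>x. \<phi> (T x))" unfolding T_def by auto
    then show ?thesis by (intro open_Collect_neq continuous_on_const)
  qed
  moreover have "T x1 = z0" by (simp add: T_def dilation_0)
  ultimately show ?thesis
    using that[of "\<lambda>x. \<bar>\<phi> (T x)\<bar>" "{x. \<phi> (T x) \<noteq> 0}"] \<phi>(3) by auto
qed

text \<open>The minimum principle gives nonvanishing almost everywhere near each point of \<Omega>.
  By Lindelof countably many such neighbourhoods suffice, so the exceptional null sets may be
  united.\<close>

lemma nonneg_eigenfunction_positive:
  assumes u: "eigenfunction G s p \<Omega> \<nu> u" and u0: "AE x in lebesgue. 0 \<le> u x"
  shows "AE x in lebesgue. x \<in> \<Omega> \<longrightarrow> 0 < u x"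
proof -
  define F where "F = {U. open U \<and> (AE x in lebesgue. x \<in> U \<longrightarrow> u x \<noteq> 0)}"
  have "\<Omega> \<subseteq> \<Union>F"
  proof
    fix x1 assume "x1 \<in> \<Omega>"
    then obtain g U where g: "g \<in> XX" "\<And>x. 0 \<le> g x" "open U" "x1 \<in> U" "\<And>x. x \<in> U \<Longrightarrow> 0 < g x"
      using X0_local_positive[OF eigenfunctionD(2)[OF u]] u unfolding eigenfunction_def by metis
    have "AE x in lebesgue. x \<in> U \<longrightarrow> u x \<noteq> 0"
      using strong_minimum_principle[OF u u0 g(1,2)] by eventually_elim (use g(5) in auto)
    then show "x1 \<in> \<Union>F" using g(3,4) by (auto simp: F_def)
  qed
  obtain F' where F': "F' \<subseteq> F" "countable F'" "\<Union>F' = \<Union>F"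
    by (rule Lindelof[of F]) (auto simp: F_def)
  have "AE x in lebesgue. \<forall>U\<in>F'. x \<in> U \<longrightarrow> u x \<noteq> 0"
    using F'(1,2) by (subst AE_ball_countable) (auto simp: F_def)
  then show ?thesis
    using u0
  proof eventually_elim
    case (elim x)
    then show ?case using \<open>\<Omega> \<subseteq> \<Union>F\<close> F'(3) by (metis UnionE order_less_le subsetD)
  qed
qed

section \<open>The Picone inequality\<close>

text \<open>A product of two bounded functions, each to be recognised as a Lipschitz function of an
  element of the space with value 0 at 0; \<open>X0_mult\<close> then applies.\<close>

lemma Picone_test_function:
  assumes u: "u \<in> XX" and v: "v \<in> XX" "\<And>x. 0 \<le> v x" "\<And>x. v x \<le> M" and e: "0 < e"
  shows "(\<lambda>x. v x powr p * (max (u x) 0 + e) powr (1 - p)) \<in> XX"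
proof -
  have M: "0 \<le> M" using v(2,3)[of 0] by linarith
  define f where "f x = v x powr p" for x
  \<comment> \<open>The negative power itself does not vanish where u does. Its difference from e
    powr (1 - p) does, and the constant is restored afterwards as a multiple of f.\<close>
  define g where "g x = e powr (1 - p) - (max (u x) 0 + e) powr (1 - p)" for x
  have "(\<lambda>x. (max 0 (min (v x) M)) powr p) \<in> XX"
    by (rule X0_lipschitz[OF v(1) truncated_powr_lipschitz[OF p_gt_1 M]]) (use p_pos M in auto)
  moreover have "max 0 (min (v x) M) = v x" for x using v by (simp add: min_def)
  ultimately have f: "f \<in> XX" by (simp add: f_def[abs_def])
  have g: "g \<in> XX"
    unfolding g_def[abs_def]
  proof (rule X0_lipschitz[OF u, where L="(p - 1) * e powr (- p)"])
    show "\<bar>(e powr (1 - p) - (max x 0 + e) powr (1 - p)) - (e powr (1 - p) - (max y 0 + e) powr (1 - p))\<bar>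
        \<le> (p - 1) * e powr (- p) * \<bar>x - y\<bar>" for x y
      using shifted_negative_powr_lipschitz[OF p_gt_1 e, of x y] by (simp add: abs_minus_commute)
  qed simp
  define M' where "M' = max (M powr p) (e powr (1 - p))"
  have fb: "\<bar>f x\<bar> \<le> M'" for x
    using v(2,3)[of x] p_pos by (auto simp: f_def M'_def intro: max.coboundedI1 powr_mono2)
  have gb: "\<bar>g x\<bar> \<le> M'" for x
  proof -
    have "(max (u x) 0 + e) powr (1 - p) \<le> e powr (1 - p)"
      using e p_gt_1 by (intro powr_mono2') auto
    then show ?thesis by (auto simp: g_def M'_def intro: max.coboundedI2)
  qed
  have "(\<lambda>x. e powr (1 - p) * f x - f x * g x) \<in> XX"
    by (intro X0_diff X0_cmult f X0_mult[OF f g fb gb])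
  moreover have "e powr (1 - p) * f x - f x * g x = v x powr p * (max (u x) 0 + e) powr (1 - p)" for x
    by (simp add: f_def g_def algebra_simps)
  ultimately show ?thesis by simp
qed

text \<open>The discrete inequality is applied to u + e, whose differences are those of u, and
  integrated. On the mass side the factor (u / (u + e))^(p-1) appears; it is at most 1 and tends to
  1 as e vanishes.\<close>

lemma Picone_bounded:
  assumes u: "eigenfunction G s p \<Omega> \<nu> u" and u0: "AE x in lebesgue. 0 \<le> u x"
    and v: "v \<in> XX" "\<And>x. 0 \<le> v x" "\<And>x. v x \<le> M"
  shows "\<nu> * mass v \<le> energy v"
proof -
  note uX = eigenfunctionD(2)[OF u]
  note [measurable] = X0_measurable[OF uX] X0_measurable[OF v(1)]
  define e where "e n = 1 / real (Suc n)" for n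
  have e: "0 < e n" for n by (simp add: e_def)
  define t where "t n x = v x powr p * (max (u x) 0 + e n) powr (1 - p)" for n x
  have tX: "t n \<in> XX" for n
    unfolding t_def[abs_def] by (rule Picone_test_function[OF uX v e])
  have [measurable]: "t n \<in> borel_measurable lebesgue" for n using X0_measurable[OF tX] .
  have u0': "AE z in MK. 0 \<le> u (fst z) \<and> 0 \<le> u (snd z)"
    using AE_MKI[OF AE_pair_lebesgue_fst[OF u0]] AE_MKI[OF AE_pair_lebesgue_snd[OF u0]]
    by eventually_elim auto
  have le: "\<nu> * mass_form u (t n) \<le> energy v" for n
  proof -
    have "\<nu> * mass_form u (t n) = energy_form u (t n)"
      using weak_solution_X0[OF eigenfunctionD(1)[OF u] tX] by simp
    also have "\<dots> \<le> energy v"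
      unfolding energy_form_def energy_def
    proof (rule integral_mono_AE)
      show "integrable MK (\<lambda>z. signed_power p (difference u z) * difference (t n) z)"
        by (intro integrable_signed_power_mult[OF p_gt_1] X0_Lp(2)[OF uX] X0_Lp(2)[OF tX])
      show "integrable MK (\<lambda>z. \<bar>difference v z\<bar> powr p)"
        using X0_Lp(2)[OF v(1)] by (simp add: in_Lp_def)
      show "AE z in MK. signed_power p (difference u z) * difference (t n) z \<le> \<bar>difference v z\<bar> powr p"
        using u0'
      proof eventually_elim
        case (elim z)
        have "c * x powr (1 - p) = c / x powr (p - 1)" for c x :: real
          using powr_minus_divide[of x "p - 1"] by simp
        then show ?case
          using discrete_Picone[OF p_gt_1, of "u (fst z) + e n" "u (snd z) + e n" "v (fst z)" "v (snd z)"] elim e[of n] v(2)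
          by (simp add: difference_def t_def add_nonneg_pos)
      qed
    qed
    finally show ?thesis .
  qed
  have "(\<lambda>n. mass_form u (t n)) \<longlonglongrightarrow> mass v"
    unfolding mass_form_def mass_def
  proof (rule integral_dominated_convergence[where w="\<lambda>x. \<bar>v x\<bar> powr p"])
    show "integrable M\<Omega> (\<lambda>x. \<bar>v x\<bar> powr p)"
      using X0_Lp(1)[OF v(1)] by (simp add: in_Lp_def)
    have eq: "signed_power p (u x) * t n x = (u x / (u x + e n)) powr (p - 1) * v x powr p" if "0 \<le> u x" for x n
    proof -
      have "signed_power p (u x) = u x powr (p - 1)"
        using that by (cases "u x = 0") (auto simp: signed_power_eq)
      then show ?thesis
        using that powr_minus_divide[of "u x + e n" "p - 1"] e[of n] by (simp add: t_def powr_divide)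
    qed
    show "AE x in M\<Omega>. norm (signed_power p (u x) * t n x) \<le> \<bar>v x\<bar> powr p" for n
      using AE_M\<Omega>I[OF u0]
    proof eventually_elim
      case (elim x)
      have "(u x / (u x + e n)) powr (p - 1) \<le> 1"
        using elim e[of n] p_gt_1 by (intro powr_le1) (auto simp: divide_le_eq_1 add_nonneg_pos)
      then show ?case
        using eq[OF elim, of n] v(2)[of x] by (simp add: abs_mult mult_left_le_one_le)
    qed
    \<comment> \<open>Strict positivity is essential here: where u = 0 the factor would be 0 for
      every n and the limit would lose mass.\<close>
    have pos: "AE x in M\<Omega>. 0 < u x"
      using nonneg_eigenfunction_positive[OF u u0] by (simp add: AE_M\<Omega>_iff)
    show "AE x in M\<Omega>. (\<lambda>n. signed_power p (u x) * t n x) \<longlonglongrightarrow> \<bar>v x\<bar> powr p"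
      using pos
    proof eventually_elim
      case (elim x)
      have "e \<longlonglongrightarrow> 0"
        unfolding e_def using LIMSEQ_inverse_real_of_nat by (simp add: inverse_eq_divide)
      then have "(\<lambda>n. (u x / (u x + e n)) powr (p - 1) * v x powr p) \<longlonglongrightarrow> (u x / (u x + 0)) powr (p - 1) * v x powr p"
        using elim by (intro tendsto_intros) auto
      then show ?case using eq[of x] elim v(2)[of x] by simp
    qed
  qed measurable
  then have "(\<lambda>n. \<nu> * mass_form u (t n)) \<longlonglongrightarrow> \<nu> * mass v"
    by (rule tendsto_mult_left)
  then show ?thesis
    by (rule LIMSEQ_le_const2) (use le in auto)
qed

text \<open>|w| is truncated at height n. Truncation is 1-Lipschitz and so does not raise the
  energy, while the masses converge to that of w.\<close>

lemma Picone:
  assumes u: "eigenfunction G s p \<Omega> \<nu> u" and u0: "AE x in lebesgue. 0 \<le> u x" and w: "w \<in> XX"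
  shows "\<nu> * mass w \<le> energy w"
proof -
  note [measurable] = X0_measurable[OF w]
  define v where "v n x = min \<bar>w x\<bar> (real n)" for n x
  have lip: "\<bar>min \<bar>x\<bar> (real n) - min \<bar>y\<bar> (real n)\<bar> \<le> 1 * \<bar>x - y\<bar>" for x y n by (auto simp: min_def)
  have vX: "v n \<in> XX" for n
    unfolding v_def[abs_def] by (rule X0_lipschitz[OF w lip]) simp
  have le: "\<nu> * mass (v n) \<le> energy w" for n
  proof -
    have "\<nu> * mass (v n) \<le> energy (v n)"
      by (rule Picone_bounded[OF u u0 vX, where M="real n"]) (auto simp: v_def)
    also have "\<dots> \<le> 1 powr p * energy w"
    proof (rule fin_lipschitz(3)[OF X0_fin[OF w] X0_measurable[OF vX]])
      show "\<bar>v n x\<bar> \<le> 1 * \<bar>w x\<bar>" "\<bar>v n x - v n y\<bar> \<le> 1 * \<bar>w x - w y\<bar>" for x y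
        using lip by (auto simp: v_def)
    qed simp
    finally show ?thesis by simp
  qed
  have "(\<lambda>n. mass (v n)) \<longlonglongrightarrow> mass w"
    unfolding mass_def
  proof (rule integral_dominated_convergence[where w="\<lambda>x. \<bar>w x\<bar> powr p"])
    show "integrable M\<Omega> (\<lambda>x. \<bar>w x\<bar> powr p)"
      using X0_Lp(1)[OF w] by (simp add: in_Lp_def)
    show "AE x in M\<Omega>. norm (\<bar>v n x\<bar> powr p) \<le> \<bar>w x\<bar> powr p" for n
      using p_pos by (auto simp: v_def intro!: powr_mono2)
    show "AE x in M\<Omega>. (\<lambda>n. \<bar>v n x\<bar> powr p) \<longlonglongrightarrow> \<bar>w x\<bar> powr p"
    proof (rule AE_I2)
      fix x
      obtain N where N: "\<bar>w x\<bar> \<le> real N" using real_arch_simple by blast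
      have "\<forall>\<^sub>F n in sequentially. \<bar>v n x\<bar> powr p = \<bar>w x\<bar> powr p"
        unfolding eventually_sequentially
      proof (intro exI[of _ N] allI impI)
        fix n assume "N \<le> n"
        then have "\<bar>w x\<bar> \<le> real n" using N by linarith
        then show "\<bar>v n x\<bar> powr p = \<bar>w x\<bar> powr p" by (simp add: v_def)
      qed
      then show "(\<lambda>n. \<bar>v n x\<bar> powr p) \<longlonglongrightarrow> \<bar>w x\<bar> powr p" by (rule tendsto_eventually)
    qed
  qed (measurable, unfold v_def, measurable)
  then have "(\<lambda>n. \<nu> * mass (v n)) \<longlonglongrightarrow> \<nu> * mass w"
    by (rule tendsto_mult_left)
  then show ?thesis
    by (rule LIMSEQ_le_const2) (use le in auto)
qed

text \<open>Picone makes \<nu> a lower bound for all Rayleigh quotients, hence at most their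
  infimum; every eigenvalue is at least that infimum.\<close>

lemma nonneg_eigenfunction_first:
  assumes u: "eigenfunction G s p \<Omega> \<nu> u" and u0: "AE x in lebesgue. 0 \<le> u x"
  shows "\<nu> = \<Lambda>"
proof (rule antisym)
  show "\<nu> \<le> \<Lambda>"
    using first_eigenvalue_ge[OF eigenfunctionD(2)[OF u]] eigenfunctionD(3)[OF u] Picone[OF u u0] by simp
qed (rule eigenfunctionD(5)[OF u])

section \<open>The spectral gap\<close>

text \<open>Y is the left translate by x of a dilated punctured ball. Homogeneity makes its measure
  proportional to r^Q up to the translation constant, and the quasi-norm of y^(-1) x is at most r on
  it.\<close>

lemma small_translated_ball:
  obtains m where "0 < m"
    "\<And>x r. 0 < r \<Longrightarrow> \<exists>Y. Y \<in> sets lebesgue \<and> ennreal (r ^ Q * m) \<le> emeasure lebesgue Y \<and>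
       (\<forall>y\<in>Y. 0 < K x y \<and> K x y \<le> r powr (real Q + p * s))"
proof -
  obtain C where C: "0 < C" "\<And>a. quasi_preserving (gmult G a) C"
    using quasi_preserving_gmult by blast
  have "continuous_on UNIV (\<lambda>z. qnorm G z)"
    by (intro continuous_on_qnorm continuous_on_id)
  then have "open ((\<lambda>z. qnorm G z) -` {..<1})"
    by (simp add: open_vimage)
  moreover have "qnorm G 0 = 0"
    using quasi_norm unfolding homogeneous_quasi_norm_def by blast
  then have "0 \<in> (\<lambda>z. qnorm G z) -` {..<1}" by simp
  ultimately obtain d where d: "0 < d" "ball 0 d \<subseteq> (\<lambda>z. qnorm G z) -` {..<1}"
    unfolding open_contains_ball by blast
  \<comment> \<open>Inside the unit quasi-ball; removing the centre guarantees y \<noteq> x, so that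
    the kernel is positive.\<close>
  define B where "B = ball (0 :: real ^ 'n) d - {0}"
  have B: "B \<in> lmeasurable" unfolding B_def by (intro fmeasurable.Diff) (auto intro: negligible_imp_measurable)
  have "measure lebesgue B = measure lebesgue (ball (0 :: real ^ 'n) d)"
    unfolding B_def by (intro measure_negligible_symdiff) (auto intro: negligible_subset[of "{0}"])
  then have b: "0 < measure lebesgue B"
    using content_ball_pos[OF d(1), of "0 :: real ^ 'n"] by simp
  define m where "m = measure lebesgue B / C"
  have "\<exists>Y. Y \<in> sets lebesgue \<and> ennreal (r ^ Q * m) \<le> emeasure lebesgue Y \<and>
       (\<forall>y\<in>Y. 0 < K x y \<and> K x y \<le> r powr (real Q + p * s))" if r: "0 < r" for x r
  proof (intro exI conjI ballI)
    define Y where "Y = gmult G (ginv G x) -` (\<delta> r ` B)"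
    note dB = emeasure_dilation[OF B r]
    have "gmult G (ginv G x) \<in> lebesgue \<rightarrow>\<^sub>M lebesgue" using C by (simp add: quasi_preserving_def)
    then show Y: "Y \<in> sets lebesgue"
      unfolding Y_def using measurable_sets[of _ lebesgue lebesgue "\<delta> r ` B"] fmeasurableD[OF dB(2)] by auto
    have "\<delta> r ` B = gmult G x -` Y"
      by (simp add: Y_def vimage_def G.assoc[symmetric])
    \<comment> \<open>The distortion bound is an upper bound for preimages. Written for the inverse
      translation, it becomes the required lower bound for Y.\<close>
    then have "emeasure lebesgue (\<delta> r ` B) \<le> ennreal C * emeasure lebesgue Y"
      using C(2)[of x] Y by (simp add: quasi_preserving_def)
    then have le: "ennreal (r ^ Q * measure lebesgue B) \<le> ennreal C * emeasure lebesgue Y"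
      using B r unfolding dB(1) by (simp add: emeasure_eq_measure2 flip: ennreal_mult)
    show "ennreal (r ^ Q * m) \<le> emeasure lebesgue Y"
    proof (cases "emeasure lebesgue Y")
      case (real a)
      then have "r ^ Q * measure lebesgue B \<le> C * a"
        using le C r by (simp add: ennreal_mult[symmetric])
      then show ?thesis using real C by (simp add: m_def field_simps)
    qed simp
    fix y assume "y \<in> Y"
    then obtain z where z: "z \<in> B" "gmult G (ginv G x) y = \<delta> r z" by (auto simp: Y_def)
    have "\<delta> r z \<noteq> 0"
      using z(1) dilation_inverse(2)[of r z] r dilation_0[of "1 / r"] by (auto simp: B_def)
    then have "x \<noteq> y" using z(2) by auto
    then show "0 < K x y" by (rule K_pos)
    have "qnorm G (gmult G (ginv G y) x) = qnorm G (\<delta> r z)"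
      using qnorm_difference_commute[of x y] z(2) by simp
    also have "\<dots> \<le> r"
      using d(2) z(1) r by (auto simp: B_def qnorm_dilation subset_iff intro!: mult_left_le less_imp_le)
    finally show "K x y \<le> r powr (real Q + p * s)"
      unfolding frac_weight_def using K_exponent_pos by (intro powr_mono2) (auto simp: qnorm_nonneg)
  qed
  then show ?thesis using that[of m] b C by (simp add: m_def)
qed

lemma nn_integral_MK:
  assumes [measurable]: "f \<in> borel_measurable (lebesgue \<Otimes>\<^sub>M lebesgue)"
  shows "(\<integral>\<^sup>+z. f z \<partial>MK) = (\<integral>\<^sup>+x. \<integral>\<^sup>+y. ennreal (1 / K x y) * f (x, y) \<partial>lebesgue \<partial>lebesgue)"
proof -
  have "(\<integral>\<^sup>+z. f z \<partial>MK) = (\<integral>\<^sup>+z. ennreal (1 / K (fst z) (snd z)) * f z \<partial>(lebesgue \<Otimes>\<^sub>M lebesgue))"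
    unfolding MK_def by (rule nn_integral_density) measurable
  also have "\<dots> = (\<integral>\<^sup>+x. \<integral>\<^sup>+y. ennreal (1 / K x y) * f (x, y) \<partial>lebesgue \<partial>lebesgue)"
    by (subst lebesgue.nn_integral_fst[symmetric]) auto
  finally show ?thesis .
qed

lemma nn_integral_energy: "u \<in> XX \<Longrightarrow> (\<integral>\<^sup>+z. ennreal (\<bar>difference u z\<bar> powr p) \<partial>MK) = ennreal (energy u)"
  unfolding energy_def using fin_Lp(2)[OF X0_fin[of u]]
  by (intro nn_integral_eq_integral) (auto simp: in_Lp_def)

lemma nn_integral_mass:
  assumes u: "u \<in> XX"
  shows "(\<integral>\<^sup>+x. ennreal (\<bar>u x\<bar> powr p * indicator \<Omega> x) \<partial>lebesgue) = ennreal (mass u)"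
proof -
  note [measurable] = X0_measurable[OF u]
  have "(\<integral>\<^sup>+x. ennreal (\<bar>u x\<bar> powr p) \<partial>M\<Omega>) = ennreal (mass u)"
    unfolding mass_def using X0_Lp(1)[OF u]
    by (intro nn_integral_eq_integral) (auto simp: in_Lp_def)
  moreover have "(\<integral>\<^sup>+x. ennreal (\<bar>u x\<bar> powr p) \<partial>M\<Omega>) = (\<integral>\<^sup>+x. ennreal (indicator \<Omega> x) * ennreal (\<bar>u x\<bar> powr p) \<partial>lebesgue)"
    unfolding M\<Omega>_def by (rule nn_integral_density) measurable
  ultimately show ?thesis by (simp add: ennreal_mult'' mult.commute)
qed

text \<open>A Faber--Krahn inequality: the energy of a function supported in a small set \<open>E\<close> is large
  because most of a small ball around any point lies outside \<open>E\<close>.\<close>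

lemma Faber_Krahn:
  assumes "0 < k"
  obtains c where "0 < c"
    "\<And>v E. v \<in> XX \<Longrightarrow> E \<in> sets lebesgue \<Longrightarrow> (AE x in lebesgue. x \<notin> E \<longrightarrow> v x = 0) \<Longrightarrow>
       emeasure lebesgue E < ennreal c \<Longrightarrow> k * mass v \<le> energy v"
proof -
  obtain m where m: "0 < m" "\<And>x r. 0 < r \<Longrightarrow> \<exists>Y. Y \<in> sets lebesgue \<and> ennreal (r ^ Q * m) \<le> emeasure lebesgue Y \<and>
       (\<forall>y\<in>Y. 0 < K x y \<and> K x y \<le> r powr (real Q + p * s))"
    using small_translated_ball by metis
  \<comment> \<open>Solves r^(-ps) m / 2 = k, so that the kernel bound on the ball times half its
    guaranteed volume is exactly k.\<close>
  define r where "r = (m / (2 * k)) powr (1 / (p * s))"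
  have r: "0 < r" using m(1) assms by (simp add: r_def)
  have ps: "0 < p * s" using p_pos s_pos by simp
  have rk: "r powr (- (p * s)) * m / 2 = k"
  proof -
    have "1 / (p * s) * (p * s) = 1" using p_pos s_pos by simp
    then have "r powr (p * s) = m / (2 * k)"
      using m(1) assms by (simp add: r_def powr_powr del: times_divide_eq_left)
    then have "m = k * (2 * r powr (p * s))" using m(1) assms by (simp add: field_simps)
    moreover have "r powr (- (p * s)) * r powr (p * s) = 1"
      using r by (simp flip: powr_add)
    ultimately show ?thesis by (simp add: mult.left_commute)
  qed
  \<comment> \<open>Half of the guaranteed volume of the ball: if E has measure below c, at least c
    of the ball remains outside E.\<close>
  define c where "c = r ^ Q * m / 2"
  have c: "0 < c" using r m(1) by (simp add: c_def)
  define N where "N = r powr (- (real Q + p * s))"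
  have Nc: "N * c = k"
  proof -
    have "N = r powr (- real Q) * r powr (- (p * s))" by (simp add: N_def flip: powr_add)
    moreover have "r powr (- real Q) * r ^ Q = 1"
      using r by (simp add: powr_minus powr_realpow)
    ultimately have "N * c = (r powr (- real Q) * r ^ Q) * (r powr (- (p * s)) * m / 2)"
      by (simp add: c_def)
    then show ?thesis using rk \<open>r powr (- real Q) * r ^ Q = 1\<close> by simp
  qed
  have "k * mass v \<le> energy v"
    if v: "v \<in> XX" and E[measurable]: "E \<in> sets lebesgue"
      and v0: "AE x in lebesgue. x \<notin> E \<longrightarrow> v x = 0" and Ec: "emeasure lebesgue E < ennreal c" for v E
  proof -
    note [measurable] = X0_measurable[OF v]
    have "ennreal (k * mass v) = ennreal k * (\<integral>\<^sup>+x. ennreal (\<bar>v x\<bar> powr p * indicator \<Omega> x) \<partial>lebesgue)"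
      unfolding nn_integral_mass[OF v] using assms by (simp add: ennreal_mult mass_nonneg)
    also have "\<dots> = (\<integral>\<^sup>+x. ennreal k * ennreal (\<bar>v x\<bar> powr p * indicator \<Omega> x) \<partial>lebesgue)"
      by (rule nn_integral_cmult[symmetric]) measurable
    also have "\<dots> \<le> (\<integral>\<^sup>+x. \<integral>\<^sup>+y. ennreal (1 / K x y) * ennreal (\<bar>difference v (x, y)\<bar> powr p) \<partial>lebesgue \<partial>lebesgue)"
    proof (rule nn_integral_mono)
      fix x
      obtain Y where Y[measurable]: "Y \<in> sets lebesgue" and Ym: "ennreal (r ^ Q * m) \<le> emeasure lebesgue Y"
        and YK: "\<And>y. y \<in> Y \<Longrightarrow> 0 < K x y" "\<And>y. y \<in> Y \<Longrightarrow> K x y \<le> r powr (real Q + p * s)"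
        using m(2)[OF r, of x] by blast
      have "ennreal c + ennreal c = ennreal (r ^ Q * m)"
        using c by (simp add: c_def mult.commute flip: ennreal_plus)
      also have "ennreal (r ^ Q * m) \<le> emeasure lebesgue (Y - E) + emeasure lebesgue E"
      proof -
        have "emeasure lebesgue Y \<le> emeasure lebesgue ((Y - E) \<union> E)" by (rule emeasure_mono) auto
        also have "\<dots> \<le> emeasure lebesgue (Y - E) + emeasure lebesgue E" by (rule emeasure_subadditive) auto
        finally show ?thesis using Ym by simp
      qed
      also note add_left_mono[OF less_imp_le[OF Ec], of "emeasure lebesgue (Y - E)"]
      finally have YE: "ennreal c \<le> emeasure lebesgue (Y - E)"
        by (rule ennreal_add_right_cancel_le)
      have "ennreal k * ennreal (\<bar>v x\<bar> powr p * indicator \<Omega> x) \<le> ennreal (N * \<bar>v x\<bar> powr p) * ennreal c"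
      proof -
        have "k * (\<bar>v x\<bar> powr p * indicator \<Omega> x) \<le> k * (\<bar>v x\<bar> powr p * 1)"
          using assms by (intro mult_left_mono) (auto simp: indicator_def)
        also have "\<dots> = (N * \<bar>v x\<bar> powr p) * c" using Nc by (simp add: mult.commute mult.left_commute)
        finally show ?thesis
          using assms c by (simp add: N_def flip: ennreal_mult)
      qed
      also have "\<dots> \<le> ennreal (N * \<bar>v x\<bar> powr p) * emeasure lebesgue (Y - E)"
        using YE by (rule mult_left_mono) simp
      also have "\<dots> = (\<integral>\<^sup>+y. ennreal (N * \<bar>v x\<bar> powr p) * indicator (Y - E) y \<partial>lebesgue)"
        by (rule nn_integral_cmult_indicator[symmetric]) simp
      also have "\<dots> \<le> (\<integral>\<^sup>+y. ennreal (1 / K x y) * ennreal (\<bar>difference v (x, y)\<bar> powr p) \<partial>lebesgue)"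
      proof (rule nn_integral_mono_AE)
        show "AE y in lebesgue. ennreal (N * \<bar>v x\<bar> powr p) * indicator (Y - E) y \<le>
            ennreal (1 / K x y) * ennreal (\<bar>difference v (x, y)\<bar> powr p)"
          using v0
        proof eventually_elim
          case (elim y)
          show ?case
          proof (cases "y \<in> Y - E")
            case True
            then have "v y = 0" using elim by auto
            have "N = 1 / (r powr (real Q + p * s))"
              unfolding N_def by (simp only: powr_minus inverse_eq_divide)
            also have "\<dots> \<le> 1 / K x y"
              using YK[of y] True r by (intro divide_left_mono mult_pos_pos) auto
            finally have "N * \<bar>v x\<bar> powr p \<le> 1 / K x y * \<bar>v x\<bar> powr p"
              by (rule mult_right_mono) simp
            then show ?thesis
              using True \<open>v y = 0\<close> K_nonneg[of x y]
              by (simp add: difference_def ennreal_mult[symmetric] ennreal_leI)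
          qed simp
        qed
      qed
      finally show "ennreal k * ennreal (\<bar>v x\<bar> powr p * indicator \<Omega> x) \<le>
          (\<integral>\<^sup>+y. ennreal (1 / K x y) * ennreal (\<bar>difference v (x, y)\<bar> powr p) \<partial>lebesgue)" .
    qed
    also have "\<dots> = ennreal (energy v)"
      unfolding nn_integral_energy[OF v, symmetric] by (rule nn_integral_MK[symmetric]) measurable
    finally show ?thesis by (simp add: energy_nonneg)
  qed
  then show ?thesis using that c by blast
qed

text \<open>Suppose the superlevel set is too small. The excess v of w over the level h is supported
  there, so Faber-Krahn gives it energy at least k mass v. Its energy is at most that of w, and it
  carries a fixed fraction of the mass of w because the part below h is light; for large k this is a
  contradiction.\<close>

lemma non_concentration:
  assumes L: "0 < L"
  shows "\<exists>\<tau>>0. \<exists>c>0. \<forall>w\<in>XX. (\<forall>x. 0 \<le> w x) \<longrightarrow> 0 < mass w \<longrightarrow> energy w \<le> L * mass w \<longrightarrow>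
       ennreal c \<le> emeasure lebesgue {x \<in> \<Omega>. \<tau> * mass w powr (1 / p) < w x}"
proof -
  define V where "V = measure lebesgue \<Omega>"
  have V: "0 \<le> V" by (simp add: V_def)
  \<comment> \<open>Makes the constant function h on \<Omega>, with the factor 2^p from splitting w,
    account for at most half the mass of w; V + 1 avoids division by 0.\<close>
  define \<tau> where "\<tau> = (1 / (2 * 2 powr p * (V + 1))) powr (1 / p)"
  have \<tau>: "0 < \<tau>" using V by (simp add: \<tau>_def)
  have \<tau>p: "2 powr p * (\<tau> powr p * V) \<le> 1 / 2"
  proof -
    have "\<tau> powr p = 1 / (2 * 2 powr p * (V + 1))"
      unfolding \<tau>_def using V by (intro powr_inverse_p) simp
    then have "2 powr p * (\<tau> powr p * V) = 1 / 2 * (V / (V + 1))"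
      by simp
    also have "V / (V + 1) \<le> 1" using V by simp
    finally show ?thesis by simp
  qed
  \<comment> \<open>One more than the ratio of energy to mass that the truncated function could
    have.\<close>
  define k where "k = 2 * 2 powr p * L + 1"
  have k: "0 < k" using L by (simp add: k_def add_pos_pos)
  obtain c where c: "0 < c" "\<And>v E. v \<in> XX \<Longrightarrow> E \<in> sets lebesgue \<Longrightarrow> (AE x in lebesgue. x \<notin> E \<longrightarrow> v x = 0) \<Longrightarrow>
       emeasure lebesgue E < ennreal c \<Longrightarrow> k * mass v \<le> energy v"
    using Faber_Krahn[OF k] by blast
  have "ennreal c \<le> emeasure lebesgue {x \<in> \<Omega>. \<tau> * mass w powr (1 / p) < w x}"
    if w: "w \<in> XX" "\<And>x. 0 \<le> w x" "0 < mass w" "energy w \<le> L * mass w" for w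
  proof (rule ccontr)
    define h where "h = \<tau> * mass w powr (1 / p)"
    define E where "E = {x \<in> \<Omega>. h < w x}"
    assume "\<not> ennreal c \<le> emeasure lebesgue {x \<in> \<Omega>. \<tau> * mass w powr (1 / p) < w x}"
    then have Ec: "emeasure lebesgue E < ennreal c" by (simp only: E_def h_def not_le)
    have h: "0 < h" using \<tau> w(3) by (simp add: h_def)
    have hp: "h powr p = \<tau> powr p * mass w"
      using \<tau> w(3) p_pos by (simp add: h_def powr_mult powr_powr)
    note [measurable] = X0_measurable[OF w(1)]
    have Em: "E \<in> sets lebesgue"
    proof -
      have "{x \<in> space lebesgue. x \<in> \<Omega> \<and> h < w x} \<in> sets lebesgue" by measurable
      then show ?thesis by (simp add: E_def)
    qed
    define v where "v x = max (w x - h) 0" for x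
    have lip: "\<bar>max (x - h) 0 - max (y - h) 0\<bar> \<le> 1 * \<bar>x - y\<bar>" for x y by (auto simp: max_def)
    have vX: "v \<in> XX" unfolding v_def[abs_def] using h by (intro X0_lipschitz[OF w(1) lip]) simp
    have "energy v \<le> 1 powr p * energy w"
    proof (rule fin_lipschitz(3)[OF X0_fin[OF w(1)] X0_measurable[OF vX]])
      show "\<bar>v x\<bar> \<le> 1 * \<bar>w x\<bar>" "\<bar>v x - v y\<bar> \<le> 1 * \<bar>w x - w y\<bar>" for x y
        using lip w(2)[of x] h by (auto simp: v_def)
    qed simp
    then have ev: "energy v \<le> L * mass w" using w(4) by simp
    have "AE x in lebesgue. x \<notin> E \<longrightarrow> v x = 0"
      using X0_zero_outside[OF w(1)] by eventually_elim (use h in \<open>auto simp: E_def v_def\<close>)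
    then have kv: "k * mass v \<le> energy v" using c(2)[OF vX Em _ Ec] by blast
    have mi: "integrable M\<Omega> (\<lambda>x. h powr p)" "(\<integral>x. h powr p \<partial>M\<Omega>) = h powr p * V"
    proof -
      have "set_integrable lebesgue \<Omega> (\<lambda>x. h powr p)"
        using fmeasurableD2[OF domain_lmeasurable]
        by (simp add: set_integrable_def less_top del: emeasure_completion)
      then show "integrable M\<Omega> (\<lambda>x. h powr p)" by (subst integrable_M\<Omega>_iff) auto
      show "(\<integral>x. h powr p \<partial>M\<Omega>) = h powr p * V"
        by (subst integral_M\<Omega>) (auto simp: set_lebesgue_integral_def V_def mult.commute)
    qed
    have i: "integrable M\<Omega> (\<lambda>x. \<bar>w x\<bar> powr p)" "integrable M\<Omega> (\<lambda>x. \<bar>v x\<bar> powr p)"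
      using X0_Lp(1)[OF w(1)] X0_Lp(1)[OF vX] by (auto simp: in_Lp_def)
    have "mass w \<le> (\<integral>x. 2 powr p * (\<bar>v x\<bar> powr p + h powr p) \<partial>M\<Omega>)"
      unfolding mass_def
    proof (rule integral_mono)
      fix x
      have "\<bar>w x\<bar> powr p \<le> \<bar>v x + h\<bar> powr p"
        using w(2)[of x] h p_pos by (intro powr_mono2) (auto simp: v_def)
      also have "\<dots> \<le> 2 powr p * (\<bar>v x\<bar> powr p + h powr p)"
        using abs_add_powr_le[OF p_pos(2), of "v x" h] h by simp
      finally show "\<bar>w x\<bar> powr p \<le> 2 powr p * (\<bar>v x\<bar> powr p + h powr p)" .
    qed (use i mi in auto)
    also have "\<dots> = 2 powr p * (mass v + h powr p * V)"
      using i(2) mi by (simp add: mass_def[of v])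
    also have "\<dots> = 2 powr p * mass v + 2 powr p * (\<tau> powr p * V) * mass w"
      unfolding hp by (simp add: algebra_simps)
    also have "\<dots> \<le> 2 powr p * mass v + 1 / 2 * mass w"
      using \<tau>p w(3) by (intro add_left_mono mult_right_mono) auto
    finally have mv: "mass w \<le> 2 * 2 powr p * mass v" by simp
    then have v0: "0 < mass v" using w(3) mass_nonneg[of v] by (cases "mass v = 0") auto
    have "k * mass v \<le> L * (2 * 2 powr p * mass v)"
      using kv ev mult_left_mono[OF mv, of L] L by linarith
    then have "k \<le> 2 * 2 powr p * L" using v0 by (simp add: algebra_simps)
    then show False by (simp add: k_def)
  qed
  then show ?thesis using \<tau> c(1) by (intro exI[of _ \<tau>] exI[of _ c] conjI ballI impI) blast+
qed

lemma K_bounded_on_domain: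
  obtains B where "0 < B" "\<And>x y. x \<in> \<Omega> \<Longrightarrow> y \<in> \<Omega> \<Longrightarrow> K x y \<le> B"
proof -
  have "compact ((\<lambda>z. K (fst z) (snd z)) ` (closure \<Omega> \<times> closure \<Omega>))"
    using bounded_domain continuous_on_subset[OF continuous_on_K]
    by (intro compact_continuous_image compact_Times) (auto simp: compact_closure)
  from compact_imp_bounded[OF this] obtain B where B: "0 < B"
    "\<forall>k\<in>(\<lambda>z. K (fst z) (snd z)) ` (closure \<Omega> \<times> closure \<Omega>). norm k \<le> B"
    unfolding bounded_pos by blast
  have "K x y \<le> B" if "x \<in> \<Omega>" "y \<in> \<Omega>" for x y
  proof -
    have "(x, y) \<in> closure \<Omega> \<times> closure \<Omega>" using that closure_subset[of \<Omega>] by blast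
    then have "norm (K x y) \<le> B" using B(2) by force
    then show ?thesis by simp
  qed
  then show ?thesis using that B(1) by blast
qed

text \<open>With b = - u y, this is the surplus (u x + b)^(p-1) b - b^p left when the equation is
  paired with the negative part and the energy density of that part is subtracted. Only pairs with u
  positive at the first point and negative at the second are counted.\<close>

definition interaction :: "(real ^ 'n \<Rightarrow> real) \<Rightarrow> (real ^ 'n) \<times> (real ^ 'n) \<Rightarrow> real" where
  "interaction u z = (if 0 < u (fst z) \<and> u (snd z) < 0
     then ((u (fst z) - u (snd z)) powr (p - 1) - (- u (snd z)) powr (p - 1)) * (- u (snd z)) else 0)"

lemma interaction_nonneg: "0 \<le> interaction u z"
proof (cases "0 < u (fst z) \<and> u (snd z) < 0")
  case True
  then have "(- u (snd z)) powr (p - 1) \<le> (u (fst z) - u (snd z)) powr (p - 1)"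
    using p_gt_1 by (intro powr_mono2) auto
  then show ?thesis using True by (simp add: interaction_def mult_nonneg_nonpos)
next
  case False
  then show ?thesis unfolding interaction_def by (subst if_not_P) auto
qed

text \<open>Pairs of equal sign give equality with no interaction, and pairs from positive to
  negative give equality by the choice of \<open>interaction\<close>. For pairs from negative to
  positive the surplus is nonnegative and is dropped.\<close>

lemma negative_part_pairing:
  "\<bar>difference (\<lambda>x. max (- u x) 0) z\<bar> powr p + interaction u z
     \<le> - (signed_power p (difference u z) * difference (\<lambda>x. max (- u x) 0) z)"
proof -
  obtain x y where z: "z = (x, y)" by force
  have pm: "t powr p = t * t powr (p - 1)" if "0 \<le> t" for t :: real
    using powr_mult_base[OF that, of "p - 1"] by simp
  consider "0 \<le> u x" "0 \<le> u y" | "u x \<le> 0" "u y \<le> 0" | "0 < u x" "u y < 0" | "u x < 0" "0 < u y"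
    by linarith
  then show ?thesis
  proof cases
    case 1
    then show ?thesis using p_pos by (simp add: z difference_def interaction_def)
  next
    case 2
    have "- (signed_power p (u x - u y) * (- u x - - u y)) = \<bar>u x - u y\<bar> powr p"
      using signed_power_mult_self[OF p_pos(3), of "u x - u y"] by (simp add: algebra_simps)
    moreover have "\<bar>- u x - - u y\<bar> = \<bar>u x - u y\<bar>" by simp
    ultimately show ?thesis using 2 by (simp add: z difference_def interaction_def max_absorb1)
  next
    case 3
    then have "signed_power p (u x - u y) = (u x - u y) powr (p - 1)"
      by (simp add: signed_power_eq)
    then show ?thesis
      using 3 pm[of "- u y"] by (simp add: z difference_def interaction_def max_def algebra_simps)
  next
    case 4
    then have s: "signed_power p (u x - u y) = - ((u y - u x) powr (p - 1))"
      by (simp add: signed_power_eq)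
    have "(- u x) powr (p - 1) \<le> (u y - u x) powr (p - 1)"
      using 4 p_gt_1 by (intro powr_mono2) auto
    then have "(- u x) * (- u x) powr (p - 1) \<le> (- u x) * (u y - u x) powr (p - 1)"
      using 4 by (intro mult_left_mono) auto
    then show ?thesis
      using 4 pm[of "- u x"] s by (simp add: z difference_def interaction_def max_def algebra_simps)
  qed
qed

text \<open>The equation is tested with the negative part; pointwise u and its negative part pair to
  minus the p-th power, which accounts for the signs. The surplus over the Rayleigh bound is then
  available for the interaction.\<close>

lemma negative_part_energy:
  assumes u: "eigenfunction G s p \<Omega> \<nu> u"
  defines "um \<equiv> \<lambda>x. max (- u x) 0"
  shows "um \<in> XX" "integrable MK (interaction u)"
    "energy um + integral\<^sup>L MK (interaction u) \<le> \<nu> * mass um"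
proof -
  note uX = eigenfunctionD(2)[OF u]
  note [measurable] = X0_measurable[OF uX]
  show umX: "um \<in> XX"
    unfolding um_def using X0_max[OF X0_cmult[OF uX, of "-1"] zero_in_X0[OF uX]] by simp
  note [measurable] = X0_measurable[OF umX]
  have i: "integrable MK (\<lambda>z. signed_power p (difference u z) * difference um z)"
    by (intro integrable_signed_power_mult[OF p_gt_1] X0_Lp(2)[OF uX] X0_Lp(2)[OF umX])
  have i2: "integrable MK (\<lambda>z. \<bar>difference um z\<bar> powr p)"
    using X0_Lp(2)[OF umX] by (simp add: in_Lp_def)
  have le: "\<bar>difference um z\<bar> powr p + interaction u z \<le> - (signed_power p (difference u z) * difference um z)" for z
    unfolding um_def by (rule negative_part_pairing)
  have [measurable]: "interaction u \<in> borel_measurable MK"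
    unfolding interaction_def[abs_def] by measurable
  show i3: "integrable MK (interaction u)"
  proof (rule Bochner_Integration.integrable_bound[OF i])
    show "AE z in MK. norm (interaction u z) \<le> norm (signed_power p (difference u z) * difference um z)"
    proof (rule AE_I2)
      fix z
      have "0 \<le> \<bar>difference um z\<bar> powr p" by simp
      then show "norm (interaction u z) \<le> norm (signed_power p (difference u z) * difference um z)"
        using le[of z] interaction_nonneg[of u z] unfolding real_norm_def by linarith
    qed
  qed measurable
  have "energy um + integral\<^sup>L MK (interaction u) = (\<integral>z. \<bar>difference um z\<bar> powr p + interaction u z \<partial>MK)"
    unfolding energy_def using i2 i3 by simp
  also have "\<dots> \<le> (\<integral>z. - (signed_power p (difference u z) * difference um z) \<partial>MK)"
    using i i2 i3 le by (intro integral_mono) auto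
  also have "\<dots> = - energy_form u um"
    using i by (simp add: energy_form_def)
  also have "\<dots> = - (\<nu> * mass_form u um)"
    using weak_solution_X0[OF eigenfunctionD(1)[OF u] umX] by simp
  also have "mass_form u um = (\<integral>x. - (\<bar>um x\<bar> powr p) \<partial>M\<Omega>)"
    unfolding mass_form_def
  proof (rule Bochner_Integration.integral_cong[OF refl])
    fix x
    show "signed_power p (u x) * um x = - (\<bar>um x\<bar> powr p)"
    proof (cases "u x < 0")
      case True
      then show ?thesis
        using signed_power_mult_self[OF p_pos(3), of "u x"] by (simp add: um_def max_def)
    qed (use p_pos in \<open>simp add: um_def max_def\<close>)
  qed
  also have "\<dots> = - mass um" by (simp add: mass_def)
  finally show "energy um + integral\<^sup>L MK (interaction u) \<le> \<nu> * mass um" by simp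
qed

text \<open>Put b = - u y. The upper bound b \<le> M t makes u x at least (\<tau> / M) b, so passing
  from b to u x + b raises the (p-1)-th power by a fixed proportion.\<close>

lemma interaction_ge:
  assumes "0 < \<tau>" "\<tau> \<le> M" "0 < t" "\<tau> * t < u x" "\<tau> * t < - u y" "- u y \<le> M * t"
  shows "(\<tau> * t) powr p * ((1 + \<tau> / M) powr (p - 1) - 1) \<le> interaction u (x, y)"
proof -
  define b where "b = - u y"
  have tt: "0 < \<tau> * t" using assms by simp
  have b: "0 < b" "\<tau> * t \<le> b" "b \<le> M * t" using assms tt unfolding b_def by linarith+
  have M: "0 < M" using assms by linarith
  have "\<tau> / M * b \<le> \<tau> / M * (M * t)" using b assms M by (intro mult_left_mono) auto
  then have "\<tau> / M * b \<le> u x" using M assms(4) by simp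
  then have "((1 + \<tau> / M) * b) powr (p - 1) \<le> (u x + b) powr (p - 1)"
    using b assms M p_gt_1 by (intro powr_mono2) (auto simp: algebra_simps)
  then have "(1 + \<tau> / M) powr (p - 1) * b powr (p - 1) \<le> (u x + b) powr (p - 1)"
    using b assms M by (simp add: powr_mult)
  then have 1: "((1 + \<tau> / M) powr (p - 1) - 1) * b powr (p - 1) \<le> (u x + b) powr (p - 1) - b powr (p - 1)"
    by (simp add: algebra_simps)
  have q: "0 \<le> (1 + \<tau> / M) powr (p - 1) - 1"
    using assms M p_gt_1 by (simp add: ge_one_powr_ge_zero)
  have "(\<tau> * t) powr p * ((1 + \<tau> / M) powr (p - 1) - 1) \<le> b powr p * ((1 + \<tau> / M) powr (p - 1) - 1)"
    using q b tt p_pos by (intro mult_right_mono powr_mono2) auto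
  also have "\<dots> = (((1 + \<tau> / M) powr (p - 1) - 1) * b powr (p - 1)) * b"
    using powr_mult_base[of b "p - 1"] b by (simp add: mult.commute mult.left_commute)
  also have "\<dots> \<le> ((u x + b) powr (p - 1) - b powr (p - 1)) * b"
    using 1 b by (intro mult_right_mono) auto
  also have "\<dots> = interaction u (x, y)"
    using b(1) assms(4) tt by (simp add: interaction_def b_def)
  finally show ?thesis .
qed

text \<open>The smaller of the two parts of a sign-changing eigenfunction is tested against. Both parts
  exceed a fixed multiple of its \<open>L\<^sup>p\<close> norm on sets of measure bounded below, and their interaction
  there is a fixed fraction of its mass.\<close>

lemma spectral_gap:
  obtains \<epsilon> where "0 < \<epsilon>"
    "\<And>\<nu> u. eigenfunction G s p \<Omega> \<nu> u \<Longrightarrow> \<nu> \<le> \<Lambda> + 1 \<Longrightarrow> 0 < mass (\<lambda>x. max (- u x) 0) \<Longrightarrow>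
       mass (\<lambda>x. max (- u x) 0) \<le> mass (\<lambda>x. max (u x) 0) \<Longrightarrow> \<Lambda> + \<epsilon> \<le> \<nu>"
proof -
  \<comment> \<open>A positive bound for every eigenvalue \<nu> \<le> \<Lambda> + 1, hence for the
    Rayleigh quotients of both parts.\<close>
  define L where "L = max 1 (\<Lambda> + 1)"
  have L: "0 < L" by (simp add: L_def)
  obtain \<tau> c where \<tau>: "0 < \<tau>" "0 < c" and
    "\<forall>w\<in>XX. (\<forall>x. 0 \<le> w x) \<longrightarrow> 0 < mass w \<longrightarrow> energy w \<le> L * mass w \<longrightarrow>
       ennreal c \<le> emeasure lebesgue {x \<in> \<Omega>. \<tau> * mass w powr (1 / p) < w x}"
    using non_concentration[OF L] by blast
  then have \<tau>c: "ennreal c \<le> emeasure lebesgue {x \<in> \<Omega>. \<tau> * mass w powr (1 / p) < w x}"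
    if "w \<in> XX" "\<And>x. 0 \<le> w x" "0 < mass w" "energy w \<le> L * mass w" for w
    using that by blast
  obtain B where B: "0 < B" "\<And>x y. x \<in> \<Omega> \<Longrightarrow> y \<in> \<Omega> \<Longrightarrow> K x y \<le> B"
    using K_bounded_on_domain by blast
  \<comment> \<open>By Chebyshev the negative part exceeds M t on a set of measure at most 1 / M^p
    \<le> c / 2. The maximum with \<tau> is for \<open>interaction_ge\<close>.\<close>
  define M where "M = max \<tau> ((2 / c) powr (1 / p))"
  have M: "0 < M" "\<tau> \<le> M" using \<tau> by (auto simp: M_def)
  have Mp: "1 / M powr p \<le> c / 2"
  proof -
    have "2 / c = ((2 / c) powr (1 / p)) powr p" using \<tau>(2) by (simp add: powr_inverse_p)
    also have "\<dots> \<le> M powr p" using p_pos by (intro powr_mono2) (auto simp: M_def)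
    finally show ?thesis using \<tau>(2) M by (simp add: field_simps)
  qed
  define \<kappa> where "\<kappa> = \<tau> powr p * ((1 + \<tau> / M) powr (p - 1) - 1)"
  have \<kappa>: "0 < \<kappa>"
    using \<tau>(1) M(1) p_gt_1 by (simp add: \<kappa>_def gr_one_powr)
  \<comment> \<open>The lower bound \<kappa> of the interaction relative to t^p, the lower bound 1 /
    B of the kernel on \<Omega>, and the volumes c and c / 2 of the two sets.\<close>
  define \<epsilon> where "\<epsilon> = \<kappa> / B * c * (c / 2)"
  have \<epsilon>: "0 < \<epsilon>" using \<kappa> B \<tau> by (simp add: \<epsilon>_def)
  have "\<Lambda> + \<epsilon> \<le> \<nu>"
    if u: "eigenfunction G s p \<Omega> \<nu> u" and \<nu>: "\<nu> \<le> \<Lambda> + 1"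
      and m0: "0 < mass (\<lambda>x. max (- u x) 0)" and mle: "mass (\<lambda>x. max (- u x) 0) \<le> mass (\<lambda>x. max (u x) 0)" for \<nu> u
  proof -
    define um up where "um x = max (- u x) 0" and "up x = max (u x) 0" for x
    have um: "um \<in> XX" "energy um + integral\<^sup>L MK (interaction u) \<le> \<nu> * mass um"
      and ii: "integrable MK (interaction u)"
      using negative_part_energy[OF u] by (auto simp: um_def[abs_def])
    have up: "up \<in> XX" "energy up + integral\<^sup>L MK (interaction (\<lambda>x. - u x)) \<le> \<nu> * mass up"
      using negative_part_energy[OF eigenfunction_minus[OF u]] by (auto simp: up_def[abs_def])
    note uX = eigenfunctionD(2)[OF u]
    note [measurable] = X0_measurable[OF uX]
    have m: "0 < mass um" "mass um \<le> mass up" using m0 mle by (auto simp: um_def[abs_def] up_def[abs_def])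
    have "\<nu> * mass um \<le> L * mass um" "\<nu> * mass up \<le> L * mass up"
      using \<nu> by (auto intro!: mult_right_mono mass_nonneg simp: L_def)
    moreover have "0 \<le> integral\<^sup>L MK (interaction w)" for w
      using interaction_nonneg by simp
    ultimately have e: "energy um \<le> L * mass um" "energy up \<le> L * mass up"
      using um(2) up(2) by (smt (verit))+
    define t where "t = mass um powr (1 / p)"
    have t: "0 < t" "t powr p = mass um" using m(1) by (simp_all add: t_def powr_inverse_p)
    define P where "P = {x \<in> \<Omega>. \<tau> * t < u x}"
    define N where "N = {x \<in> \<Omega>. \<tau> * t < - u x}"
    define N' where "N' = {x \<in> \<Omega>. \<tau> * t < - u x \<and> - u x \<le> M * t}"
    define H where "H = {x \<in> \<Omega>. M * t < - u x}"
    have "{x \<in> space lebesgue. x \<in> \<Omega> \<and> \<tau> * t < u x} \<in> sets lebesgue"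
      "{x \<in> space lebesgue. x \<in> \<Omega> \<and> \<tau> * t < - u x} \<in> sets lebesgue"
      "{x \<in> space lebesgue. x \<in> \<Omega> \<and> \<tau> * t < - u x \<and> - u x \<le> M * t} \<in> sets lebesgue"
      "{x \<in> space lebesgue. x \<in> \<Omega> \<and> M * t < - u x} \<in> sets lebesgue"
      by measurable
    then have [measurable]: "P \<in> sets lebesgue" "N \<in> sets lebesgue" "N' \<in> sets lebesgue" "H \<in> sets lebesgue"
      by (simp_all add: P_def N_def N'_def H_def)
    have \<tau>t: "0 < \<tau> * t" using \<tau> t by simp
    have cN: "ennreal c \<le> emeasure lebesgue N"
    proof -
      have "{x \<in> \<Omega>. \<tau> * mass um powr (1 / p) < um x} = N"
        using \<tau>t by (auto simp: N_def um_def t_def)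
      then show ?thesis using \<tau>c[OF um(1) _ m(1) e(1)] by (simp add: um_def)
    qed
    \<comment> \<open>Here the comparison of the masses is used: t comes from the smaller part, so
      the level \<tau> t is not above the one at which non-concentration holds for the positive
      part.\<close>
    have cP: "ennreal c \<le> emeasure lebesgue P"
    proof -
      have "t \<le> mass up powr (1 / p)"
        unfolding t_def using m p_pos by (intro powr_mono2) auto
      then have "\<tau> * t \<le> \<tau> * mass up powr (1 / p)" using \<tau>(1) by simp
      then have "{x \<in> \<Omega>. \<tau> * mass up powr (1 / p) < up x} \<subseteq> P"
        using \<tau>t by (auto simp: P_def up_def)
      then have "emeasure lebesgue {x \<in> \<Omega>. \<tau> * mass up powr (1 / p) < up x} \<le> emeasure lebesgue P"
        by (rule emeasure_mono) measurable
      moreover have "ennreal c \<le> emeasure lebesgue {x \<in> \<Omega>. \<tau> * mass up powr (1 / p) < up x}"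
        using m e by (intro \<tau>c[OF up(1)]) (auto simp: up_def)
      ultimately show ?thesis by (rule order_trans[rotated])
    qed
    have cH: "emeasure lebesgue H \<le> ennreal (c / 2)"
    proof -
      have "ennreal ((M * t) powr p) * emeasure lebesgue H = (\<integral>\<^sup>+x. ennreal ((M * t) powr p) * indicator H x \<partial>lebesgue)"
        by (rule nn_integral_cmult_indicator[symmetric]) measurable
      also have "\<dots> \<le> (\<integral>\<^sup>+x. ennreal (\<bar>um x\<bar> powr p * indicator \<Omega> x) \<partial>lebesgue)"
      proof (rule nn_integral_mono)
        fix x
        show "ennreal ((M * t) powr p) * indicator H x \<le> ennreal (\<bar>um x\<bar> powr p * indicator \<Omega> x)"
          using M t p_pos by (auto simp: indicator_def H_def um_def intro!: ennreal_leI powr_mono2)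
      qed
      also have "\<dots> = ennreal (t powr p)" using nn_integral_mass[OF um(1)] t by simp
      finally have le: "ennreal (M powr p * t powr p) * emeasure lebesgue H \<le> ennreal (t powr p)"
        using M t by (simp add: powr_mult)
      show ?thesis
      proof (cases "emeasure lebesgue H")
        case (real h)
        then have "M powr p * t powr p * h \<le> t powr p"
          using le by (simp add: ennreal_mult[symmetric])
        then have "t powr p * (M powr p * h) \<le> t powr p * 1" by (simp add: mult_ac)
        then have "M powr p * h \<le> 1" using t(1) by (subst (asm) mult_le_cancel_left_pos) auto
        then have "h \<le> 1 / M powr p" using M by (simp add: field_simps)
        then show ?thesis using real Mp by (simp add: ennreal_leI)
      next
        case top
        moreover have "ennreal (M powr p * t powr p) \<noteq> 0" using M t(1) by simp
        ultimately show ?thesis using le by (simp add: ennreal_mult_top top_unique del: ennreal_eq_0_iff emeasure_completion)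
      qed
    qed
    have cN': "ennreal (c / 2) \<le> emeasure lebesgue N'"
    proof -
      have "ennreal (c / 2) + ennreal (c / 2) = ennreal c" using \<tau>(2) by (simp flip: ennreal_plus)
      also note cN
      also have "emeasure lebesgue N \<le> emeasure lebesgue (N' \<union> H)"
        by (rule emeasure_mono) (auto simp: N_def N'_def H_def)
      also have "\<dots> \<le> emeasure lebesgue N' + emeasure lebesgue H" by (rule emeasure_subadditive) measurable
      also note add_left_mono[OF cH, of "emeasure lebesgue N'"]
      finally show ?thesis
        by (rule ennreal_add_right_cancel_le)
    qed
    have "ennreal (\<epsilon> * t powr p) = ennreal (\<kappa> / B * t powr p) * (ennreal (c / 2) * ennreal c)"
      using \<kappa> B(1) \<tau>(2) by (simp add: \<epsilon>_def mult_ac flip: ennreal_mult)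
    also have "\<dots> \<le> ennreal (\<kappa> / B * t powr p) * (emeasure lebesgue N' * emeasure lebesgue P)"
      by (intro mult_left_mono mult_mono cN' cP) auto
    also have "\<dots> = (\<integral>\<^sup>+x. (\<integral>\<^sup>+y. ennreal (\<kappa> / B * t powr p) * indicator N' y \<partial>lebesgue) * indicator P x \<partial>lebesgue)"
      unfolding nn_integral_cmult_indicator[OF \<open>N' \<in> sets lebesgue\<close>]
        nn_integral_cmult_indicator[OF \<open>P \<in> sets lebesgue\<close>]
      by (rule mult.assoc[symmetric])
    also have "\<dots> \<le> (\<integral>\<^sup>+x. \<integral>\<^sup>+y. ennreal (1 / K x y) * ennreal (interaction u (x, y)) \<partial>lebesgue \<partial>lebesgue)"
    proof (rule nn_integral_mono)
      fix x
      show "(\<integral>\<^sup>+y. ennreal (\<kappa> / B * t powr p) * indicator N' y \<partial>lebesgue) * indicator P x \<le>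
          (\<integral>\<^sup>+y. ennreal (1 / K x y) * ennreal (interaction u (x, y)) \<partial>lebesgue)"
      proof (cases "x \<in> P")
        case True
        have "(\<integral>\<^sup>+y. ennreal (\<kappa> / B * t powr p) * indicator N' y \<partial>lebesgue) \<le>
            (\<integral>\<^sup>+y. ennreal (1 / K x y) * ennreal (interaction u (x, y)) \<partial>lebesgue)"
        proof (rule nn_integral_mono)
          fix y
          show "ennreal (\<kappa> / B * t powr p) * indicator N' y \<le> ennreal (1 / K x y) * ennreal (interaction u (x, y))"
          proof (cases "y \<in> N'")
            case y: True
            have "0 < u x" "u y < 0" using True y \<tau>t by (auto simp: P_def N'_def)
            then have K0: "0 < K x y" by (intro K_pos) auto
            have "\<kappa> * t powr p \<le> interaction u (x, y)"
              using interaction_ge[OF \<tau>(1) M(2) t(1), of u x y] True y \<tau>(1) t(1)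
              by (simp add: P_def N'_def \<kappa>_def powr_mult mult_ac)
            then have "1 / B * (\<kappa> * t powr p) \<le> 1 / K x y * interaction u (x, y)"
              using B K0 True y \<kappa> by (intro mult_mono divide_left_mono) (auto simp: P_def N'_def)
            then show ?thesis
              using y K0 by (simp add: ennreal_leI interaction_nonneg flip: ennreal_mult)
          qed simp
        qed
        then show ?thesis using True by simp
      qed simp
    qed
    also have "\<dots> = (\<integral>\<^sup>+z. ennreal (interaction u z) \<partial>MK)"
      unfolding interaction_def[abs_def] by (rule nn_integral_MK[symmetric]) measurable
    also have "\<dots> = ennreal (integral\<^sup>L MK (interaction u))"
      by (rule nn_integral_eq_integral[OF ii]) (simp add: interaction_nonneg)
    finally have "\<epsilon> * t powr p \<le> integral\<^sup>L MK (interaction u)"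
      using interaction_nonneg by (simp add: ennreal_le_iff)
    \<comment> \<open>Since t^p is the mass of the negative part, the factor cancels and a bound on
      \<nu> - \<Lambda> free of u remains.\<close>
    also have "\<dots> \<le> \<nu> * mass um - \<Lambda> * mass um"
      using um(2) first_eigenvalue_le[OF um(1)] by simp
    finally have "\<epsilon> * mass um \<le> (\<nu> - \<Lambda>) * mass um" using t by (simp add: left_diff_distrib)
    then show ?thesis using m(1) by simp
  qed
  then show ?thesis using that \<epsilon> by blast
qed

section \<open>Signs of eigenfunctions and isolation of the first eigenvalue\<close>

lemma constant_sign_AE:
  assumes "u \<in> XX" "constant_sign \<Omega> u"
  shows "(AE x in lebesgue. 0 \<le> u x) \<or> (AE x in lebesgue. 0 \<le> - u x)"
proof -
  have z: "AE x in lebesgue. x \<notin> \<Omega> \<longrightarrow> u x = 0" using X0_zero_outside[OF assms(1)] .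
  from assms(2) consider "AE x in lebesgue. x \<in> \<Omega> \<longrightarrow> 0 \<le> u x" | "AE x in lebesgue. x \<in> \<Omega> \<longrightarrow> u x \<le> 0"
    by (auto simp: constant_sign_def)
  then show ?thesis
  proof cases
    case 1
    with z have "AE x in lebesgue. 0 \<le> u x" by eventually_elim force
    then show ?thesis ..
  next
    case 2
    with z have "AE x in lebesgue. 0 \<le> - u x" by eventually_elim force
    then show ?thesis ..
  qed
qed

lemma constant_sign_first:
  assumes u: "eigenfunction G s p \<Omega> \<nu> u" and "constant_sign \<Omega> u"
  shows "\<nu> = \<Lambda>"
  using constant_sign_AE[OF eigenfunctionD(2)[OF u] assms(2)]
    nonneg_eigenfunction_first[OF u] nonneg_eigenfunction_first[OF eigenfunction_minus[OF u]] by blast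

lemma first_eigenfunction_sign:
  assumes "first_eigenfunction G s p \<Omega> \<phi>"
  shows "(AE x in lebesgue. 0 \<le> \<phi> x) \<and> (AE x in lebesgue. x \<in> \<Omega> \<longrightarrow> 0 < \<phi> x) \<or>
    (AE x in lebesgue. 0 \<le> - \<phi> x) \<and> (AE x in lebesgue. x \<in> \<Omega> \<longrightarrow> 0 < - \<phi> x)"
proof -
  have \<phi>: "eigenfunction G s p \<Omega> \<Lambda> \<phi>" using assms by (simp add: first_eigenfunction_def)
  have "(AE x in lebesgue. 0 \<le> \<phi> x) \<or> (AE x in lebesgue. 0 \<le> - \<phi> x)"
    using minimizer_constant_sign[OF eigenfunctionD(2,4)[OF \<phi>]] by auto
  then show ?thesis
    using nonneg_eigenfunction_positive[OF \<phi>] nonneg_eigenfunction_positive[OF eigenfunction_minus[OF \<phi>]] by blast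
qed

lemma first_eigenfunctions_proportional:
  assumes "first_eigenfunction G s p \<Omega> \<phi>" "first_eigenfunction G s p \<Omega> \<psi>"
  shows "\<exists>c. AE x in lebesgue. \<psi> x = c * \<phi> x"
proof -
  have \<phi>: "eigenfunction G s p \<Omega> \<Lambda> \<phi>" and \<psi>: "eigenfunction G s p \<Omega> \<Lambda> \<psi>"
    using assms by (auto simp: first_eigenfunction_def)
  have proportional: "\<exists>c. AE x in lebesgue. \<psi> x = c * f x"
    if "eigenfunction G s p \<Omega> \<Lambda> f" "AE x in lebesgue. 0 \<le> f x" "AE x in lebesgue. x \<in> \<Omega> \<longrightarrow> 0 < f x" for f
    using minimizers_proportional[OF eigenfunctionD(2,4)[OF that(1)] that(2) _ eigenfunctionD(2,4)[OF \<psi>] that(3)]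
      that(1) by (auto simp: eigenfunction_def)
  from first_eigenfunction_sign[OF assms(1)] show ?thesis
  proof
    assume "(AE x in lebesgue. 0 \<le> \<phi> x) \<and> (AE x in lebesgue. x \<in> \<Omega> \<longrightarrow> 0 < \<phi> x)"
    then show ?thesis using proportional[OF \<phi>] by blast
  next
    assume "(AE x in lebesgue. 0 \<le> - \<phi> x) \<and> (AE x in lebesgue. x \<in> \<Omega> \<longrightarrow> 0 < - \<phi> x)"
    then obtain c where "AE x in lebesgue. \<psi> x = c * - \<phi> x"
      using proportional[OF eigenfunction_minus[OF \<phi>]] by blast
    then show ?thesis by (intro exI[of _ "- c"]) simp
  qed
qed

lemma sign_changing_iff:
  assumes "u \<in> XX" shows "sign_changing \<Omega> u \<longleftrightarrow> \<not> constant_sign \<Omega> u"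
proof -
  note [measurable] = X0_measurable[OF assms]
  have eq: "(AE x in lebesgue. x \<in> \<Omega> \<longrightarrow> \<not> P x) \<longleftrightarrow> emeasure lebesgue {x \<in> \<Omega>. P x} = 0"
    if "{x \<in> space lebesgue. x \<in> \<Omega> \<and> P x} \<in> sets lebesgue" for P
    using that by (subst AE_iff_measurable[OF _ refl]) (auto simp del: emeasure_completion)
  have "{x \<in> space lebesgue. x \<in> \<Omega> \<and> u x < 0} \<in> sets lebesgue"
    "{x \<in> space lebesgue. x \<in> \<Omega> \<and> 0 < u x} \<in> sets lebesgue"
    by measurable
  from eq[OF this(1)] eq[OF this(2)] show ?thesis
    by (simp add: sign_changing_def constant_sign_def not_less zero_less_iff_neq_zero conj_commute
        del: emeasure_completion)
qed

text \<open>An eigenfunction with \<nu> \<noteq> \<Lambda> has two nontrivial parts, as a signed one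
  would belong to \<Lambda>. Passing to - u if necessary makes the negative part the smaller one, as
  the gap estimate requires.\<close>

lemma first_eigenvalue_isolated:
  obtains \<epsilon> where "0 < \<epsilon>" "\<And>\<nu>. \<nu> \<noteq> \<Lambda> \<Longrightarrow> \<bar>\<nu> - \<Lambda>\<bar> < \<epsilon> \<Longrightarrow> \<not> eigenvalue G s p \<Omega> \<nu>"
proof -
  obtain e where e: "0 < e"
    "\<And>\<nu> u. eigenfunction G s p \<Omega> \<nu> u \<Longrightarrow> \<nu> \<le> \<Lambda> + 1 \<Longrightarrow> 0 < mass (\<lambda>x. max (- u x) 0) \<Longrightarrow>
       mass (\<lambda>x. max (- u x) 0) \<le> mass (\<lambda>x. max (u x) 0) \<Longrightarrow> \<Lambda> + e \<le> \<nu>"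
    using spectral_gap by blast
  \<comment> \<open>The bound 1 in the minimum ensures \<nu> \<le> \<Lambda> + 1, the range in which
    the gap constant is uniform.\<close>
  have "\<not> eigenvalue G s p \<Omega> \<nu>" if \<nu>: "\<nu> \<noteq> \<Lambda>" "\<bar>\<nu> - \<Lambda>\<bar> < min 1 e" for \<nu>
  proof
    assume "eigenvalue G s p \<Omega> \<nu>"
    then obtain u where u: "eigenfunction G s p \<Omega> \<nu> u" by (auto simp: eigenvalue_def)
    have pos: "0 < mass (\<lambda>x. max (- w x) 0)" if w: "eigenfunction G s p \<Omega> \<nu> w" for w
    proof (rule ccontr)
      assume "\<not> 0 < mass (\<lambda>x. max (- w x) 0)"
      then have "mass (\<lambda>x. max (- w x) 0) = 0" using mass_nonneg[of "\<lambda>x. max (- w x) 0"] by linarith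
      then have "AE x in lebesgue. max (- w x) 0 = 0"
        using mass_eq_0_iff[OF negative_part_energy(1)[OF w]] by blast
      then have "AE x in lebesgue. 0 \<le> w x" by eventually_elim (simp add: max_def split: if_splits)
      then show False using nonneg_eigenfunction_first[OF w] \<nu>(1) by blast
    qed
    have "\<Lambda> + e \<le> \<nu>"
    proof (cases "mass (\<lambda>x. max (- u x) 0) \<le> mass (\<lambda>x. max (u x) 0)")
      case True
      then show ?thesis using e(2)[OF u _ pos[OF u]] \<nu>(2) by auto
    next
      case False
      then show ?thesis
        using e(2)[OF eigenfunction_minus[OF u] _ pos[OF eigenfunction_minus[OF u]]] \<nu>(2) by auto
    qed
    then show False using \<nu>(2) by auto
  qed
  then show ?thesis using that[of "min 1 e"] e(1) by auto
qed

end

theorem theorem1p2: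
  fixes G :: "('n::finite) graded_group" and s p :: real and \<Omega> :: "(real ^ 'n) set"
  assumes "0 < s" "s < 1" "1 < p"
    and "stratified_lie_group G"
    and "homogeneous_quasi_norm G"
    and "s * p < real (homogeneous_dim G)"
    and "open \<Omega>" "connected \<Omega>" "\<Omega> \<noteq> {}" "bounded \<Omega>"
  shows
    "(\<forall>\<phi>. first_eigenfunction G s p \<Omega> \<phi> \<longrightarrow>
        (AE x in lebesgue. x \<in> \<Omega> \<longrightarrow> \<phi> x > 0) \<or> (AE x in lebesgue. x \<in> \<Omega> \<longrightarrow> - \<phi> x > 0)) \<and>
     ((\<forall>\<phi> \<psi>. first_eigenfunction G s p \<Omega> \<phi> \<and> first_eigenfunction G s p \<Omega> \<psi> \<longrightarrow>
         (\<exists>c. AE x in lebesgue. \<psi> x = c * \<phi> x)) \<and>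
      (\<forall>\<phi> \<nu> u. first_eigenfunction G s p \<Omega> \<phi> \<and> eigenfunction G s p \<Omega> \<nu> u \<and> constant_sign \<Omega> u \<longrightarrow>
         (\<exists>c. AE x in lebesgue. u x = c * \<phi> x)) \<and>
      (\<forall>\<nu> u. first_eigenvalue G s p \<Omega> < \<nu> \<and> eigenfunction G s p \<Omega> \<nu> u \<longrightarrow> sign_changing \<Omega> u)) \<and>
     (\<exists>\<epsilon>>0. \<forall>\<nu>. \<nu> \<noteq> first_eigenvalue G s p \<Omega> \<and> \<bar>\<nu> - first_eigenvalue G s p \<Omega>\<bar> < \<epsilon> \<longrightarrow>
        \<not> eigenvalue G s p \<Omega> \<nu>)"
proof -
  interpret fractional_eigenproblem G s p \<Omega>
    by (rule fractional_eigenproblem.intro) fact+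
  have simple: "\<exists>c. AE x in lebesgue. u x = c * \<phi> x"
    if "first_eigenfunction G s p \<Omega> \<phi>" "eigenfunction G s p \<Omega> \<nu> u" "constant_sign \<Omega> u" for \<phi> \<nu> u
    using first_eigenfunctions_proportional[OF that(1), of u] constant_sign_first[OF that(2,3)] that(2)
    by (simp add: first_eigenfunction_def)
  have changing: "sign_changing \<Omega> u"
    if "first_eigenvalue G s p \<Omega> < \<nu>" "eigenfunction G s p \<Omega> \<nu> u" for \<nu> u
    using constant_sign_first[OF that(2)] sign_changing_iff[OF eigenfunctionD(2)[OF that(2)]] that(1)
    by auto
  obtain \<epsilon> where "0 < \<epsilon>" "\<And>\<nu>. \<nu> \<noteq> first_eigenvalue G s p \<Omega> \<Longrightarrow>
      \<bar>\<nu> - first_eigenvalue G s p \<Omega>\<bar> < \<epsilon> \<Longrightarrow> \<not> eigenvalue G s p \<Omega> \<nu>"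
    using first_eigenvalue_isolated by blast
  then show ?thesis
    using first_eigenfunction_sign first_eigenfunctions_proportional simple changing by blast
qed

end
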